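(* Let $r,s,t\ge 2$ be integers such that $t\ge s$ and such that either ($t\ge s^2-2s+3$ and $r\ge s+1$) or $r\ge s+2$. There exist constants $c,C>0$ such that for every function $0<p=p(n)\le 1$: (1) if $p\gg n^{-r+2-\frac{s+t-2}{st-1}}$, then a.a.s. $$\max\left\{c\,p\,n^{r-1},\ n^{2-\frac{s+t-2}{st-1}}(\log n)^{-C}\right\}\le \mathrm{ex}(G^r_{n,p},K_{s,t}^{(r)})\le \max\left\{C\,p\,n^{r-1},\ n^{2-\frac{s+t-2}{st-1}}(\log n)^{C}\right\};$$ (2) if $n^{-r}\ll p\ll n^{-r+2-\frac{s+t-2}{st-1}}$, then a.a.s. $\mathrm{ex}(G^r_{n,p},K_{s,t}^{(r)})=(1+o(1))\,p\binom{n}{r}$.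
   Context: An $r$-graph is a finite $r$-uniform hypergraph. For a graph $F$ and $r\ge 2$, the expansion $F^{(r)}$ is the $r$-graph obtained by inserting $r-2$ new vertices into each edge of $F$, all new vertices (over all edges) being distinct. $K_{s,t}$ is the complete bipartite graph with parts of sizes $s$ and $t$. $G^r_{n,p}$ is the random $r$-graph on $n$ vertices in which each $r$-set is an edge independently with probability $p$. $\mathrm{ex}(G^r_{n,p},F)$ is the maximum number of edges in an $F$-free subgraph of $G^r_{n,p}$. Events $A_n$ hold a.a.s. if $\Pr[A_n]\to1$ as $n\to\infty$. $f(n)\ll g(n)$ (equivalently $g\gg f$) means $f(n)/g(n)\to0$. *)

theory Defs
  imports "HOL-Probability.Probability" "HOL-Probability.Product_PMF"
begin

type_synonym 'a hypergraph = "'a set \<times> 'a set set"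

abbreviation verts :: "'a hypergraph \<Rightarrow> 'a set" where "verts \<equiv> fst"
abbreviation edges :: "'a hypergraph \<Rightarrow> 'a set set" where "edges \<equiv> snd"

definition is_rgraph :: "nat \<Rightarrow> 'a hypergraph \<Rightarrow> bool" where
  "is_rgraph r H \<longleftrightarrow> finite (verts H) \<and> (\<forall>e\<in>edges H. e \<subseteq> verts H \<and> card e = r)"

definition subhypergraph :: "'a hypergraph \<Rightarrow> 'a hypergraph \<Rightarrow> bool" where
  "subhypergraph H G \<longleftrightarrow>
     verts H \<subseteq> verts G \<and> edges H \<subseteq> edges G \<and> (\<forall>e\<in>edges H. e \<subseteq> verts H)"

text \<open>Copies are not required to be induced.\<close>

definition contains_copy :: "'a hypergraph \<Rightarrow> 'b hypergraph \<Rightarrow> bool" where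
  "contains_copy H F \<longleftrightarrow>
     (\<exists>f. inj_on f (verts F) \<and> f ` verts F \<subseteq> verts H \<and> (\<forall>e\<in>edges F. f ` e \<in> edges H))"

text \<open>For finite \<open>G\<close> and \<open>F\<close> with at least one edge, the maximum is over a finite
  nonempty set (the edgeless subgraph is always \<open>F\<close>-free).\<close>

definition ex_num :: "'a hypergraph \<Rightarrow> 'b hypergraph \<Rightarrow> nat" where
  "ex_num G F = Max {card (edges H) | H. subhypergraph H G \<and> \<not> contains_copy H F}"

definition complete_bipartite :: "nat \<Rightarrow> nat \<Rightarrow> (nat + nat) hypergraph" where
  "complete_bipartite s t =
     (Inl ` {..<s} \<union> Inr ` {..<t}, {{Inl i, Inr j} | i j. i < s \<and> j < t})"

text \<open>The vertices \<open>Inl v\<close> are those of \<open>F\<close>; the vertices \<open>Inr (e, 0), \<dots>, Inr (e, r - 3)\<close>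
  are the new ones inserted into the edge \<open>e\<close>.\<close>

definition expansion :: "nat \<Rightarrow> 'a hypergraph \<Rightarrow> ('a + 'a set \<times> nat) hypergraph" where
  "expansion r F =
     (Inl ` verts F \<union> Inr ` (edges F \<times> {..<r - 2}),
      (\<lambda>e. Inl ` e \<union> Inr ` ({e} \<times> {..<r - 2})) ` edges F)"

lemma is_rgraph_complete_bipartite: "is_rgraph 2 (complete_bipartite s t)"
  by (auto simp: is_rgraph_def complete_bipartite_def)

lemma is_rgraph_expansion:
  assumes "is_rgraph 2 F" "r \<ge> 2"
  shows "is_rgraph r (expansion r F)"
proof -
  have fin: "finite (verts F)" and F: "\<And>e. e \<in> edges F \<Longrightarrow> e \<subseteq> verts F \<and> card e = 2"
    using assms(1) by (auto simp: is_rgraph_def)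
  have "edges F \<subseteq> Pow (verts F)" using F by auto
  then have finE: "finite (edges F)" using fin finite_subset by blast
  have "card (Inl ` e \<union> Inr ` ({e} \<times> {..<r - 2})) = r" if "e \<in> edges F" for e
  proof -
    have "finite e" using F[OF that] fin finite_subset by blast
    then have "card (Inl ` e \<union> Inr ` ({e} \<times> {..<r - 2}))
        = card (Inl ` e :: ('a + 'a set \<times> nat) set)
          + card (Inr ` ({e} \<times> {..<r - 2}) :: ('a + 'a set \<times> nat) set)"
      by (intro card_Un_disjoint) auto
    also have "\<dots> = card e + card ({e} \<times> {..<r - 2})"
      by (simp add: card_image)
    finally show ?thesis
      using F[OF that] assms(2) by simp
  qed
  then show ?thesis
    using fin finE F by (fastforce simp: is_rgraph_def expansion_def)
qed

definition random_rgraph :: "nat \<Rightarrow> nat \<Rightarrow> real \<Rightarrow> nat hypergraph pmf" where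
  "random_rgraph r n p =
     map_pmf (\<lambda>X. ({..<n}, {e. e \<subseteq> {..<n} \<and> card e = r \<and> X e}))
       (Pi_pmf {e. e \<subseteq> {..<n} \<and> card e = r} False (\<lambda>_. bernoulli_pmf p))"

definition aas :: "(nat \<Rightarrow> 'a pmf) \<Rightarrow> (nat \<Rightarrow> 'a \<Rightarrow> bool) \<Rightarrow> bool" where
  "aas M A \<longleftrightarrow> (\<lambda>n. measure_pmf.prob (M n) {x. A n x}) \<longlonglongrightarrow> 1"

text \<open>\<open>X\<^sub>n = (1 + o(1)) a\<^sub>n\<close> a.a.s., with a deterministic error term bounding the relative deviation.\<close>

definition aas_asymp :: "(nat \<Rightarrow> 'a pmf) \<Rightarrow> (nat \<Rightarrow> 'a \<Rightarrow> real) \<Rightarrow> (nat \<Rightarrow> real) \<Rightarrow> bool" where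
  "aas_asymp M X a \<longleftrightarrow>
     (\<exists>\<delta>. \<delta> \<longlonglongrightarrow> 0 \<and> aas M (\<lambda>n x. \<bar>X n x - a n\<bar> \<le> \<delta> n * a n))"

definition much_less :: "(nat \<Rightarrow> real) \<Rightarrow> (nat \<Rightarrow> real) \<Rightarrow> bool" (infix "\<lless>" 50) where
  "f \<lless> g \<longleftrightarrow> (\<lambda>n. f n / g n) \<longlonglongrightarrow> 0"

end

theory Submission
  imports Defs "HOL-Real_Asymp.Real_Asymp"
begin

text \<open>The upper bound is a union bound over hypergraph containers. A container theorem for weighted
  hypergraphs reduces it to balanced supersaturation: every \<open>r\<close>-graph \<open>H\<close> with more than a constant
  times \<open>n ^ (r - 1)\<close> edges carries a nonzero weight on its copies of the expansion for which every
  set of \<open>j\<close> edges has relative degree at most \<open>polylog \<sdot> n powr ((2 - x) * (j - 1)) / card H ^ j\<close>,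
  where \<open>x = (s + t - 2) / (s * t - 1)\<close>. Iterating the containers down to size \<open>O(n ^ (r - 1))\<close>
  then costs only \<open>exp (n powr (2 - x) * polylog)\<close> of them.

  For supersaturation, first clean \<open>H\<close> so that every pair inside an edge has large codegree. Then a
  random \<open>K\<^sub>s\<^sub>,\<^sub>t\<close> formed of such pairs extends to a copy of the expansion by choosing for each pair a random
  edge containing it. Order the vertices of every edge and pass to a dyadic class of edges in which the
  codegree of the \<open>U\<close>-coordinates is about \<open>D U\<close>, for all \<open>U\<close>. If some pair of coordinates satisfies
  \<open>D {i, j} \<le> card H * n powr (\<delta>0 - 2)\<close> with \<open>\<delta>0 = (t - 1) / (s * t - 1)\<close>, there are so many pairs at
  these coordinates that stars in the graph of pairs, with regularised degrees, give a balanced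
  distribution. Otherwise all pairs are heavy; then some \<open>(r - 1)\<close>-set has a large link, and one puts
  the \<open>s\<close> side inside such a set and the \<open>t\<close> side in its link. The assumption on \<open>r\<close>, \<open>s\<close>, \<open>t\<close> is what
  keeps this second distribution balanced.

  The lower bounds come from all edges through one vertex, and from deleting an edge of every copy
  in a sparser random subset.\<close>

section \<open>Containers for weighted hypergraphs\<close>

text \<open>The admissible relative degrees are dictated by the container theorem: fingerprints of
  size \<open>m\<close> in a ground set of size \<open>N\<close> tolerate about
  \<open>(m / N) ^ (j - 1) / N\<close> for sets of size \<open>j\<close>. Here
  \<open>N = card H\<close>, and \<open>m\<close> is about \<open>n powr (2 - x)\<close>, the number
  of edges at the density where edges and copies are equally frequent. The exponents come from a
  model computation. A graph with \<open>n powr (2 - \<delta>0)\<close> pairs has degrees about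
  \<open>n powr (1 - \<delta>0)\<close>, and \<open>s\<close> vertices have about
  \<open>n powr \<epsilon>\<close> common neighbours, where \<epsilon> = x - \<delta>0. With these
  values the balance condition holds with equality for a single edge, for a star with
  \<open>t\<close> edges and for the whole complete bipartite graph, so there is no room in the
  choice of \<delta>0. The obstacle in the link construction is that one tuple of
  \<open>r - 1\<close> vertices serves the whole \<open>s\<close> side. If \<open>r = s + 1\<close>
  it is used up: the \<open>s\<close> side and one vertex of the \<open>t\<close> side already form
  an edge, so prescribing them gains nothing from the size of the link, and the required inequality
  then asks for \<open>t > s\<close>.\<close>

definition wdeg :: "'a set \<Rightarrow> ('a set \<Rightarrow> real) \<Rightarrow> 'a set \<Rightarrow> real" where
  "wdeg V w S = (\<Sum>e | e \<subseteq> V \<and> S \<subseteq> e. w e)"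

lemma finite_wdeg_index: "finite V \<Longrightarrow> finite {e. e \<subseteq> V \<and> P e}"
  by (rule finite_subset[of _ "Pow V"]) auto

lemma wdeg_nonneg: "(\<And>e. 0 \<le> w e) \<Longrightarrow> 0 \<le> wdeg V w S"
  unfolding wdeg_def by (rule sum_nonneg) auto

lemma wdeg_mono: "(\<And>e. w e \<le> w' e) \<Longrightarrow> wdeg V w S \<le> wdeg V w' S"
  unfolding wdeg_def by (rule sum_mono) auto

lemma wdeg_add: "wdeg V (\<lambda>e. w e + w' e) S = wdeg V w S + wdeg V w' S"
  unfolding wdeg_def by (rule sum.distrib)

text \<open>The function on the left is the weighted link of \<open>v\<close>; deleting
  \<open>v\<close> matches the sets over \<open>insert v S\<close> with the sets over
  \<open>S\<close> that avoid \<open>v\<close>.\<close>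

lemma wdeg_link:
  assumes "finite V" "v \<in> V"
  shows "wdeg V (\<lambda>e. if v \<in> e then 0 else w (insert v e)) S
    = (if v \<in> S then 0 else wdeg V w (insert v S))"
proof (cases "v \<in> S")
  case True
  then show ?thesis unfolding wdeg_def by (auto intro!: sum.neutral)
next
  case False
  have "wdeg V (\<lambda>e. if v \<in> e then 0 else w (insert v e)) S
      = (\<Sum>e | e \<subseteq> V \<and> S \<subseteq> e \<and> v \<notin> e. w (insert v e))"
    unfolding wdeg_def
    by (rule sum.mono_neutral_cong_right) (auto intro: finite_wdeg_index assms(1))
  also have "\<dots> = (\<Sum>e | e \<subseteq> V \<and> insert v S \<subseteq> e. w e)"
    using assms False
    by (intro sum.reindex_bij_witness[where i="\<lambda>e. e - {v}" and j="insert v"]) (auto simp: insert_absorb)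
  finally show ?thesis using False by (simp add: wdeg_def)
qed

lemma sum_wdeg_singleton:
  fixes w :: "'a set \<Rightarrow> real"
  assumes "finite V"
  shows "(\<Sum>v\<in>V. wdeg V w {v}) = (\<Sum>e\<in>Pow V. card e * w e)"
proof -
  have "(\<Sum>v\<in>V. wdeg V w {v}) = (\<Sum>v\<in>V. \<Sum>e\<in>Pow V. if v \<in> e then w e else 0)"
    unfolding wdeg_def using assms
    by (intro sum.cong refl sum.mono_neutral_cong_left) auto
  also have "\<dots> = (\<Sum>e\<in>Pow V. \<Sum>v\<in>V. if v \<in> e then w e else 0)"
    by (rule sum.swap)
  also have "\<dots> = (\<Sum>e\<in>Pow V. card e * w e)"
  proof (rule sum.cong[OF refl])
    fix e assume "e \<in> Pow V"
    then have "V \<inter> e = e" by auto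
    then show "(\<Sum>v\<in>V. if v \<in> e then w e else 0) = card e * w e"
      using assms by (simp add: sum.If_cases)
  qed
  finally show ?thesis .
qed

text \<open>Each \<open>e\<close> is counted once per subset. For a \<open>k\<close>-uniform weight
  the degrees of all sets thus add up to \<open>2 ^ k\<close> times the total weight, which bounds
  all saturated sets at once; this is the origin of the factor \<open>2 ^ k\<close> in the
  saturation threshold.\<close>

lemma sum_wdeg:
  assumes "finite V"
  shows "(\<Sum>S\<in>Pow V. wdeg V w S) = (\<Sum>e\<in>Pow V. 2 ^ card e * w e)"
proof -
  have "(\<Sum>S\<in>Pow V. wdeg V w S) = (\<Sum>S\<in>Pow V. \<Sum>e\<in>Pow V. if S \<subseteq> e then w e else 0)"
    unfolding wdeg_def using assms
    by (intro sum.cong refl sum.mono_neutral_cong_left) auto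
  also have "\<dots> = (\<Sum>e\<in>Pow V. \<Sum>S\<in>Pow V. if S \<subseteq> e then w e else 0)"
    by (rule sum.swap)
  also have "\<dots> = (\<Sum>e\<in>Pow V. 2 ^ card e * w e)"
  proof (rule sum.cong[OF refl])
    fix e assume "e \<in> Pow V"
    then have "Pow V \<inter> {S. S \<subseteq> e} = Pow e" "finite e" using assms finite_subset by auto
    then show "(\<Sum>S\<in>Pow V. if S \<subseteq> e then w e else 0) = 2 ^ card e * w e"
      using assms by (simp add: sum.If_cases card_Pow)
  qed
  finally show ?thesis .
qed

text \<open>The state after processing the fingerprint \<open>vs\<close> is the remaining weight together with the
  accumulated link of the fingerprint. Sets lying over an \<open>S\<close> whose degree in the link exceeds
  \<open>thr S\<close> are discarded, which keeps the link balanced for the induction on the uniformity.\<close>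

primrec container_run ::
  "'a set \<Rightarrow> ('a set \<Rightarrow> real) \<Rightarrow> ('a set \<Rightarrow> real) \<Rightarrow> 'a list \<Rightarrow> ('a set \<Rightarrow> real) \<times> ('a set \<Rightarrow> real)" where
  "container_run V thr w [] = (w, \<lambda>_. 0)"
| "container_run V thr w (v # vs) =
    (let (w', u) = container_run V thr w vs;
         u' = (\<lambda>e. u e + (if v \<in> e then 0 else w' (insert v e)))
     in (\<lambda>e. if v \<in> e \<or> (\<exists>S. S \<noteq> {} \<and> S \<subseteq> e \<and> thr S < wdeg V u' S) then 0 else w' e, u'))"

abbreviation "rest V thr w vs \<equiv> fst (container_run V thr w vs)"
abbreviation "links V thr w vs \<equiv> snd (container_run V thr w vs)"

lemma links_Cons:
  "links V thr w (v # vs) =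
    (\<lambda>e. links V thr w vs e + (if v \<in> e then 0 else rest V thr w vs (insert v e)))"
  by (simp add: Let_def split_beta)

lemma rest_Cons:
  "rest V thr w (v # vs) =
    (\<lambda>e. if v \<in> e \<or> (\<exists>S. S \<noteq> {} \<and> S \<subseteq> e \<and> thr S < wdeg V (links V thr w (v # vs)) S)
         then 0 else rest V thr w vs e)"
  by (simp add: Let_def split_beta)

declare container_run.simps(2)[simp del]

section \<open>Invariants of a container run\<close>

lemma rest_bounds:
  assumes "\<And>e. 0 \<le> w e"
  shows "0 \<le> rest V thr w vs e" "rest V thr w vs e \<le> w e"
proof -
  have "0 \<le> rest V thr w vs e \<and> rest V thr w vs e \<le> w e"
    by (induction vs) (use assms in \<open>auto simp: rest_Cons\<close>)
  then show "0 \<le> rest V thr w vs e" "rest V thr w vs e \<le> w e" by auto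
qed

lemma links_nonneg: "(\<And>e. 0 \<le> w e) \<Longrightarrow> 0 \<le> links V thr w vs e"
  by (induction vs arbitrary: e) (auto simp: links_Cons rest_bounds intro!: add_nonneg_nonneg)

lemma links_supp:
  assumes "\<And>e. 0 \<le> w e" "links V thr w vs e \<noteq> 0"
  obtains v where "v \<in> set vs" "v \<notin> e" "w (insert v e) > 0"
proof -
  have "\<exists>v\<in>set vs. v \<notin> e \<and> w (insert v e) > 0"
    using assms(2)
  proof (induction vs)
    case (Cons v vs)
    show ?case
    proof (cases "links V thr w vs e = 0")
      case True
      then have "v \<notin> e" "rest V thr w vs (insert v e) \<noteq> 0"
        using Cons.prems by (auto simp: links_Cons split: if_splits)
      then show ?thesis
        using rest_bounds[where w=w and V=V and thr=thr and vs=vs and e="insert v e", OF assms(1)]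
        by (intro bexI[of _ v]) auto
    qed (use Cons in auto)
  qed auto
  then show ?thesis using that by auto
qed

lemma wdeg_links_mono:
  assumes "\<And>e. 0 \<le> w e"
  shows "wdeg V (links V thr w vs) S \<le> wdeg V (links V thr w (v # vs)) S"
  by (rule wdeg_mono) (simp add: links_Cons rest_bounds assms)

text \<open>A set becomes saturated at some step of the run, and the same step clears the remaining
  weight over it. The condition \<open>0 \<le> thr S\<close> excludes saturation before the first
  step, when the link is zero.\<close>

lemma rest_eq_0:
  assumes "\<And>e. 0 \<le> w e" "S \<noteq> {}" "S \<subseteq> e" "thr S < wdeg V (links V thr w vs) S" "0 \<le> thr S"
  shows "rest V thr w vs e = 0"
proof (cases vs)
  case Nil
  then show ?thesis using assms by (auto simp: wdeg_def)
qed (use assms in \<open>auto simp: rest_Cons\<close>)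

text \<open>Link degrees only grow along a run, so a set that was saturated when \<open>e\<close>
  was discarded is still saturated at the end.\<close>

lemma rest_neq:
  assumes "\<And>e. 0 \<le> w e" "rest V thr w vs e \<noteq> w e"
  shows "(\<exists>v\<in>set vs. v \<in> e) \<or> (\<exists>S. S \<noteq> {} \<and> S \<subseteq> e \<and> thr S < wdeg V (links V thr w vs) S)"
  using assms(2)
proof (induction vs)
  case (Cons v vs)
  show ?case
  proof (cases "rest V thr w vs e = w e")
    case True
    then show ?thesis using Cons.prems by (auto simp: rest_Cons split: if_splits)
  next
    case False
    then have "(\<exists>v\<in>set vs. v \<in> e) \<or> (\<exists>S. S \<noteq> {} \<and> S \<subseteq> e \<and> thr S < wdeg V (links V thr w vs) S)"
      by (rule Cons.IH)
    then show ?thesis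
      using wdeg_links_mono[where w=w and V=V and thr=thr and vs=vs and v=v, OF assms(1)]
      by (meson less_le_trans list.set_intros(2))
  qed
qed auto

text \<open>The overshoot is a single increment: the step that takes \<open>S\<close> above
  \<open>thr S\<close> adds at most \<open>b\<close>, and afterwards no remaining weight lies over
  \<open>S\<close>, so the link gains nothing more there.\<close>

lemma wdeg_links_le:
  assumes "finite V" "set vs \<subseteq> V" "\<And>e. 0 \<le> w e" "S \<noteq> {}" "0 \<le> thr S" "0 \<le> b"
    and b: "\<And>v. v \<in> V \<Longrightarrow> v \<notin> S \<Longrightarrow> wdeg V w (insert v S) \<le> b"
  shows "wdeg V (links V thr w vs) S \<le> thr S + b"
  using assms(2)
proof (induction vs)
  case Nil
  then show ?case using assms by (simp add: wdeg_def)
next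
  case (Cons v vs)
  then have v: "v \<in> V" by simp
  have eq: "wdeg V (links V thr w (v # vs)) S = wdeg V (links V thr w vs) S
      + (if v \<in> S then 0 else wdeg V (rest V thr w vs) (insert v S))"
    unfolding links_Cons wdeg_add wdeg_link[OF assms(1) v] ..
  show ?case
  proof (cases "thr S < wdeg V (links V thr w vs) S")
    case True
    have "wdeg V (rest V thr w vs) (insert v S) = 0"
      unfolding wdeg_def
      using rest_eq_0[where w=w and S=S and thr=thr and V=V and vs=vs, OF assms(3,4) _ True assms(5)]
      by (intro sum.neutral) auto
    then show ?thesis using eq Cons by auto
  next
    case False
    have "wdeg V (rest V thr w vs) (insert v S) \<le> b" if "v \<notin> S"
      by (rule order_trans[OF wdeg_mono b[OF v that]]) (rule rest_bounds(2)[OF assms(3)])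
    then show ?thesis using eq False assms(6) by (auto split: if_splits)
  qed
qed

lemma wdeg_links_empty:
  assumes "finite V" "v \<in> V"
  shows "wdeg V (links V thr w (v # vs)) {} = wdeg V (links V thr w vs) {} + wdeg V (rest V thr w vs) {v}"
  unfolding links_Cons wdeg_add wdeg_link[OF assms] by simp

text \<open>Each step picks the element of \<open>I\<close> of largest remaining degree, and this
  degree is what the total link weight gains. Remaining degrees only decrease, so after
  \<open>m\<close> steps \<open>m\<close> times any current degree in \<open>I\<close> is at most
  the sum of the gains. All picks lie in \<open>I\<close>, so the list is a fingerprint of
  \<open>I\<close>; its head is the latest pick.\<close>

lemma greedy_run:
  assumes "finite V" "I \<subseteq> V" "\<And>e. 0 \<le> w e"
  shows "\<exists>vs. length vs \<le> m \<and> set vs \<subseteq> I \<and>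
    (\<forall>v\<in>I. m * wdeg V (rest V thr w vs) {v} \<le> wdeg V (links V thr w vs) {})"
proof (induction m)
  case 0
  show ?case by (intro exI[of _ "[]"]) (auto simp: wdeg_def)
next
  case (Suc m)
  then obtain vs where vs: "length vs \<le> m" "set vs \<subseteq> I"
    "\<And>v. v \<in> I \<Longrightarrow> m * wdeg V (rest V thr w vs) {v} \<le> wdeg V (links V thr w vs) {}"
    by auto
  show ?case
  proof (cases "I = {}")
    case True
    then show ?thesis by (intro exI[of _ "[]"]) auto
  next
    case False
    have fin: "finite I" using assms finite_subset by auto
    define f where "f v = wdeg V (rest V thr w vs) {v}" for v
    have "Max (f ` I) \<in> f ` I" by (rule Max_in) (use fin False in auto)
    then obtain v where vI: "v \<in> I" and "Max (f ` I) = f v" by (rule imageE)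
    moreover have "f v' \<le> Max (f ` I)" if "v' \<in> I" for v'
      by (rule Max_ge) (use fin that in auto)
    ultimately have "f v' \<le> f v" if "v' \<in> I" for v' using that by simp
    then have v: "v \<in> I" "\<And>v'. v' \<in> I \<Longrightarrow> wdeg V (rest V thr w vs) {v'} \<le> wdeg V (rest V thr w vs) {v}"
      using vI by (simp_all add: f_def)
    have "Suc m * wdeg V (rest V thr w (v # vs)) {v'} \<le> wdeg V (links V thr w (v # vs)) {}"
      if "v' \<in> I" for v'
    proof -
      have "wdeg V (rest V thr w (v # vs)) {v'} \<le> wdeg V (rest V thr w vs) {v'}"
        by (rule wdeg_mono) (simp add: rest_Cons rest_bounds(1)[OF assms(3)])
      also have "\<dots> \<le> wdeg V (rest V thr w vs) {v}" using v that by auto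
      finally have "Suc m * wdeg V (rest V thr w (v # vs)) {v'} \<le> Suc m * wdeg V (rest V thr w vs) {v}"
        by (intro mult_left_mono) auto
      also have "\<dots> \<le> wdeg V (links V thr w (v # vs)) {}"
        using vs(3)[OF v(1)] wdeg_links_empty[OF assms(1), of v] v(1) assms(2)
        by (auto simp: algebra_simps)
      finally show ?thesis .
    qed
    then show ?thesis using vs v by (intro exI[of _ "v # vs"]) auto
  qed
qed


text \<open>The alternative is whether the link of the fingerprint has collected weight
  \<open>\<tau> * W / 4\<close>. If it has, it is a balanced \<open>k\<close>-uniform weight for
  which \<open>I\<close> is still independent. If it has not, the greedy choice makes every
  remaining degree in \<open>I\<close> small, while half of the weight is still present; a set of
  vertices of small degree then misses a fixed proportion of \<open>V\<close>.\<close>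

lemma container_step:
  fixes w :: "'a set \<Rightarrow> real" and B W :: real and m N k :: nat
  defines "\<tau> \<equiv> real m / real N"
  defines "thr \<equiv> \<lambda>S::'a set. 2 ^ k * (B * W / N * \<tau> ^ card S)"
  assumes finV: "finite V" and N: "card V = N" "N > 0" and m: "m \<ge> 1" and B: "B > 0"
    and w: "\<And>e. 0 \<le> w e" "\<And>e. w e \<noteq> 0 \<Longrightarrow> e \<subseteq> V \<and> card e = Suc k"
    and W: "wdeg V w {} = W" "W > 0"
    and deg: "\<And>S. S \<subseteq> V \<Longrightarrow> S \<noteq> {} \<Longrightarrow> wdeg V w S \<le> B * W / N * \<tau> ^ (card S - 1)"
    and small: "4 * m * B \<le> N"
    and I: "I \<subseteq> V" "\<And>e. e \<subseteq> I \<Longrightarrow> w e = 0"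
  obtains vs where "length vs \<le> m" "set vs \<subseteq> V"
    "I \<subseteq> {v \<in> V. m * wdeg V (rest V thr w vs) {v} \<le> \<tau> * W / 4}"
    "card {v \<in> V. m * wdeg V (rest V thr w vs) {v} \<le> \<tau> * W / 4} + N / (4 * B) \<le> N"
  | vs where "length vs \<le> m" "set vs \<subseteq> V" "wdeg V (links V thr w vs) {} > 0"
    "\<And>e. links V thr w vs e \<noteq> 0 \<Longrightarrow> e \<subseteq> V \<and> card e = k"
    "\<And>S. S \<subseteq> V \<Longrightarrow> S \<noteq> {} \<Longrightarrow> wdeg V (links V thr w vs) S
      \<le> 2 ^ (k + 3) * B * wdeg V (links V thr w vs) {} / N * \<tau> ^ (card S - 1)"
    "\<And>e. e \<subseteq> I \<Longrightarrow> links V thr w vs e = 0"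
proof -
  have \<tau>: "\<tau> > 0" using m N by (simp add: \<tau>_def)
  have thr0: "0 \<le> thr S" for S using \<tau> B W by (simp add: thr_def)
  obtain vs where vs: "length vs \<le> m" "set vs \<subseteq> I"
    "\<And>v. v \<in> I \<Longrightarrow> m * wdeg V (rest V thr w vs) {v} \<le> wdeg V (links V thr w vs) {}"
    using exE[OF greedy_run[where w=w and m=m and thr=thr, OF finV I(1) w(1)]] by metis
  have vsV: "set vs \<subseteq> V" using vs I by auto
  define U where "U = wdeg V (links V thr w vs) {}"
  define u where "u = links V thr w vs"
  define w' where "w' = rest V thr w vs"
  have u0: "0 \<le> u e" for e unfolding u_def by (rule links_nonneg[OF w(1)])
  have w'0: "0 \<le> w' e" "w' e \<le> w e" for e unfolding w'_def by (rule rest_bounds[OF w(1)])+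
  \<comment> \<open>\<open>I\<close> stays independent for the link: a set
    \<open>e \<subseteq> I\<close> in its support would give \<open>insert v e \<subseteq> I\<close>
    of positive weight, because the fingerprint lies in \<open>I\<close>.\<close>
  have usupp: "e \<subseteq> V \<and> card e = k \<and> \<not> e \<subseteq> I" if ue: "u e \<noteq> 0" for e
  proof -
    obtain v where v: "v \<in> set vs" "v \<notin> e" "w (insert v e) > 0"
      using links_supp[where w=w and V=V and thr=thr and vs=vs and e=e, OF w(1)] ue unfolding u_def by metis
    then have "insert v e \<subseteq> V" "card (insert v e) = Suc k" using w(2)[of "insert v e"] by auto
    moreover have "finite e" using calculation finV by (meson finite_subset subset_insertI2 finite_insert)
    moreover have "\<not> insert v e \<subseteq> I" using I(2)[of "insert v e"] v by auto
    ultimately show ?thesis using v vs(2) by auto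
  qed
  show thesis
  proof (cases "\<tau> * W / 4 \<le> U")
    case True
    have Upos: "U > 0" using True \<tau> W by (smt (verit) divide_pos_pos mult_pos_pos)
    show thesis
    proof (rule that(2)[OF vs(1) vsV])
      show "wdeg V (links V thr w vs) {} > 0" using Upos by (simp add: U_def)
      show "e \<subseteq> V \<and> card e = k" if "links V thr w vs e \<noteq> 0" for e
        using usupp that by (auto simp: u_def)
      show "links V thr w vs e = 0" if "e \<subseteq> I" for e
        using usupp that by (auto simp: u_def)
      fix S assume S: "S \<subseteq> V" "S \<noteq> {}"
      have fS: "finite S" using S finV finite_subset by auto
      have cS: "card S = Suc (card S - 1)" using S fS by (simp add: card_gt_0_iff)
      have "wdeg V (links V thr w vs) S \<le> thr S + B * W / N * \<tau> ^ card S"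
      proof (rule wdeg_links_le[OF finV vsV w(1) S(2) thr0])
        show "0 \<le> B * W / N * \<tau> ^ card S" using \<tau> B W by simp
        show "wdeg V w (insert v S) \<le> B * W / N * \<tau> ^ card S" if "v \<in> V" "v \<notin> S" for v
          using deg[of "insert v S"] S that fS by simp
      qed
      also have "\<dots> \<le> 2 ^ (k + 1) * (B * W / N * \<tau> ^ card S)"
      proof -
        have "(1::real) \<le> 2 ^ k" by simp
        then have "1 * (B * W / N * \<tau> ^ card S) \<le> 2 ^ k * (B * W / N * \<tau> ^ card S)"
          using \<tau> B W by (intro mult_right_mono) auto
        moreover have "2 ^ (k + 1) * (B * W / N * \<tau> ^ card S)
            = 2 ^ k * (B * W / N * \<tau> ^ card S) + 2 ^ k * (B * W / N * \<tau> ^ card S)"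
          by simp
        ultimately show ?thesis unfolding thr_def by linarith
      qed
      also have "\<dots> = 2 ^ (k + 1) * B / N * \<tau> ^ (card S - 1) * (\<tau> * W)"
        by (subst cS) (simp add: field_simps)
      also have "\<dots> \<le> 2 ^ (k + 1) * B / N * \<tau> ^ (card S - 1) * (4 * U)"
        using True \<tau> B by (intro mult_left_mono) auto
      also have "\<dots> = 2 ^ (k + 3) * B * U / N * \<tau> ^ (card S - 1)"
        by (simp add: power_add field_simps)
      finally show "wdeg V (links V thr w vs) S \<le> 2 ^ (k + 3) * B * wdeg V (links V thr w vs) {} / N * \<tau> ^ (card S - 1)"
        by (simp add: U_def)
    qed
  next
    case False
    \<comment> \<open>For given \<open>w\<close> and parameters this set depends on \<open>I\<close>
      only through the fingerprint \<open>vs\<close>, so there are no more such containers than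
      fingerprints.\<close>
    define C where "C = {v \<in> V. m * wdeg V w' {v} \<le> \<tau> * W / 4}"
    have IC: "I \<subseteq> C"
      using vs(3) False I(1) by (force simp: C_def w'_def U_def)
    have D1: "wdeg V w {v} \<le> B * W / N" if "v \<in> V" for v
      using deg[of "{v}"] that by simp
    have removed: "wdeg V w {} - wdeg V w' {} \<le> W / 2"
    proof -
      \<comment> \<open>Weight is lost for two reasons only, by meeting the fingerprint or by lying
        over a saturated set. Each accounts for at most \<open>W / 4\<close>.\<close>
      define Sat where "Sat = {S \<in> Pow V. S \<noteq> {} \<and> thr S < wdeg V u S}"
      have finSat: "finite Sat" using finV by (simp add: Sat_def)
      have "wdeg V w {} - wdeg V w' {} = (\<Sum>e\<in>Pow V. w e - w' e)"
        unfolding wdeg_def by (simp add: sum_subtractf Pow_def)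
      also have "\<dots> \<le> (\<Sum>e\<in>Pow V. (\<Sum>v\<in>set vs. if v \<in> e then w e else 0) + (\<Sum>S\<in>Sat. if S \<subseteq> e then w e else 0))"
      proof (rule sum_mono)
        fix e assume e: "e \<in> Pow V"
        let ?A = "(\<Sum>v\<in>set vs. if v \<in> e then w e else 0)"
        let ?B = "(\<Sum>S\<in>Sat. if S \<subseteq> e then w e else 0)"
        have nn: "0 \<le> ?A" "0 \<le> ?B" using w(1) by (auto intro!: sum_nonneg)
        show "w e - w' e \<le> ?A + ?B"
        proof (cases "w' e = w e")
          case False
          then consider v where "v \<in> set vs" "v \<in> e" | S where "S \<noteq> {}" "S \<subseteq> e" "thr S < wdeg V u S"
            using rest_neq[where w=w and V=V and thr=thr and vs=vs and e=e, OF w(1)] unfolding w'_def u_def by blast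
          then show ?thesis
          proof cases
            case 1
            then have "w e \<le> ?A"
              using member_le_sum[of v "set vs" "\<lambda>v. if v \<in> e then w e else 0"] w(1) by auto
            then show ?thesis using nn w'0[of e] by linarith
          next
            case 2
            then have "S \<in> Sat" using e by (auto simp: Sat_def)
            then have "w e \<le> ?B"
              using member_le_sum[of S Sat "\<lambda>S. if S \<subseteq> e then w e else 0"] w(1) finSat 2 by auto
            then show ?thesis using nn w'0[of e] by linarith
          qed
        qed (use nn in auto)
      qed
      also have "\<dots> = (\<Sum>v\<in>set vs. wdeg V w {v}) + (\<Sum>S\<in>Sat. wdeg V w S)"
      proof -
        have "wdeg V w S = (\<Sum>e\<in>Pow V. if S \<subseteq> e then w e else 0)" for S
          unfolding wdeg_def using finV by (intro sum.mono_neutral_cong_left) auto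
        then show ?thesis
          by (simp add: sum.distrib sum.swap[of _ _ "Pow V"])
      qed
      also have "(\<Sum>v\<in>set vs. wdeg V w {v}) \<le> W / 4"
      proof -
        have "(\<Sum>v\<in>set vs. wdeg V w {v}) \<le> card (set vs) * (B * W / N)"
          using sum_mono[of "set vs" "\<lambda>v. wdeg V w {v}" "\<lambda>_. B * W / N"] D1 vsV by auto
        also have "\<dots> \<le> m * (B * W / N)"
          using card_length[of vs] vs(1) B W by (intro mult_right_mono) auto
        also have "\<dots> \<le> W / 4" using mult_right_mono[OF small, of W] W N by (simp add: field_simps)
        finally show ?thesis .
      qed
      \<comment> \<open>For a saturated \<open>S\<close> the degree in \<open>w\<close> is at most
        the link degree divided by \<open>2 ^ k * \<tau>\<close>. The link degrees of all sets add
        up to \<open>2 ^ k * U\<close>, and \<open>U / \<tau>\<close> is below \<open>W / 4\<close>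
        in this case.\<close>
      also have "(\<Sum>S\<in>Sat. wdeg V w S) \<le> W / 4"
      proof -
        have "(\<Sum>S\<in>Sat. wdeg V w S) \<le> (\<Sum>S\<in>Sat. wdeg V u S / (2 ^ k * \<tau>))"
        proof (rule sum_mono)
          fix S assume "S \<in> Sat"
          then have S: "S \<subseteq> V" "S \<noteq> {}" "thr S < wdeg V u S" by (auto simp: Sat_def)
          have cS: "card S = Suc (card S - 1)" using S finV finite_subset by (metis Suc_pred' card_gt_0_iff)
          have "wdeg V w S \<le> B * W / N * \<tau> ^ (card S - 1)" using deg S by auto
          also have "\<dots> = thr S / (2 ^ k * \<tau>)"
            unfolding thr_def using \<tau> by (subst (2) cS) (simp add: field_simps)
          also have "\<dots> \<le> wdeg V u S / (2 ^ k * \<tau>)"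
            using S(3) \<tau> by (intro divide_right_mono) auto
          finally show "wdeg V w S \<le> wdeg V u S / (2 ^ k * \<tau>)" .
        qed
        also have "\<dots> \<le> (\<Sum>S\<in>Pow V. wdeg V u S / (2 ^ k * \<tau>))"
          using finV \<tau> u0 by (intro sum_mono2) (auto simp: Sat_def intro!: wdeg_nonneg divide_nonneg_pos)
        also have "\<dots> = (\<Sum>e\<in>Pow V. 2 ^ card e * u e) / (2 ^ k * \<tau>)"
          by (simp add: sum_wdeg[OF finV] flip: sum_divide_distrib)
        also have "(\<Sum>e\<in>Pow V. 2 ^ card e * u e) = (\<Sum>e\<in>Pow V. 2 ^ k * u e)"
          using usupp by (intro sum.cong) auto
        also have "\<dots> = 2 ^ k * U"
          by (simp add: U_def u_def wdeg_def Pow_def sum_distrib_left)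
        also have "2 ^ k * U / (2 ^ k * \<tau>) = U / \<tau>" by simp
        also have "\<dots> \<le> W / 4" using False \<tau> by (simp add: field_simps)
        finally show ?thesis .
      qed
      finally show ?thesis by simp
    qed
    have "card C + N / (4 * B) \<le> N"
    proof -
      have CV: "C \<subseteq> V" by (auto simp: C_def)
      then have finC: "finite C" using finV finite_subset by auto
      have "W / 2 \<le> wdeg V w' {}" using removed W by simp
      also have "\<dots> \<le> (\<Sum>e\<in>Pow V. card e * w' e)"
      proof -
        have "w' e \<le> card e * w' e" for e
        proof (cases "w' e = 0")
          case False
          then have "card e = Suc k" using w(2)[of e] w'0[of e] by force
          moreover have "0 \<le> real k * w' e" using w'0 by simp
          ultimately show ?thesis by (simp add: algebra_simps)
        qed auto
        then show ?thesis unfolding wdeg_def by (simp add: Pow_def sum_mono)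
      qed
      also have "\<dots> = (\<Sum>v\<in>V. wdeg V w' {v})" by (simp add: sum_wdeg_singleton[OF finV])
      \<comment> \<open>The vertices in \<open>C\<close> carry at most \<open>W / 4\<close>
        together, so those outside carry at least as much; as no degree exceeds
        \<open>B * W / N\<close>, there are at least \<open>N / (4 * B)\<close> of them.\<close>
      also have "\<dots> = (\<Sum>v\<in>C. wdeg V w' {v}) + (\<Sum>v\<in>V - C. wdeg V w' {v})"
        using CV finV by (metis add.commute sum.subset_diff)
      also have "(\<Sum>v\<in>C. wdeg V w' {v}) \<le> W / 4"
      proof -
        have "wdeg V w' {v} \<le> W / (4 * N)" if "v \<in> C" for v
        proof -
          have "m * wdeg V w' {v} \<le> m / N * W / 4" using that by (simp add: C_def \<tau>_def)
          then show ?thesis using m N by (simp add: field_simps)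
        qed
        then have "(\<Sum>v\<in>C. wdeg V w' {v}) \<le> card C * (W / (4 * N))"
          using sum_mono[of C "\<lambda>v. wdeg V w' {v}" "\<lambda>_. W / (4 * N)"] by auto
        also have "\<dots> \<le> N * (W / (4 * N))"
          using card_mono[OF finV CV] N W by (intro mult_right_mono) auto
        finally show ?thesis using N by simp
      qed
      also have "(\<Sum>v\<in>V - C. wdeg V w' {v}) \<le> card (V - C) * (B * W / N)"
      proof -
        have "wdeg V w' {v} \<le> B * W / N" if "v \<in> V" for v
          using order_trans[OF wdeg_mono[OF w'0(2)] D1[OF that]] .
        then show ?thesis
          using sum_mono[of "V - C" "\<lambda>v. wdeg V w' {v}" "\<lambda>_. B * W / N"] by auto
      qed
      finally have "W / 4 \<le> card (V - C) * (B * W / N)" by linarith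
      then have "W * (N / (4 * B)) \<le> W * card (V - C)" using B N W by (simp add: field_simps)
      then have "N / (4 * B) \<le> card (V - C)" by (rule mult_left_le_imp_le[OF _ W(2)])
      also have "real (card (V - C)) = real N - real (card C)"
        using N card_mono[OF finV CV] by (simp add: card_Diff_subset[OF finC CV] of_nat_diff)
      finally show ?thesis by linarith
    qed
    then show thesis using that(1)[OF vs(1) vsV] IC by (simp add: C_def w'_def)
  qed
qed

section \<open>Counting fingerprints and induction on the uniformity\<close>

lemma card_lists_length_le_power:
  assumes "finite V"
  shows "card {xs. set xs \<subseteq> V \<and> length xs \<le> m} \<le> (card V + 1) ^ m"
proof -
  have "(\<Sum>i\<le>m. card V ^ i) \<le> (card V + 1) ^ m"
  proof (induction m)
    case (Suc m)
    have "card V ^ Suc m \<le> card V * (card V + 1) ^ m"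
      unfolding power_Suc by (intro mult_le_mono2 power_mono) auto
    from add_mono[OF Suc this] show ?case by (simp add: algebra_simps)
  qed auto
  then show ?thesis by (simp add: card_lists_length_le[OF assms])
qed

text \<open>A fingerprint either yields its own container or passes to its link, whose uniformity is
  smaller by one; this costs at most a factor of twice the number of fingerprints per level. When
  the uniformity drops to \<open>k\<close>, the balance constant grows by
  \<open>2 ^ (k + 3)\<close>, and the exponent \<open>k * (k + 3)\<close> collects these
  losses.\<close>

theorem weighted_container:
  fixes w :: "'a set \<Rightarrow> real" and B W :: real and m N k :: nat
  assumes finV: "finite V" and N: "card V = N" "N > 0" and m: "m \<ge> 1" and B: "B > 0"
    and w: "\<And>e. 0 \<le> w e" "\<And>e. w e \<noteq> 0 \<Longrightarrow> e \<subseteq> V \<and> card e = k"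
    and W: "wdeg V w {} = W" "W > 0"
    and deg: "\<And>S. S \<subseteq> V \<Longrightarrow> S \<noteq> {} \<Longrightarrow> wdeg V w S \<le> B * W / N * (m / N) ^ (card S - 1)"
    and small: "4 * m * B * 2 ^ (k * (k + 3)) \<le> N"
  shows "\<exists>\<C>. finite \<C> \<and> card \<C> \<le> (2 * (N + 1) ^ m) ^ k \<and>
    (\<forall>C\<in>\<C>. C \<subseteq> V \<and> card C + N / (4 * B * 2 ^ (k * (k + 3))) \<le> N) \<and>
    (\<forall>I. I \<subseteq> V \<and> (\<forall>e. e \<subseteq> I \<longrightarrow> w e = 0) \<longrightarrow> (\<exists>C\<in>\<C>. I \<subseteq> C))"
  using B w W deg small
proof (induction k arbitrary: w B W)
  case 0
  have "w e = 0" if "e \<noteq> {}" for e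
    using 0(3)[of e] that finV finite_subset[of e V] by auto
  then have "wdeg V w {} = w {}"
    unfolding wdeg_def using finV by (subst sum.remove[of _ "{}"]) auto
  \<comment> \<open>At uniformity zero the weight sits on the empty set, which lies in every
    \<open>I\<close>; no set is independent, and the empty family of containers will do.\<close>
  then have "\<not> (\<forall>e. e \<subseteq> I \<longrightarrow> w e = 0)" for I
    using 0 by auto
  then show ?case by (intro exI[of _ "{}"]) auto
next
  case (Suc k)
  define \<tau> where "\<tau> = real m / real N"
  define thr where "thr = (\<lambda>S::'a set. 2 ^ k * (B * W / N * \<tau> ^ card S))"
  define C where "C vs = {v \<in> V. m * wdeg V (rest V thr w vs) {v} \<le> \<tau> * W / 4}" for vs
  define L where "L = {vs. set vs \<subseteq> V \<and> length vs \<le> m}"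
  define L1 where "L1 = {vs \<in> L. card (C vs) + N / (4 * B) \<le> N}"
  define B' where "B' = 2 ^ (k + 3) * B"
  define good where "good vs \<longleftrightarrow> wdeg V (links V thr w vs) {} > 0 \<and>
    (\<forall>e. links V thr w vs e \<noteq> 0 \<longrightarrow> e \<subseteq> V \<and> card e = k) \<and>
    (\<forall>S. S \<subseteq> V \<longrightarrow> S \<noteq> {} \<longrightarrow> wdeg V (links V thr w vs) S
      \<le> B' * wdeg V (links V thr w vs) {} / N * \<tau> ^ (card S - 1))" for vs
  define L2 where "L2 = {vs \<in> L. good vs}"
  define \<delta> where "\<delta> = N / (4 * B * 2 ^ (Suc k * (Suc k + 3)))"
  define q where "q = 2 * (N + 1) ^ m"
  have finL: "finite L" and cardL: "card L \<le> (N + 1) ^ m"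
    using card_lists_length_le_power[OF finV] N finite_lists_length_le[OF finV] by (auto simp: L_def)
  \<comment> \<open>The exponents satisfy
    \<open>(k + 3) + k * (k + 3) \<le> (k + 1) * (k + 4)\<close>.\<close>
  have exps: "B' * 2 ^ (k * (k + 3)) \<le> B * 2 ^ (Suc k * (Suc k + 3))"
    using Suc.prems(1) unfolding B'_def
    by (simp add: power_add[symmetric] algebra_simps power_increasing)
  have ex: "\<exists>\<C>. finite \<C> \<and> card \<C> \<le> q ^ k \<and>
    (\<forall>C\<in>\<C>. C \<subseteq> V \<and> card C + N / (4 * B' * 2 ^ (k * (k + 3))) \<le> N) \<and>
    (\<forall>I. I \<subseteq> V \<and> (\<forall>e. e \<subseteq> I \<longrightarrow> links V thr w vs e = 0) \<longrightarrow> (\<exists>C\<in>\<C>. I \<subseteq> C))"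
    if "vs \<in> L2" for vs
    unfolding q_def
  proof (rule Suc.IH)
    show "B' > 0" using Suc.prems(1) by (simp add: B'_def)
    show "\<And>e. 0 \<le> links V thr w vs e" by (rule links_nonneg[OF Suc.prems(2)])
    have "4 * m * (B' * 2 ^ (k * (k + 3))) \<le> 4 * m * (B * 2 ^ (Suc k * (Suc k + 3)))"
      by (intro mult_left_mono exps) auto
    then show "4 * m * B' * 2 ^ (k * (k + 3)) \<le> N" using Suc.prems(7) by (simp only: mult.assoc)
  qed (use that in \<open>auto simp: L2_def good_def \<tau>_def\<close>)
  then obtain F where F: "\<And>vs. vs \<in> L2 \<Longrightarrow> finite (F vs) \<and> card (F vs) \<le> q ^ k \<and>
    (\<forall>C\<in>F vs. C \<subseteq> V \<and> card C + N / (4 * B' * 2 ^ (k * (k + 3))) \<le> N) \<and>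
    (\<forall>I. I \<subseteq> V \<and> (\<forall>e. e \<subseteq> I \<longrightarrow> links V thr w vs e = 0) \<longrightarrow> (\<exists>C\<in>F vs. I \<subseteq> C))"
    by metis
  have \<delta>1: "\<delta> \<le> N / (4 * B)"
    unfolding \<delta>_def using Suc.prems(1) by (intro divide_left_mono) (auto simp: mult_le_cancel_left1)
  have \<delta>2: "\<delta> \<le> N / (4 * B' * 2 ^ (k * (k + 3)))"
    unfolding \<delta>_def using Suc.prems(1) exps by (intro divide_left_mono) (auto simp: B'_def)
  let ?C = "C ` L1 \<union> (\<Union>vs\<in>L2. F vs)"
  have finL12: "finite L1" "finite L2" using finL by (auto simp: L1_def L2_def)
  have "card ?C \<le> card (C ` L1) + card (\<Union>vs\<in>L2. F vs)" by (rule card_Un_le)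
  also have "\<dots> \<le> card L1 + (\<Sum>vs\<in>L2. card (F vs))"
    by (intro add_mono card_image_le card_UN_le finL12)
  also have "\<dots> \<le> card L + (\<Sum>vs\<in>L2. q ^ k)"
    using F finL by (intro add_mono sum_mono card_mono) (auto simp: L1_def)
  also have "\<dots> \<le> card L + card L * q ^ k"
    using finL by (simp add: L2_def card_mono)
  also have "\<dots> \<le> card L * q ^ k + card L * q ^ k" by (simp add: q_def)
  also have "\<dots> = 2 * card L * q ^ k" by simp
  also have "\<dots> \<le> 2 * (N + 1) ^ m * q ^ k" using cardL by (intro mult_right_mono) auto
  also have "\<dots> = q ^ Suc k" by (simp add: q_def)
  finally have card: "card ?C \<le> q ^ Suc k" .
  have cover: "\<exists>C\<in>?C. I \<subseteq> C" if I: "I \<subseteq> V" "\<And>e. e \<subseteq> I \<Longrightarrow> w e = 0" for I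
  proof -
    have sm: "4 * m * B \<le> N"
    proof -
      have "4 * m * B \<le> 4 * m * B * 2 ^ (Suc k * (Suc k + 3))"
        using mult_left_mono[of 1 "2 ^ (Suc k * (Suc k + 3))" "4 * m * B"] Suc.prems(1) by simp
      then show ?thesis using Suc.prems(7) by linarith
    qed
    show ?thesis
    proof (rule container_step[where m=m and N=N and k=k and B=B and w=w and V=V and I=I and W=W,
          OF finV N m Suc.prems(1-6) sm I])
      fix vs assume "length vs \<le> m" "set vs \<subseteq> V"
        "I \<subseteq> {v \<in> V. m * wdeg V (rest V (\<lambda>S. 2 ^ k * (B * W / real N * (real m / real N) ^ card S)) w vs) {v} \<le> real m / real N * W / 4}"
        "card {v \<in> V. m * wdeg V (rest V (\<lambda>S. 2 ^ k * (B * W / real N * (real m / real N) ^ card S)) w vs) {v} \<le> real m / real N * W / 4} + N / (4 * B) \<le> N"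
      then have "vs \<in> L1" "I \<subseteq> C vs" by (auto simp: L1_def L_def C_def thr_def \<tau>_def)
      then show ?thesis by auto
    next
      fix vs
      let ?l = "links V (\<lambda>S. 2 ^ k * (B * W / real N * (real m / real N) ^ card S)) w vs"
      assume "length vs \<le> m" "set vs \<subseteq> V" "0 < wdeg V ?l {}"
        "\<And>e. ?l e \<noteq> 0 \<Longrightarrow> e \<subseteq> V \<and> card e = k"
        "\<And>S. S \<subseteq> V \<Longrightarrow> S \<noteq> {} \<Longrightarrow> wdeg V ?l S
          \<le> 2 ^ (k + 3) * B * wdeg V ?l {} / real N * (real m / real N) ^ (card S - 1)"
        "\<And>e. e \<subseteq> I \<Longrightarrow> ?l e = 0"
      then have vs: "vs \<in> L2" "\<forall>e. e \<subseteq> I \<longrightarrow> links V thr w vs e = 0"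
        by (auto simp: L2_def L_def good_def thr_def \<tau>_def B'_def)
      from F[OF vs(1)] have "I \<subseteq> V \<and> (\<forall>e. e \<subseteq> I \<longrightarrow> links V thr w vs e = 0) \<longrightarrow> (\<exists>C\<in>F vs. I \<subseteq> C)"
        by (elim conjE allE)
      then obtain D where "D \<in> F vs" "I \<subseteq> D" using I(1) vs(2) by auto
      then show ?thesis using vs(1) by (intro bexI[of _ D]) auto
    qed
  qed
  show ?case
  proof (intro exI[of _ ?C] conjI ballI allI impI)
    show "finite ?C" using finL12 F by auto
    show "card ?C \<le> (2 * (N + 1) ^ m) ^ Suc k" using card by (simp add: q_def)
    show "D \<subseteq> V" if "D \<in> ?C" for D using that F by (auto simp: C_def)
    show "card D + N / (4 * B * 2 ^ (Suc k * (Suc k + 3))) \<le> N" if "D \<in> ?C" for D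
    proof -
      have "card D + \<delta> \<le> N"
        using that
      proof
        assume "D \<in> C ` L1"
        then show ?thesis using \<delta>1 by (auto simp: L1_def)
      next
        assume "D \<in> (\<Union>vs\<in>L2. F vs)"
        then have "card D + N / (4 * B' * 2 ^ (k * (k + 3))) \<le> N" using F by blast
        then show ?thesis using \<delta>2 by linarith
      qed
      then show ?thesis by (simp add: \<delta>_def)
    qed
    show "\<exists>C\<in>?C. I \<subseteq> C" if "I \<subseteq> V \<and> (\<forall>e. e \<subseteq> I \<longrightarrow> w e = 0)" for I
      by (rule cover) (use that in auto)
  qed
qed

section \<open>Cleaning and dyadic classes\<close>

definition codeg :: "'a set set \<Rightarrow> 'a set \<Rightarrow> nat" where
  "codeg H S = card {e \<in> H. S \<subseteq> e}"

text \<open>While some \<open>S\<close> violates the bound, delete all edges over it. This costs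
  less than \<open>b S\<close>, and \<open>S\<close> never has to be treated again because no edge
  over it is left.\<close>

lemma ex_clean_subset:
  fixes b :: "'a set \<Rightarrow> real"
  assumes "finite H" "finite \<S>"
  shows "\<exists>H'\<subseteq>H. real (card H) \<le> card H' + (\<Sum>S\<in>\<S>. \<bar>b S\<bar>) \<and>
    (\<forall>S\<in>\<S>. \<forall>e\<in>H'. S \<subseteq> e \<longrightarrow> b S \<le> codeg H' S)"
  using assms(2,1)
proof (induction "card \<S>" arbitrary: \<S> H)
  case 0
  then show ?case by auto
next
  case (Suc k)
  show ?case
  proof (cases "\<forall>S\<in>\<S>. \<forall>e\<in>H. S \<subseteq> e \<longrightarrow> b S \<le> codeg H S")
    case True
    then show ?thesis by (intro exI[of _ H]) (auto intro: sum_nonneg)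
  next
    case False
    then obtain S where S: "S \<in> \<S>" "codeg H S < b S" by force
    let ?H = "{e \<in> H. \<not> S \<subseteq> e}"
    have "k = card (\<S> - {S})" using Suc S by simp
    from Suc(1)[OF this, of ?H] Suc obtain H' where H': "H' \<subseteq> ?H"
      "card ?H \<le> card H' + (\<Sum>S\<in>\<S> - {S}. \<bar>b S\<bar>)"
      "\<forall>S'\<in>\<S> - {S}. \<forall>e\<in>H'. S' \<subseteq> e \<longrightarrow> b S' \<le> codeg H' S'"
      by auto
    have "card H = card ?H + codeg H S"
      unfolding codeg_def using Suc(4) by (subst card_Un_disjoint[symmetric]) (auto intro: arg_cong[where f=card])
    moreover have "(\<Sum>S\<in>\<S>. \<bar>b S\<bar>) = \<bar>b S\<bar> + (\<Sum>S\<in>\<S> - {S}. \<bar>b S\<bar>)"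
      using S Suc by (intro sum.remove) auto
    ultimately have "real (card H) \<le> card H' + (\<Sum>S\<in>\<S>. \<bar>b S\<bar>)" using H' S by linarith
    moreover have "\<forall>S'\<in>\<S>. \<forall>e\<in>H'. S' \<subseteq> e \<longrightarrow> b S' \<le> codeg H' S'"
      using H' by blast
    ultimately show ?thesis using H'(1) by blast
  qed
qed

section \<open>Dyadic pigeonholing\<close>

lemma dyadic_class:
  fixes g :: "'a \<Rightarrow> nat"
  assumes "finite X" "\<And>x. x \<in> X \<Longrightarrow> 1 \<le> g x \<and> g x < 2 ^ \<Lambda>" "\<Lambda> \<ge> 1"
  shows "\<exists>d\<ge>1. card X \<le> \<Lambda> * card {x \<in> X. d \<le> g x \<and> g x < 2 * d}"
proof -
  let ?Y = "\<lambda>l. {x \<in> X. 2 ^ l \<le> g x \<and> g x < 2 * 2 ^ l}"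
  have "\<exists>l<\<Lambda>. 2 ^ l \<le> g x \<and> g x < 2 * 2 ^ l" if "x \<in> X" for x
  proof -
    from ex_power_ivl1[of 2 "g x"] assms(2)[OF that] obtain l where l: "2 ^ l \<le> g x" "g x < 2 ^ (l + 1)" by auto
    then have "(2::nat) ^ l < 2 ^ \<Lambda>" using assms(2)[OF that] by linarith
    then show ?thesis using l by (intro exI[of _ l]) auto
  qed
  then have X: "X = (\<Union>l<\<Lambda>. ?Y l)" by auto
  define M where "M = Max ((\<lambda>l. card (?Y l)) ` {..<\<Lambda>})"
  have "M \<in> (\<lambda>l. card (?Y l)) ` {..<\<Lambda>}" unfolding M_def using assms(3) by (intro Max_in) (auto simp: lessThan_empty_iff)
  then obtain l where l: "l < \<Lambda>" "M = card (?Y l)" by auto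
  have "card X \<le> (\<Sum>l<\<Lambda>. card (?Y l))" by (subst X) (rule card_UN_le, simp)
  also have "\<dots> \<le> (\<Sum>l<\<Lambda>. M)" by (intro sum_mono) (auto simp: M_def)
  also have "\<dots> = \<Lambda> * card (?Y l)" using l by simp
  finally show ?thesis by (intro exI[of _ "2 ^ l"]) auto
qed

text \<open>Pigeonholing for one index at a time. Bounds already obtained survive the passage to a
  smaller \<open>Y\<close> because \<open>g\<close> does not depend on the current class; for this
  reason codegrees are later counted in the whole hypergraph and not in the class.\<close>

lemma dyadic_classes:
  fixes g :: "'b \<Rightarrow> 'a \<Rightarrow> nat"
  assumes "finite \<U>" "finite X" "\<And>U x. U \<in> \<U> \<Longrightarrow> x \<in> X \<Longrightarrow> 1 \<le> g U x \<and> g U x < 2 ^ \<Lambda>" "\<Lambda> \<ge> 1"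
  shows "\<exists>D Y. Y \<subseteq> X \<and> card X \<le> \<Lambda> ^ card \<U> * card Y \<and>
    (\<forall>U\<in>\<U>. 1 \<le> D U \<and> (\<forall>x\<in>Y. D U \<le> g U x \<and> g U x < 2 * D U))"
  using assms(1,3)
proof (induction \<U>)
  case empty
  then show ?case by (intro exI[of _ "\<lambda>_. 1"] exI[of _ X]) auto
next
  case (insert U \<U>)
  then obtain D Y where DY: "Y \<subseteq> X" "card X \<le> \<Lambda> ^ card \<U> * card Y"
    "\<forall>U\<in>\<U>. 1 \<le> D U \<and> (\<forall>x\<in>Y. D U \<le> g U x \<and> g U x < 2 * D U)"
    by (metis insertCI)
  obtain d where d: "d \<ge> 1" "card Y \<le> \<Lambda> * card {x \<in> Y. d \<le> g U x \<and> g U x < 2 * d}"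
    using dyadic_class[of Y "g U" \<Lambda>] DY(1) insert.prems assms(2,4) by (meson finite_subset insertCI subsetD)
  let ?Y = "{x \<in> Y. d \<le> g U x \<and> g U x < 2 * d}"
  have "card X \<le> \<Lambda> ^ card \<U> * (\<Lambda> * card ?Y)"
    using DY(2) d(2) by (meson le_trans mult_le_mono2)
  then have "card X \<le> \<Lambda> ^ card (insert U \<U>) * card ?Y"
    using insert.hyps by (simp add: mult_ac)
  then show ?case
    using DY(1,3) d(1) insert.hyps
    by (intro exI[of _ "D(U := d)"] exI[of _ ?Y]) auto
qed

section \<open>Counting subsets and systems of compatible choices\<close>

lemma card_subsets_le_power:
  assumes "card A = n" "finite A"
  shows "card {S. S \<subseteq> A \<and> card S = k} \<le> n ^ k"
proof -
  have "card {S. S \<subseteq> A \<and> card S = k} = n choose k" using n_subsets[of A k] assms by simp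
  also have "\<dots> \<le> n ^ k" by (cases "k \<le> n") (auto simp: binomial_le_pow binomial_eq_0)
  finally show ?thesis .
qed

lemma codeg_le_power:
  assumes H: "H \<subseteq> {e. e \<subseteq> {..<n} \<and> card e = r}" and S: "finite S"
  shows "codeg H S \<le> n ^ (r - card S)"
proof -
  have "codeg H S \<le> card {T. T \<subseteq> {..<n} \<and> card T = r - card S}"
    unfolding codeg_def
  proof (rule card_inj_on_le[where f="\<lambda>e. e - S"])
    show "inj_on (\<lambda>e. e - S) {e \<in> H. S \<subseteq> e}" by (auto simp: inj_on_def)
    show "(\<lambda>e. e - S) ` {e \<in> H. S \<subseteq> e} \<subseteq> {T. T \<subseteq> {..<n} \<and> card T = r - card S}"
      using H S by (auto simp: card_Diff_subset)
    show "finite {T. T \<subseteq> {..<n} \<and> card T = r - card S}"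
      by (rule finite_subset[of _ "Pow {..<n}"]) auto
  qed
  also have "\<dots> \<le> n ^ (r - card S)" by (rule card_subsets_le_power) auto
  finally show ?thesis .
qed

text \<open>Choose the values one index at a time. Each earlier value excludes at most a fraction
  \<open>1 / (2 * q)\<close> of the candidates and there are at most \<open>q\<close> earlier
  values, so at least half of the candidates survive each time.\<close>

lemma card_compatible_PiE_ge:
  fixes N :: "'f \<Rightarrow> 'e set"
  assumes "finite E" "\<And>f. f \<in> E \<Longrightarrow> finite (N f)" "card E \<le> q"
    and sym: "\<And>x y. R x y \<Longrightarrow> R y x"
    and bad: "\<And>f g y. f \<in> E \<Longrightarrow> g \<in> E \<Longrightarrow> y \<in> N g \<Longrightarrow> 2 * q * card {x \<in> N f. \<not> R x y} \<le> card (N f)"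
  shows "(\<Prod>f\<in>E. card (N f)) \<le> 2 ^ card E * card {X \<in> PiE E N. \<forall>f\<in>E. \<forall>g\<in>E. f \<noteq> g \<longrightarrow> R (X f) (X g)}"
  using assms(1-3,5)
proof (induction E)
  case empty
  then show ?case by simp
next
  case (insert f E)
  let ?V = "\<lambda>E. {X \<in> PiE E N. \<forall>f\<in>E. \<forall>g\<in>E. f \<noteq> g \<longrightarrow> R (X f) (X g)}"
  define A where "A X = {x \<in> N f. \<forall>g\<in>E. R x (X g)}" for X
  have fin: "finite (?V E')" if "finite E'" "\<And>f. f \<in> E' \<Longrightarrow> finite (N f)" for E'
  proof (rule finite_subset)
    show "?V E' \<subseteq> PiE E' N" by (rule Collect_restrict)
    show "finite (PiE E' N)" by (rule finite_PiE) (use that in auto)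
  qed
  have finV: "finite (?V E)" "finite (?V (insert f E))"
    by (rule fin; use insert.hyps(1) insert.prems(1) in blast)+
  have A: "card (N f) \<le> 2 * card (A X)" if X: "X \<in> ?V E" for X
  proof -
    have "N f = A X \<union> (\<Union>g\<in>E. {x \<in> N f. \<not> R x (X g)})" by (auto simp: A_def)
    then have "card (N f) \<le> card (A X) + card (\<Union>g\<in>E. {x \<in> N f. \<not> R x (X g)})"
      by (metis card_Un_le)
    also have "card (\<Union>g\<in>E. {x \<in> N f. \<not> R x (X g)}) \<le> (\<Sum>g\<in>E. card {x \<in> N f. \<not> R x (X g)})"
      by (rule card_UN_le[OF insert(1)])
    finally have "2 * q * card (N f) \<le> 2 * q * (card (A X) + (\<Sum>g\<in>E. card {x \<in> N f. \<not> R x (X g)}))"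
      by (intro mult_le_mono2) simp
    then have 1: "2 * q * card (N f) \<le> 2 * q * card (A X) + (\<Sum>g\<in>E. 2 * q * card {x \<in> N f. \<not> R x (X g)})"
      by (simp only: add_mult_distrib2 sum_distrib_left)
    have "(\<Sum>g\<in>E. 2 * q * card {x \<in> N f. \<not> R x (X g)}) \<le> (\<Sum>g\<in>E. card (N f))"
      using X insert.prems(3) by (intro sum_mono) auto
    also have "\<dots> \<le> q * card (N f)" using insert.prems(2) insert.hyps by simp
    finally have "2 * q * card (N f) \<le> 2 * q * card (A X) + q * card (N f)"
      using 1 by linarith
    moreover have "2 * q * card (N f) = q * card (N f) + q * card (N f)"
      "2 * q * card (A X) = q * (2 * card (A X))" by simp_all
    ultimately have "q * card (N f) \<le> q * (2 * card (A X))" by linarith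
    moreover have "q > 0" using insert by auto
    ultimately show ?thesis by simp
  qed
  have IH: "(\<Prod>f\<in>E. card (N f)) \<le> 2 ^ card E * card (?V E)"
  proof (rule insert.IH)
    show "card E \<le> q" using insert by auto
    show "2 * q * card {x \<in> N f'. \<not> R x y} \<le> card (N f')" if "f' \<in> E" "g \<in> E" "y \<in> N g" for f' g y
      by (rule insert.prems(3)) (use that in auto)
  qed (use insert in auto)
  have "card (N f) * card (?V E) \<le> (\<Sum>X\<in>?V E. 2 * card (A X))"
    using sum_mono[of "?V E" "\<lambda>_. card (N f)" "\<lambda>X. 2 * card (A X)"] A by (simp add: mult.commute)
  also have "\<dots> = 2 * card (SIGMA X:?V E. A X)"
    using finV insert.prems by (subst card_SigmaI) (auto simp: A_def sum_distrib_left)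
  also have "card (SIGMA X:?V E. A X) \<le> card (?V (insert f E))"
  proof (rule card_inj_on_le[where f="\<lambda>(X, x). X(f := x)"])
    show "inj_on (\<lambda>(X, x). X(f := x)) (SIGMA X:?V E. A X)"
    proof (rule inj_onI, clarify)
      fix X x X' x'
      assume *: "X \<in> PiE E N" "X' \<in> PiE E N" "X(f := x) = X'(f := x')"
      have "x = x'" using fun_cong[OF *(3), of f] by simp
      moreover have "X = X'"
      proof
        fix g
        show "X g = X' g"
          using fun_cong[OF *(3), of g] *(1,2) insert(2) by (cases "g = f") (auto simp: PiE_def extensional_def)
      qed
      ultimately show "X = X' \<and> x = x'" by simp
    qed
    show "(\<lambda>(X, x). X(f := x)) ` (SIGMA X:?V E. A X) \<subseteq> ?V (insert f E)"
    proof (rule image_subsetI, clarify)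
      fix X x
      assume X: "X \<in> PiE E N" "\<forall>f\<in>E. \<forall>g\<in>E. f \<noteq> g \<longrightarrow> R (X f) (X g)" and x: "x \<in> A X"
      have "X(f := x) \<in> PiE (insert f E) N"
        using X(1) x by (intro PiE_fun_upd) (auto simp: A_def)
      moreover have "R ((X(f := x)) f') ((X(f := x)) g)"
        if fg: "f' \<in> insert f E" "g \<in> insert f E" "f' \<noteq> g" for f' g
      proof -
        have xg: "R x (X g)" if "g \<in> E" for g using x that by (simp add: A_def)
        consider "f' = f" "g \<in> E" "g \<noteq> f" | "g = f" "f' \<in> E" "f' \<noteq> f" | "f' \<in> E" "g \<in> E" "f' \<noteq> f" "g \<noteq> f"
          using fg by blast
        then show ?thesis
          by cases (use xg sym[OF xg] X(2) fg(3) in simp_all)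
      qed
      ultimately show "X(f := x) \<in> PiE (insert f E) N \<and> (\<forall>f'\<in>insert f E. \<forall>g\<in>insert f E.
          f' \<noteq> g \<longrightarrow> R ((X(f := x)) f') ((X(f := x)) g))" by blast
    qed
  qed (rule finV)
  finally have 2: "card (N f) * card (?V E) \<le> 2 * card (?V (insert f E))" by simp
  have "(\<Prod>f\<in>insert f E. card (N f)) = card (N f) * (\<Prod>f\<in>E. card (N f))" using insert by simp
  also have "\<dots> \<le> card (N f) * (2 ^ card E * card (?V E))" by (intro mult_le_mono2 IH)
  also have "\<dots> = 2 ^ card E * (card (N f) * card (?V E))" by simp
  also have "\<dots> \<le> 2 ^ card E * (2 * card (?V (insert f E)))" by (intro mult_le_mono2 2)
  finally show ?case using insert by simp
qed

section \<open>From complete bipartite graphs to their expansions\<close>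

text \<open>A copy is recorded by its edge set alone: the \<open>r\<close>-sets are the vertices of
  the hypergraph to which the container theorem is applied, and the copies are its edges.\<close>

definition copies :: "nat \<Rightarrow> 'b hypergraph \<Rightarrow> nat set set set" where
  "copies n F = {(\<lambda>e. h ` e) ` edges F | h. inj_on h (verts F) \<and> h ` verts F \<subseteq> {..<n}}"

text \<open>The \<open>r - 2\<close> vertices of \<open>X f\<close> outside the image of
  \<open>f\<close> are enumerated and receive the new vertices of the expanded edge
  \<open>f\<close>. That distinct \<open>X f\<close> meet only inside the core makes the combined
  map injective.\<close>

lemma expansion_copy:
  fixes F :: "'p hypergraph"
  assumes F: "is_rgraph 2 F" "\<Union>(edges F) = verts F" and r: "r \<ge> 2"
    and u: "inj_on u (verts F)"
    and X: "\<And>f. f \<in> edges F \<Longrightarrow> X f \<subseteq> {..<n} \<and> card (X f) = r \<and> X f \<inter> u ` verts F = u ` f"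
    and disj: "\<And>f g. f \<in> edges F \<Longrightarrow> g \<in> edges F \<Longrightarrow> f \<noteq> g \<Longrightarrow> X f \<inter> X g \<subseteq> u ` verts F"
  shows "X ` edges F \<in> copies n (expansion r F)"
proof -
  have sub: "f \<subseteq> verts F" "card f = 2" "finite f" if "f \<in> edges F" for f
    using F(1) that by (auto simp: is_rgraph_def intro: finite_subset)
  have "\<exists>b. bij_betw b {..<r - 2} (X f - u ` f)" if f: "f \<in> edges F" for f
  proof -
    have "finite (X f)" using X[OF f] finite_subset by blast
    moreover have "u ` f \<subseteq> X f" using X[OF f] by auto
    moreover have "card (u ` f) = 2" using sub[OF f] u by (metis card_image inj_on_subset)
    ultimately have "card (X f - u ` f) = r - 2" using X[OF f] sub(3)[OF f] by (simp add: card_Diff_subset)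
    then show ?thesis using \<open>finite (X f)\<close> ex_bij_betw_nat_finite[of "X f - u ` f"]
      by (auto simp: atLeast0LessThan)
  qed
  then obtain b where b: "\<And>f. f \<in> edges F \<Longrightarrow> bij_betw (b f) {..<r - 2} (X f - u ` f)"
    by metis
  define h where "h = case_sum u (\<lambda>(f, i). b f i)"
  have bim: "b f i \<in> X f" "b f i \<notin> u ` verts F" if "f \<in> edges F" "i < r - 2" for f i
  proof -
    have "b f i \<in> X f - u ` f" using b[OF that(1)] that(2) by (auto simp: bij_betw_def)
    then show "b f i \<in> X f" "b f i \<notin> u ` verts F" using X[OF that(1)] by auto
  qed
  have himg: "h ` (Inl ` f \<union> Inr ` ({f} \<times> {..<r - 2})) = X f" if f: "f \<in> edges F" for f
  proof -
    have "h ` (Inl ` f \<union> Inr ` ({f} \<times> {..<r - 2})) = u ` f \<union> b f ` {..<r - 2}"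
      by (force simp: h_def image_Un image_image)
    also have "\<dots> = X f" using b[OF f] X[OF f] by (auto simp: bij_betw_def)
    finally show ?thesis .
  qed
  have "inj_on h (verts (expansion r F))"
  proof (rule inj_onI)
    fix x y assume xy: "x \<in> verts (expansion r F)" "y \<in> verts (expansion r F)" "h x = h y"
    have vx: "(\<exists>a\<in>verts F. x = Inl a) \<or> (\<exists>f\<in>edges F. \<exists>i<r - 2. x = Inr (f, i))"
      and vy: "(\<exists>a\<in>verts F. y = Inl a) \<or> (\<exists>f\<in>edges F. \<exists>i<r - 2. y = Inr (f, i))"
      using xy(1,2) by (auto simp: expansion_def)
    show "x = y"
    proof (cases x)
      case (Inl a)
      then have a: "a \<in> verts F" using vx by auto
      show ?thesis
      proof (cases y)
        case (Inl a')
        then show ?thesis using vy xy(3) \<open>x = Inl a\<close> a u by (auto simp: h_def inj_on_def)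
      next
        case (Inr fi)
        then obtain f i where "f \<in> edges F" "i < r - 2" "y = Inr (f, i)" using vy by auto
        then show ?thesis using bim(2)[of f i] imageI[OF a, of u] xy(3) \<open>x = Inl a\<close> by (auto simp: h_def)
      qed
    next
      case (Inr fi)
      then obtain f i where f: "f \<in> edges F" "i < r - 2" "x = Inr (f, i)" using vx by auto
      show ?thesis
      proof (cases y)
        case (Inl a)
        then have "a \<in> verts F" using vy by auto
        then show ?thesis using bim(2)[of f i] imageI[of a "verts F" u] xy(3) f \<open>y = Inl a\<close> by (auto simp: h_def)
      next
        case (Inr gj)
        then obtain g j where g: "g \<in> edges F" "j < r - 2" "y = Inr (g, j)" using vy by auto
        have eq: "b f i = b g j" using xy(3) f g by (simp add: h_def)
        have "f = g"
        proof (rule ccontr)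
          assume "f \<noteq> g"
          then have "b f i \<in> u ` verts F"
            using disj[of f g] f g bim(1)[of f i] bim(1)[of g j] eq by auto
          then show False using bim(2)[of f i] f by auto
        qed
        moreover from this have "i = j"
          using b[OF f(1)] eq f(2) g(2) by (auto simp: bij_betw_def inj_on_def)
        ultimately show ?thesis using f g by simp
      qed
    qed
  qed
  moreover have "h ` verts (expansion r F) \<subseteq> {..<n}"
  proof
    fix z assume "z \<in> h ` verts (expansion r F)"
    then consider a where "a \<in> verts F" "z = u a" | f i where "f \<in> edges F" "i < r - 2" "z = b f i"
      by (auto simp: expansion_def h_def)
    then show "z \<in> {..<n}"
    proof cases
      case 1
      then obtain f where "f \<in> edges F" "a \<in> f" using F(2) by auto
      then show ?thesis using X[of f] 1 by blast
    next
      case 2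
      then show ?thesis using bim(1)[of f i] X[of f] by blast
    qed
  qed
  moreover have "(\<lambda>e. h ` e) ` edges (expansion r F) = X ` edges F"
    unfolding expansion_def by (simp add: image_image himg cong: image_cong)
  ultimately show ?thesis unfolding copies_def by (smt (verit, best) mem_Collect_eq)
qed

lemma card_SIGMA_le:
  fixes c :: real
  assumes "finite A" "\<And>x. x \<in> A \<Longrightarrow> finite (B x)" "\<And>x. x \<in> A \<Longrightarrow> real (card (B x)) \<le> c"
  shows "real (card (SIGMA x:A. B x)) \<le> card A * c"
  using sum_mono[of A "\<lambda>x. real (card (B x))" "\<lambda>_. c"] assms by (simp add: card_SigmaI)

lemma card_UN_le_real:
  fixes c :: real
  assumes "finite A" "\<And>x. x \<in> A \<Longrightarrow> real (card (B x)) \<le> c"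
  shows "real (card (\<Union>x\<in>A. B x)) \<le> card A * c"
proof -
  have "real (card (\<Union>x\<in>A. B x)) \<le> (\<Sum>x\<in>A. real (card (B x)))"
    using card_UN_le[OF assms(1), of B] by (metis of_nat_mono of_nat_sum)
  also have "\<dots> \<le> card A * c" using sum_mono[of A "\<lambda>x. real (card (B x))" "\<lambda>_. c"] assms by simp
  finally show ?thesis .
qed

section \<open>From random embeddings of the core to random copies of the expansion\<close>

text \<open>For \<psi> uniform in \<Psi> the maps \<open>u \<psi>\<close> are random embeddings of
  \<open>F\<close>. \<open>marginal\<close> bounds the probability of prescribing the vertices
  touched by \<open>J\<close>. The product of the \<open>d f\<close> stands on its right-hand side
  because a random edge over the image of \<open>f\<close> is a given one with probability about
  \<open>1 / d f\<close>; thus \<beta> becomes, up to constants, the probability that prescribed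
  edges occur in the copy. \<open>d_large\<close> makes codegrees of pairs exceed the number of
  edges lost to unwanted intersections.\<close>

locale expansion_setup =
  fixes F :: "'p hypergraph" and n r :: nat and H :: "nat set set"
    and \<Psi> :: "'i set" and u :: "'i \<Rightarrow> 'p \<Rightarrow> nat" and d :: "'p set \<Rightarrow> real" and \<beta> :: "nat \<Rightarrow> real"
  assumes F: "is_rgraph 2 F" "\<Union>(edges F) = verts F" and r: "r \<ge> 3" and n: "n \<ge> 1"
    and H: "H \<subseteq> {e. e \<subseteq> {..<n} \<and> card e = r}"
    and \<Psi>: "finite \<Psi>" "\<Psi> \<noteq> {}"
    and inj: "\<And>\<psi>. \<psi> \<in> \<Psi> \<Longrightarrow> inj_on (u \<psi>) (verts F)"
    and d: "\<And>\<psi> f. \<psi> \<in> \<Psi> \<Longrightarrow> f \<in> edges F \<Longrightarrow> d f \<le> codeg H (u \<psi> ` f) \<and> codeg H (u \<psi> ` f) \<le> 2 * d f"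
    and d_large: "\<And>f. f \<in> edges F \<Longrightarrow> (2 * card (verts F) + 4 * card (edges F) * r) * n ^ (r - 3) \<le> d f"
    and marginal: "\<And>J a. J \<subseteq> edges F \<Longrightarrow> J \<noteq> {} \<Longrightarrow>
      card {\<psi> \<in> \<Psi>. \<forall>x\<in>\<Union>J. u \<psi> x = a x} \<le> \<beta> (card J) * card \<Psi> * (\<Prod>f\<in>J. d f)"
    and \<beta>: "\<And>j. 0 \<le> \<beta> j"
begin

abbreviation "P \<equiv> verts F"
abbreviation "E \<equiv> edges F"

text \<open>The trace on the core must be exact: an edge over the image of \<open>f\<close> through
  a further core vertex would spoil the copy.\<close>

definition nbrs :: "'i \<Rightarrow> 'p set \<Rightarrow> nat set set" where
  "nbrs \<psi> f = {e \<in> H. e \<inter> u \<psi> ` P = u \<psi> ` f}"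

definition fillings :: "'i \<Rightarrow> ('p set \<Rightarrow> nat set) set" where
  "fillings \<psi> = {X \<in> PiE E (nbrs \<psi>). \<forall>f\<in>E. \<forall>g\<in>E. f \<noteq> g \<longrightarrow> X f \<inter> X g \<subseteq> u \<psi> ` P}"

definition confs :: "('i \<times> ('p set \<Rightarrow> nat set)) set" where
  "confs = (SIGMA \<psi>:\<Psi>. fillings \<psi>)"

lemma fin: "finite P" "finite E" "finite H"
proof -
  show "finite P" using F by (auto simp: is_rgraph_def)
  then show "finite E" using F by (intro finite_subset[of E "Pow P"]) (auto simp: is_rgraph_def)
  show "finite H" using H by (rule finite_subset) (auto intro: finite_subset[of _ "Pow {..<n}"])
qed

lemma edge: "f \<in> E \<Longrightarrow> f \<subseteq> P \<and> card f = 2 \<and> finite f"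
  using F fin(1) by (auto simp: is_rgraph_def intro: finite_subset)

lemma d_pos: "f \<in> E \<Longrightarrow> d f > 0"
proof -
  assume f: "f \<in> E"
  then have "card E > 0" using fin by (auto simp: card_gt_0_iff)
  then have "0 < (2 * card P + 4 * card E * r) * n ^ (r - 3)" using r n by simp
  then have "0 < real ((2 * card P + 4 * card E * r) * n ^ (r - 3))" by (simp only: of_nat_0_less_iff)
  then show ?thesis using d_large[OF f] by linarith
qed

text \<open>An unwanted intersection puts a third vertex into an edge over a pair, and triples have
  codegree at most \<open>n ^ (r - 3)\<close>. This explains the form of \<open>d_large\<close>: the
  summand with \<open>card (verts F)\<close> pays for hits on the core, the summand with
  \<open>r\<close> for hits on other chosen edges.\<close>

lemma codeg_insert_le:
  assumes "\<psi> \<in> \<Psi>" "f \<in> E" "z \<notin> u \<psi> ` f"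
  shows "real (card {e \<in> H. insert z (u \<psi> ` f) \<subseteq> e}) \<le> n ^ (r - 3)"
proof -
  have "card (u \<psi> ` f) = 2"
    using inj[OF assms(1)] edge[OF assms(2)] by (metis card_image inj_on_subset)
  then have "card (insert z (u \<psi> ` f)) = 3" using assms edge by (subst card_insert_disjoint) auto
  then show ?thesis
    using codeg_le_power[OF H, of "insert z (u \<psi> ` f)"] edge[OF assms(2)] unfolding codeg_def by simp
qed

lemma nbrs_ge:
  assumes \<psi>: "\<psi> \<in> \<Psi>" and f: "f \<in> E"
  shows "d f / 2 \<le> card (nbrs \<psi> f)" "card (nbrs \<psi> f) \<le> 2 * d f"
proof -
  let ?B = "\<Union>z\<in>u \<psi> ` P - u \<psi> ` f. {e \<in> H. insert z (u \<psi> ` f) \<subseteq> e}"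
  have finN: "finite {e \<in> H. u \<psi> ` f \<subseteq> e}" "finite (nbrs \<psi> f)" using fin by (auto simp: nbrs_def)
  have sub: "nbrs \<psi> f \<subseteq> {e \<in> H. u \<psi> ` f \<subseteq> e}" by (auto simp: nbrs_def)
  then show "card (nbrs \<psi> f) \<le> 2 * d f"
    using card_mono[OF finN(1) sub] d[OF \<psi> f] unfolding codeg_def by linarith
  have "{e \<in> H. u \<psi> ` f \<subseteq> e} \<subseteq> nbrs \<psi> f \<union> ?B" using edge[OF f] by (auto simp: nbrs_def)
  then have "codeg H (u \<psi> ` f) \<le> card (nbrs \<psi> f \<union> ?B)"
    unfolding codeg_def using fin by (intro card_mono) (auto simp: nbrs_def)
  also have "\<dots> \<le> card (nbrs \<psi> f) + card ?B" by (rule card_Un_le)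
  finally have 1: "codeg H (u \<psi> ` f) \<le> card (nbrs \<psi> f) + card ?B" .
  have "real (card ?B) \<le> card (u \<psi> ` P - u \<psi> ` f) * real (n ^ (r - 3))"
    by (rule card_UN_le_real) (use fin codeg_insert_le[OF \<psi> f] in auto)
  also have "\<dots> \<le> card P * real (n ^ (r - 3))"
    using fin by (intro mult_right_mono) (auto intro!: order_trans[OF card_mono card_image_le])
  also have "\<dots> \<le> d f / 2"
  proof -
    have "(2 * real (card P)) * real (n ^ (r - 3)) \<le> real ((2 * card P + 4 * card E * r) * n ^ (r - 3))"
      unfolding of_nat_mult by (intro mult_right_mono) auto
    then show ?thesis using d_large[OF f] by linarith
  qed
  finally show "d f / 2 \<le> card (nbrs \<psi> f)" using 1 d[OF \<psi> f] by linarith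
qed

text \<open>One factor two per edge is lost in passing from \<open>d f\<close> to
  \<open>nbrs\<close>, another in making the chosen edges disjoint outside the core.\<close>

lemma card_fillings_ge:
  assumes \<psi>: "\<psi> \<in> \<Psi>"
  shows "(\<Prod>f\<in>E. d f) \<le> 4 ^ card E * real (card (fillings \<psi>))"
proof -
  have "(\<Prod>f\<in>E. card (nbrs \<psi> f)) \<le> 2 ^ card E * card (fillings \<psi>)"
    unfolding fillings_def
  proof (rule card_compatible_PiE_ge[where q="card E"])
    show "2 * card E * card {x \<in> nbrs \<psi> f. \<not> x \<inter> y \<subseteq> u \<psi> ` P} \<le> card (nbrs \<psi> f)"
      if fg: "f \<in> E" "g \<in> E" "y \<in> nbrs \<psi> g" for f g y
    proof -
      have y: "finite y" "card y = r" using fg(3) H by (auto simp: nbrs_def intro: finite_subset)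
      let ?B = "\<Union>z\<in>y - u \<psi> ` P. {e \<in> H. insert z (u \<psi> ` f) \<subseteq> e}"
      have "{x \<in> nbrs \<psi> f. \<not> x \<inter> y \<subseteq> u \<psi> ` P} \<subseteq> ?B"
      proof
        fix x assume "x \<in> {x \<in> nbrs \<psi> f. \<not> x \<inter> y \<subseteq> u \<psi> ` P}"
        then have x: "x \<in> H" "u \<psi> ` f \<subseteq> x" "\<not> x \<inter> y \<subseteq> u \<psi> ` P" by (auto simp: nbrs_def)
        then obtain z where "z \<in> x" "z \<in> y" "z \<notin> u \<psi> ` P" by blast
        then show "x \<in> ?B" using x by blast
      qed
      then have "card {x \<in> nbrs \<psi> f. \<not> x \<inter> y \<subseteq> u \<psi> ` P} \<le> card ?B"
        using fin y by (intro card_mono) auto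
      also have "real (card ?B) \<le> card (y - u \<psi> ` P) * real (n ^ (r - 3))"
        by (rule card_UN_le_real) (use y codeg_insert_le[OF \<psi> fg(1)] edge[OF fg(1)] in auto)
      also have "\<dots> \<le> r * real (n ^ (r - 3))"
        using card_mono[of y "y - u \<psi> ` P"] y by (intro mult_right_mono) auto
      finally have "2 * real (card E) * real (card {x \<in> nbrs \<psi> f. \<not> x \<inter> y \<subseteq> u \<psi> ` P})
          \<le> 2 * real (card E) * (r * real (n ^ (r - 3)))" by (intro mult_left_mono) auto
      also have "\<dots> \<le> d f / 2"
      proof -
        have "(4 * real (card E) * real r) * real (n ^ (r - 3)) \<le> real ((2 * card P + 4 * card E * r) * n ^ (r - 3))"
          unfolding of_nat_mult by (intro mult_right_mono) auto
        then show ?thesis using d_large[OF fg(1)] by linarith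
      qed
      also have "\<dots> \<le> card (nbrs \<psi> f)" by (rule nbrs_ge[OF \<psi> fg(1)])
      finally have "real (2 * card E * card {x \<in> nbrs \<psi> f. \<not> x \<inter> y \<subseteq> u \<psi> ` P}) \<le> real (card (nbrs \<psi> f))"
        by simp
      then show ?thesis by (simp only: of_nat_le_iff)
    qed
  qed (use fin in \<open>auto simp: nbrs_def\<close>)
  then have 1: "real (\<Prod>f\<in>E. card (nbrs \<psi> f)) \<le> 2 ^ card E * real (card (fillings \<psi>))"
    by (metis (mono_tags, lifting) of_nat_le_iff of_nat_mult of_nat_numeral of_nat_power)
  have "(\<Prod>f\<in>E. d f) = 2 ^ card E * (\<Prod>f\<in>E. d f / 2)" by (simp add: prod_dividef)
  also have "\<dots> \<le> 2 ^ card E * (\<Prod>f\<in>E. real (card (nbrs \<psi> f)))"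
    using nbrs_ge(1)[OF \<psi>] d_pos by (intro mult_left_mono prod_mono) (auto simp: less_imp_le)
  also have "\<dots> \<le> 2 ^ card E * (2 ^ card E * real (card (fillings \<psi>)))"
    using 1 by (intro mult_left_mono) auto
  also have "\<dots> = 4 ^ card E * real (card (fillings \<psi>))"
    by (simp add: power_mult_distrib[symmetric])
  finally show ?thesis .
qed

lemma fin_confs: "finite (fillings \<psi>)" "finite confs"
proof -
  have "finite (PiE E (nbrs \<psi>))" for \<psi> by (rule finite_PiE) (use fin in \<open>auto simp: nbrs_def\<close>)
  then show f: "finite (fillings \<psi>)" for \<psi> unfolding fillings_def by auto
  show "finite confs" unfolding confs_def using \<Psi> f by (intro finite_SigmaI) auto
qed

lemma card_confs_ge: "card \<Psi> * (\<Prod>f\<in>E. d f) \<le> 4 ^ card E * real (card confs)"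
proof -
  have "card \<Psi> * (\<Prod>f\<in>E. d f) = (\<Sum>\<psi>\<in>\<Psi>. \<Prod>f\<in>E. d f)" by simp
  also have "\<dots> \<le> (\<Sum>\<psi>\<in>\<Psi>. 4 ^ card E * real (card (fillings \<psi>)))"
    by (intro sum_mono card_fillings_ge)
  also have "\<dots> = 4 ^ card E * real (card confs)"
    unfolding confs_def using \<Psi> fin_confs by (simp add: card_SigmaI sum_distrib_left)
  finally show ?thesis .
qed

text \<open>Prescribed edges restrict the embedding through the vertices of \<open>F\<close> they
  touch: each such vertex must land in one of the given edges, which leaves \<open>r\<close> places
  for it and at most \<open>r ^ card P\<close> tuples of places. \<open>marginal\<close> applies to
  each tuple, and the edges not prescribed range freely over \<open>nbrs\<close>.\<close>

lemma card_prescribed_le: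
  assumes g: "g \<in> S \<rightarrow> E" "inj_on g S" and S: "S \<subseteq> H" "S \<noteq> {}"
  shows "card {\<phi> \<in> confs. \<forall>h\<in>S. snd \<phi> (g h) = h}
    \<le> 2 ^ card E * r ^ card P * \<beta> (card S) * card \<Psi> * (\<Prod>f\<in>E. d f)"
proof -
  let ?J = "g ` S"
  have J: "?J \<subseteq> E" "?J \<noteq> {}" "card ?J = card S" "finite ?J"
    using g S fin by (auto simp: card_image intro: finite_subset)
  have finS: "finite S" using S fin finite_subset by auto
  have "\<forall>x\<in>\<Union>?J. \<exists>h\<in>S. x \<in> g h" by auto
  then obtain k where k: "\<And>x. x \<in> \<Union>?J \<Longrightarrow> k x \<in> S \<and> x \<in> g (k x)" by metis
  have UJ: "\<Union>?J \<subseteq> P" using J edge by blast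
  then have UJ: "\<Union>?J \<subseteq> P" "finite (\<Union>?J)" using fin(1) by (auto intro: finite_subset)
  define \<Psi>' where "\<Psi>' = {\<psi> \<in> \<Psi>. \<forall>h\<in>S. u \<psi> ` g h \<subseteq> h}"
  have h: "finite h" "card h = r" if "h \<in> S" for h
  proof -
    have "h \<subseteq> {..<n}" "card h = r" using that S H by blast+
    then show "finite h" "card h = r" by (auto intro: finite_subset)
  qed
  have "\<Psi>' \<subseteq> (\<Union>a\<in>PiE (\<Union>?J) k. {\<psi> \<in> \<Psi>. \<forall>x\<in>\<Union>?J. u \<psi> x = a x})"
  proof
    fix \<psi> assume "\<psi> \<in> \<Psi>'"
    then have "restrict (u \<psi>) (\<Union>?J) \<in> PiE (\<Union>?J) k" "\<psi> \<in> \<Psi>"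
      using k by (auto simp: \<Psi>'_def)
    then show "\<psi> \<in> (\<Union>a\<in>PiE (\<Union>?J) k. {\<psi> \<in> \<Psi>. \<forall>x\<in>\<Union>?J. u \<psi> x = a x})"
      by (intro UN_I[of "restrict (u \<psi>) (\<Union>?J)"]) auto
  qed
  then have "card \<Psi>' \<le> card (\<Union>a\<in>PiE (\<Union>?J) k. {\<psi> \<in> \<Psi>. \<forall>x\<in>\<Union>?J. u \<psi> x = a x})"
    by (rule card_mono[rotated]) (rule finite_subset[of _ \<Psi>], use \<Psi> in auto)
  then have "real (card \<Psi>') \<le> card (\<Union>a\<in>PiE (\<Union>?J) k. {\<psi> \<in> \<Psi>. \<forall>x\<in>\<Union>?J. u \<psi> x = a x})"
    by (simp only: of_nat_le_iff)
  also have "\<dots> \<le> card (PiE (\<Union>?J) k) * (\<beta> (card ?J) * card \<Psi> * (\<Prod>f\<in>?J. d f))"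
  proof (rule card_UN_le_real)
    show "finite (PiE (\<Union>?J) k)" by (rule finite_PiE[OF UJ(2)]) (use k h in auto)
  qed (rule marginal[OF J(1,2)])
  finally have c0: "real (card \<Psi>') \<le> card (PiE (\<Union>?J) k) * (\<beta> (card ?J) * card \<Psi> * (\<Prod>f\<in>?J. d f))" .
  have p: "card (PiE (\<Union>?J) k) \<le> r ^ card P"
  proof -
    have "card (PiE (\<Union>?J) k) = (\<Prod>x\<in>\<Union>?J. r)"
      unfolding card_PiE[OF UJ(2)]
    proof (rule prod.cong[OF refl])
      fix x assume "x \<in> \<Union>?J"
      then show "card (k x) = r" using k[of x] h[of "k x"] by blast
    qed
    then show ?thesis using UJ fin r by (simp add: card_mono power_increasing)
  qed
  have "0 \<le> \<beta> (card ?J) * card \<Psi> * (\<Prod>f\<in>?J. d f)"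
    using J(1) \<beta> d_pos by (intro mult_nonneg_nonneg prod_nonneg) (auto simp: less_imp_le subset_iff)
  moreover have "real (card (PiE (\<Union>?J) k)) \<le> real (r ^ card P)" using p by (simp only: of_nat_le_iff)
  ultimately have c1: "card \<Psi>' \<le> r ^ card P * (\<beta> (card S) * card \<Psi> * (\<Prod>f\<in>?J. d f))"
    using order_trans[OF c0 mult_right_mono] J(3) by simp
  define R where "R \<psi> = {X \<in> fillings \<psi>. \<forall>h\<in>S. X (g h) = h}" for \<psi>
  have c2: "real (card (R \<psi>)) \<le> (\<Prod>f\<in>E - ?J. 2 * d f)" if \<psi>: "\<psi> \<in> \<Psi>" for \<psi>
  proof -
    have "card (R \<psi>) \<le> card (PiE (E - ?J) (nbrs \<psi>))"
    proof (rule card_inj_on_le[where f="\<lambda>X. restrict X (E - ?J)"])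
      show "inj_on (\<lambda>X. restrict X (E - ?J)) (R \<psi>)"
      proof (rule inj_onI)
        fix X Y assume XY: "X \<in> R \<psi>" "Y \<in> R \<psi>" "restrict X (E - ?J) = restrict Y (E - ?J)"
        show "X = Y"
        proof
          fix f
          consider "f \<in> ?J" | "f \<in> E - ?J" | "f \<notin> E" using J by auto
          then show "X f = Y f"
          proof cases
            case 1
            then show ?thesis using XY by (auto simp: R_def)
          next
            case 2
            then show ?thesis using fun_cong[OF XY(3), of f] by simp
          next
            case 3
            then show ?thesis using XY by (auto simp: R_def fillings_def PiE_def extensional_def)
          qed
        qed
      qed
      show "(\<lambda>X. restrict X (E - ?J)) ` R \<psi> \<subseteq> PiE (E - ?J) (nbrs \<psi>)"
        by (auto simp: R_def fillings_def PiE_def Pi_def)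
      show "finite (PiE (E - ?J) (nbrs \<psi>))"
        by (rule finite_PiE) (use fin in \<open>auto simp: nbrs_def\<close>)
    qed
    also have "\<dots> = (\<Prod>f\<in>E - ?J. card (nbrs \<psi> f))" using fin by (intro card_PiE) auto
    also have "real \<dots> \<le> (\<Prod>f\<in>E - ?J. 2 * d f)"
      unfolding of_nat_prod by (rule prod_mono) (use nbrs_ge(2)[OF \<psi>] in auto)
    finally show ?thesis by simp
  qed
  have "{\<phi> \<in> confs. \<forall>h\<in>S. snd \<phi> (g h) = h} \<subseteq> (SIGMA \<psi>:\<Psi>'. R \<psi>)"
  proof
    fix \<phi> assume \<phi>: "\<phi> \<in> {\<phi> \<in> confs. \<forall>h\<in>S. snd \<phi> (g h) = h}"
    obtain \<psi> X where [simp]: "\<phi> = (\<psi>, X)" by (cases \<phi>)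
    have X: "\<psi> \<in> \<Psi>" "X \<in> R \<psi>" using \<phi> by (auto simp: confs_def R_def)
    have "u \<psi> ` g h \<subseteq> h" if h: "h \<in> S" for h
    proof -
      have "g h \<in> E" using g h by auto
      moreover have "X (g h) = h" using X(2) h by (simp add: R_def)
      moreover have "X \<in> PiE E (nbrs \<psi>)" using X(2) by (simp add: R_def fillings_def)
      ultimately have "X (g h) = h" "X (g h) \<in> nbrs \<psi> (g h)"
        using PiE_mem[of X E "nbrs \<psi>" "g h"] by simp_all
      then show ?thesis by (auto simp: nbrs_def)
    qed
    then show "\<phi> \<in> (SIGMA \<psi>:\<Psi>'. R \<psi>)" using X by (auto simp: \<Psi>'_def)
  qed
  moreover have finR: "finite (R \<psi>)" for \<psi> using fin_confs by (auto simp: R_def)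
  moreover have fin\<Psi>': "finite \<Psi>'" using \<Psi> by (auto simp: \<Psi>'_def)
  ultimately have "real (card {\<phi> \<in> confs. \<forall>h\<in>S. snd \<phi> (g h) = h}) \<le> real (card (SIGMA \<psi>:\<Psi>'. R \<psi>))"
    by (intro of_nat_mono card_mono finite_SigmaI) auto
  also have "\<dots> \<le> card \<Psi>' * (\<Prod>f\<in>E - ?J. 2 * d f)"
    by (rule card_SIGMA_le) (use fin\<Psi>' finR c2 in \<open>auto simp: \<Psi>'_def\<close>)
  also have "\<dots> \<le> (r ^ card P * (\<beta> (card S) * card \<Psi> * (\<Prod>f\<in>?J. d f))) * (2 ^ card E * (\<Prod>f\<in>E - ?J. d f))"
  proof (rule mult_mono[OF c1])
    have "(\<Prod>f\<in>E - ?J. 2 * d f) = 2 ^ card (E - ?J) * (\<Prod>f\<in>E - ?J. d f)" by (simp add: prod.distrib)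
    also have "\<dots> \<le> 2 ^ card E * (\<Prod>f\<in>E - ?J. d f)"
      using fin d_pos by (intro mult_right_mono prod_nonneg power_increasing card_mono) (auto simp: less_imp_le)
    finally show "(\<Prod>f\<in>E - ?J. 2 * d f) \<le> 2 ^ card E * (\<Prod>f\<in>E - ?J. d f)" .
    show "0 \<le> (\<Prod>f\<in>E - ?J. 2 * d f)" using d_pos by (intro prod_nonneg) (auto simp: less_imp_le)
    show "0 \<le> r ^ card P * (\<beta> (card S) * card \<Psi> * (\<Prod>f\<in>?J. d f))"
      using d_pos \<beta> J by (intro mult_nonneg_nonneg prod_nonneg) (auto simp: less_imp_le subset_iff)
  qed
  also have "\<dots> = 2 ^ card E * r ^ card P * \<beta> (card S) * card \<Psi> * ((\<Prod>f\<in>E - ?J. d f) * (\<Prod>f\<in>?J. d f))"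
    by simp
  also have "(\<Prod>f\<in>E - ?J. d f) * (\<Prod>f\<in>?J. d f) = (\<Prod>f\<in>E. d f)"
    using prod.subset_diff[OF J(1) fin(2), of d] by simp
  finally show ?thesis .
qed

text \<open>Two equal chosen edges would lie inside the core, hence coincide with the image of a
  pair and have fewer than three vertices.\<close>

lemma card_fill_inj:
  assumes "(\<psi>, X) \<in> confs"
  shows "inj_on X E" "X ` E \<subseteq> H" "X ` E \<in> copies n (expansion r F)"
proof -
  have \<psi>: "\<psi> \<in> \<Psi>" and X: "\<And>f. f \<in> E \<Longrightarrow> X f \<in> nbrs \<psi> f"
    and disj: "\<And>f g. f \<in> E \<Longrightarrow> g \<in> E \<Longrightarrow> f \<noteq> g \<Longrightarrow> X f \<inter> X g \<subseteq> u \<psi> ` P"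
    using assms by (auto simp: confs_def fillings_def)
  show "inj_on X E"
  proof (rule inj_onI, rule ccontr)
    fix f g assume fg: "f \<in> E" "g \<in> E" "X f = X g" "f \<noteq> g"
    then have "X f \<subseteq> u \<psi> ` P" using disj[of f g] by auto
    then have "X f = u \<psi> ` f" using X[OF fg(1)] by (auto simp: nbrs_def)
    then have "card (X f) \<le> 2" using edge[OF fg(1)] card_image_le[of f "u \<psi>"] by auto
    moreover have "card (X f) = r" using X[OF fg(1)] H by (auto simp: nbrs_def)
    ultimately show False using r by simp
  qed
  show "X ` E \<subseteq> H" using X by (auto simp: nbrs_def)
  show "X ` E \<in> copies n (expansion r F)"
  proof (rule expansion_copy[OF F _ inj[OF \<psi>]])
    show "X f \<subseteq> {..<n} \<and> card (X f) = r \<and> X f \<inter> u \<psi> ` P = u \<psi> ` f" if "f \<in> E" for f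
    proof -
      have "X f \<in> H" "X f \<inter> u \<psi> ` P = u \<psi> ` f" using X[OF that] by (auto simp: nbrs_def)
      then show ?thesis using H by blast
    qed
  qed (use r disj in auto)
qed

text \<open>The weight of \<open>A\<close> is the number of configurations with edge set
  \<open>A\<close>, so the relative degree of \<open>S\<close> is the probability that a random
  configuration contains \<open>S\<close>. A union bound over the ways to assign the elements of
  \<open>S\<close> to edges of \<open>F\<close> costs \<open>card E ^ card E\<close>; the base
  \<open>8\<close> is the \<open>2\<close> of the free choices times the \<open>4\<close> in the
  lower bound for the number of configurations.\<close>

theorem expansion_weight:
  shows "\<exists>w. (\<forall>A. 0 \<le> w A) \<and>
    (\<forall>A. w A \<noteq> 0 \<longrightarrow> A \<subseteq> H \<and> card A = card E \<and> A \<in> copies n (expansion r F)) \<and>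
    wdeg H w {} > 0 \<and>
    (\<forall>S. S \<subseteq> H \<longrightarrow> S \<noteq> {} \<longrightarrow>
      wdeg H w S \<le> 8 ^ card E * card E ^ card E * r ^ card P * \<beta> (card S) * wdeg H w {})"
proof -
  define w where "w A = real (card {\<phi> \<in> confs. snd \<phi> ` E = A})" for A
  have wd: "wdeg H w S = card {\<phi> \<in> confs. S \<subseteq> snd \<phi> ` E}" for S
  proof -
    have "wdeg H w S = card (\<Union>A\<in>{A. A \<subseteq> H \<and> S \<subseteq> A}. {\<phi> \<in> confs. snd \<phi> ` E = A})"
      unfolding wdeg_def w_def using fin fin_confs finite_wdeg_index[OF fin(3)]
      by (subst card_UN_disjoint) auto
    also have "(\<Union>A\<in>{A. A \<subseteq> H \<and> S \<subseteq> A}. {\<phi> \<in> confs. snd \<phi> ` E = A}) = {\<phi> \<in> confs. S \<subseteq> snd \<phi> ` E}"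
      using card_fill_inj(2) by auto
    finally show ?thesis .
  qed
  have pos: "card confs > 0"
  proof -
    have "0 < card \<Psi> * (\<Prod>f\<in>E. d f)"
      using \<Psi> d_pos by (intro mult_pos_pos prod_pos) (auto simp: card_gt_0_iff)
    then have "0 < 4 ^ card E * real (card confs)" using card_confs_ge by linarith
    then show ?thesis by (simp add: zero_less_mult_iff)
  qed
  have supp: "A \<subseteq> H \<and> card A = card E \<and> A \<in> copies n (expansion r F)" if "w A \<noteq> 0" for A
  proof -
    have "{\<phi> \<in> confs. snd \<phi> ` E = A} \<noteq> {}" using that unfolding w_def by (metis card.empty of_nat_0)
    then obtain \<psi> X where "(\<psi>, X) \<in> confs" "X ` E = A" by auto
    then show ?thesis using card_fill_inj[of \<psi> X] card_image[of X E] by auto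
  qed
  have bound: "wdeg H w S \<le> 8 ^ card E * card E ^ card E * r ^ card P * \<beta> (card S) * wdeg H w {}"
    if S: "S \<subseteq> H" "S \<noteq> {}" for S
  proof (cases "card S \<le> card E")
    case False
    have "{\<phi> \<in> confs. S \<subseteq> snd \<phi> ` E} = {}"
    proof (rule ccontr)
      assume "{\<phi> \<in> confs. S \<subseteq> snd \<phi> ` E} \<noteq> {}"
      then obtain \<phi> where "S \<subseteq> snd \<phi> ` E" by auto
      then have "card S \<le> card E" using fin by (meson card_image_le card_mono finite_imageI le_trans)
      then show False using False by simp
    qed
    then have "wdeg H w S = 0" unfolding wd by (simp only: card.empty of_nat_0)
    then show ?thesis using \<beta> by (simp add: wd)
  next
    case True
    have finS: "finite S" using S fin finite_subset by auto
    have S0: "card S > 0" using S finS by (auto simp: card_gt_0_iff)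
    let ?G = "{g \<in> PiE S (\<lambda>_. E). inj_on g S}"
    have finG: "finite (PiE S (\<lambda>_. E))" by (rule finite_PiE) (use finS fin in auto)
    have "{\<phi> \<in> confs. S \<subseteq> snd \<phi> ` E} \<subseteq> (\<Union>g\<in>?G. {\<phi> \<in> confs. \<forall>h\<in>S. snd \<phi> (g h) = h})"
    proof
      fix \<phi> assume \<phi>: "\<phi> \<in> {\<phi> \<in> confs. S \<subseteq> snd \<phi> ` E}"
      define g where "g h = (SOME f. f \<in> E \<and> snd \<phi> f = h)" for h
      have g: "g h \<in> E \<and> snd \<phi> (g h) = h" if "h \<in> S" for h
      proof -
        have "S \<subseteq> snd \<phi> ` E" using \<phi> by simp
        then have "h \<in> snd \<phi> ` E" using that by (rule subsetD)
        then obtain f where "h = snd \<phi> f" "f \<in> E" by (rule imageE)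
        then have "\<exists>f. f \<in> E \<and> snd \<phi> f = h" by (intro exI[of _ f]) simp
        then show ?thesis unfolding g_def by (rule someI_ex)
      qed
      have "inj_on (restrict g S) S"
      proof (rule inj_onI)
        fix h h' assume hh: "h \<in> S" "h' \<in> S" "restrict g S h = restrict g S h'"
        then have "g h = g h'" by simp
        then show "h = h'" using conjunct2[OF g[OF hh(1)]] conjunct2[OF g[OF hh(2)]] by metis
      qed
      moreover have "restrict g S \<in> PiE S (\<lambda>_. E)" using g by simp
      ultimately have "restrict g S \<in> ?G" by simp
      then show "\<phi> \<in> (\<Union>g\<in>?G. {\<phi> \<in> confs. \<forall>h\<in>S. snd \<phi> (g h) = h})"
        using \<phi> g by (intro UN_I[of "restrict g S"]) auto
    qed
    then have "real (card {\<phi> \<in> confs. S \<subseteq> snd \<phi> ` E}) \<le> real (card (\<Union>g\<in>?G. {\<phi> \<in> confs. \<forall>h\<in>S. snd \<phi> (g h) = h}))"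
      by (intro of_nat_mono card_mono finite_subset[OF _ fin_confs(2)]) auto
    also have "\<dots> \<le> card ?G * (2 ^ card E * r ^ card P * \<beta> (card S) * card \<Psi> * (\<Prod>f\<in>E. d f))"
      
    proof (rule card_UN_le_real)
      show "finite ?G" by (rule finite_subset[OF _ finG]) auto
      show "real (card {\<phi> \<in> confs. \<forall>h\<in>S. snd \<phi> (g h) = h})
          \<le> 2 ^ card E * r ^ card P * \<beta> (card S) * card \<Psi> * (\<Prod>f\<in>E. d f)" if "g \<in> ?G" for g
        by (rule card_prescribed_le) (use that S in auto)
    qed
    also have "\<dots> \<le> real (card E ^ card E) * (2 ^ card E * r ^ card P * \<beta> (card S) * card \<Psi> * (\<Prod>f\<in>E. d f))"
    proof (rule mult_right_mono)
      have "card ?G \<le> card (PiE S (\<lambda>_. E))" by (rule card_mono[OF finG]) auto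
      also have "\<dots> = card E ^ card S" by (simp add: card_PiE[OF finS])
      also have "\<dots> \<le> card E ^ card E" using True S0 by (intro power_increasing) auto
      finally show "real (card ?G) \<le> real (card E ^ card E)" by simp
      show "0 \<le> 2 ^ card E * r ^ card P * \<beta> (card S) * card \<Psi> * (\<Prod>f\<in>E. d f)"
        using \<beta> d_pos by (intro mult_nonneg_nonneg prod_nonneg) (auto simp: less_imp_le)
    qed
    also have "\<dots> = real (card E ^ card E) * 2 ^ card E * r ^ card P * \<beta> (card S) * (card \<Psi> * (\<Prod>f\<in>E. d f))"
      by simp
    also have "\<dots> \<le> real (card E ^ card E) * 2 ^ card E * r ^ card P * \<beta> (card S) * (4 ^ card E * real (card confs))"
      by (intro mult_left_mono card_confs_ge mult_nonneg_nonneg \<beta>) auto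
    also have "\<dots> = 8 ^ card E * card E ^ card E * r ^ card P * \<beta> (card S) * real (card confs)"
    proof -
      have "(8::real) ^ card E = 2 ^ card E * 4 ^ card E" by (simp add: power_mult_distrib[symmetric])
      then show ?thesis by simp
    qed
    finally show ?thesis by (simp add: wd)
  qed
  show ?thesis
    using supp bound pos by (intro exI[of _ w]) (auto simp: w_def wd)
qed

end

section \<open>Counting functions with prescribed or distinct values\<close>

lemma card_PiE_determined_le:
  assumes "finite A" "finite B" "A0 \<subseteq> A"
    and det: "\<And>x z z'. x \<in> A0 \<Longrightarrow> z \<in> B \<Longrightarrow> z' \<in> B \<Longrightarrow> Q x z \<Longrightarrow> Q x z' \<Longrightarrow> z = z'"
  shows "card {g \<in> PiE A (\<lambda>_. B). \<forall>x\<in>A0. Q x (g x)} \<le> card B ^ (card A - card A0)"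
proof -
  have "card {g \<in> PiE A (\<lambda>_. B). \<forall>x\<in>A0. Q x (g x)} \<le> card (PiE (A - A0) (\<lambda>_. B))"
  proof (rule card_inj_on_le[where f="\<lambda>g. restrict g (A - A0)"])
    show "inj_on (\<lambda>g. restrict g (A - A0)) {g \<in> PiE A (\<lambda>_. B). \<forall>x\<in>A0. Q x (g x)}"
    proof (rule inj_onI)
      fix g g' assume g: "g \<in> {g \<in> PiE A (\<lambda>_. B). \<forall>x\<in>A0. Q x (g x)}"
        and g': "g' \<in> {g \<in> PiE A (\<lambda>_. B). \<forall>x\<in>A0. Q x (g x)}"
        and eq: "restrict g (A - A0) = restrict g' (A - A0)"
      show "g = g'"
      proof (rule PiE_ext)
        show "g \<in> PiE A (\<lambda>_. B)" "g' \<in> PiE A (\<lambda>_. B)" using g g' by auto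
        fix x assume x: "x \<in> A"
        show "g x = g' x"
        proof (cases "x \<in> A0")
          case True
          show ?thesis by (rule det[OF True]) (use g g' x True in auto)
        next
          case False
          then show ?thesis using fun_cong[OF eq, of x] x by simp
        qed
      qed
    qed
    show "(\<lambda>g. restrict g (A - A0)) ` {g \<in> PiE A (\<lambda>_. B). \<forall>x\<in>A0. Q x (g x)} \<subseteq> PiE (A - A0) (\<lambda>_. B)"
      by auto
    show "finite (PiE (A - A0) (\<lambda>_. B))" by (rule finite_PiE) (use assms in auto)
  qed
  also have "\<dots> = card B ^ (card A - card A0)"
    using assms by (simp add: card_PiE card_Diff_subset finite_subset)
  finally show ?thesis .
qed

text \<open>The instance of compatible choices in which compatible means distinct.\<close>

lemma card_inj_PiE_ge:
  assumes "finite A" "finite B" "2 * card A \<le> card B"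
  shows "(card B) ^ card A \<le> 2 ^ card A * card {g \<in> PiE A (\<lambda>_. B). inj_on g A}"
proof -
  have "(\<Prod>f\<in>A. card B) \<le> 2 ^ card A * card {X \<in> PiE A (\<lambda>_. B). \<forall>f\<in>A. \<forall>g\<in>A. f \<noteq> g \<longrightarrow> X f \<noteq> X g}"
  proof (rule card_compatible_PiE_ge[where q="card A"])
    fix y :: 'b
    have "{x \<in> B. \<not> x \<noteq> y} \<subseteq> {y}" by auto
    then have "card {x \<in> B. \<not> x \<noteq> y} \<le> card {y}" by (intro card_mono) auto
    then have "2 * card A * card {x \<in> B. \<not> x \<noteq> y} \<le> 2 * card A * 1"
      by (intro mult_le_mono2) simp
    also have "\<dots> \<le> card B" using assms(3) by simp
    finally show "2 * card A * card {x \<in> B. \<not> x \<noteq> y} \<le> card B" .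
  qed (use assms in auto)
  moreover have "{X \<in> PiE A (\<lambda>_. B). \<forall>f\<in>A. \<forall>g\<in>A. f \<noteq> g \<longrightarrow> X f \<noteq> X g} = {g \<in> PiE A (\<lambda>_. B). inj_on g A}"
    by (auto simp: inj_on_def)
  ultimately show ?thesis by simp
qed

section \<open>Sampling complete bipartite graphs\<close>

locale regular_class =
  fixes n r :: nat and H :: "nat set set" and lab :: "nat set \<Rightarrow> nat \<Rightarrow> nat"
    and C :: "nat set set" and D :: "nat set \<Rightarrow> nat" and L :: real
  assumes n: "n \<ge> 1" and r: "r \<ge> 3" and H: "H \<subseteq> {e. e \<subseteq> {..<n} \<and> card e = r}" "H \<noteq> {}"
    and lab: "\<And>e. e \<in> H \<Longrightarrow> bij_betw (lab e) {..<r} e"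
    and C: "C \<subseteq> H" "real (card H) \<le> L * card C" and L: "L \<ge> 1"
    and D1: "\<And>U. U \<subseteq> {..<r} \<Longrightarrow> 1 \<le> D U"
    and D: "\<And>e U. e \<in> C \<Longrightarrow> U \<subseteq> {..<r} \<Longrightarrow> D U \<le> codeg H (lab e ` U) \<and> codeg H (lab e ` U) < 2 * D U"
begin

text \<open>One constant for the losses of the class: \<open>r ^ r\<close> from the tuples inside an
  edge, \<open>L\<close> from passing to the class, and small numerical factors.\<close>

definition Q :: real where "Q = 8 * r ^ r * L"

definition shadow :: "nat set \<Rightarrow> (nat \<Rightarrow> nat) set" where
  "shadow U = (\<lambda>e. restrict (lab e) U) ` C"

section \<open>Projections of the regular class\<close>

lemma finH: "finite H" and finC: "finite C"
proof -
  show "finite H" using H(1) by (rule finite_subset) (auto intro: finite_subset[of _ "Pow {..<n}"])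
  then show "finite C" using C finite_subset by auto
qed

lemma H_edge: "e \<in> H \<Longrightarrow> finite e \<and> card e = r \<and> e \<subseteq> {..<n}"
proof -
  assume "e \<in> H"
  then have "e \<subseteq> {..<n}" "card e = r" using H(1) by blast+
  then show ?thesis by (auto intro: finite_subset)
qed

lemma lab_mem: "e \<in> H \<Longrightarrow> i < r \<Longrightarrow> lab e i \<in> e"
  using lab[of e] by (auto simp: bij_betw_def)

lemma lab_inj: "e \<in> H \<Longrightarrow> i < r \<Longrightarrow> j < r \<Longrightarrow> lab e i = lab e j \<longleftrightarrow> i = j"
  using lab[of e] by (auto simp: bij_betw_def inj_on_def)

lemma lab_lt: "e \<in> H \<Longrightarrow> i < r \<Longrightarrow> lab e i < n"
  using lab_mem[of e i] H_edge[of e] by auto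

lemma Q_ge: "Q \<ge> 8" "2 * real (r ^ r) * L \<le> Q" "L \<le> Q" "4 * L \<le> Q"
proof -
  have r1: "(1::real) \<le> real (r ^ r)" using r by simp
  then have *: "1 * L \<le> real (r ^ r) * L" "1 * 1 \<le> real (r ^ r) * L" using L by (intro mult_mono; simp)+
  then show "Q \<ge> 8" "L \<le> Q" "4 * L \<le> Q" using L unfolding Q_def by auto
  show "2 * real (r ^ r) * L \<le> Q" using * L unfolding Q_def by auto
qed

lemma fin_shadow: "finite (shadow U)" using finC by (simp add: shadow_def)

text \<open>Double counting of tuples and edges containing them: a tuple in the projection has
  codegree at least \<open>D U\<close>, and an edge contains at most \<open>r ^ r\<close> tuples.
  Together with \<open>card_C_le\<close> this makes the number of projections to \<open>U\<close>
  comparable to \<open>card H / D U\<close>.\<close>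

lemma card_shadow_le:
  assumes U: "U \<subseteq> {..<r}"
  shows "card (shadow U) * D U \<le> r ^ r * card H"
proof -
  have finU: "finite U" "card U \<le> r" using U finite_subset card_mono[OF _ U] by auto
  have cod: "D U \<le> card {e \<in> H. y ` U \<subseteq> e}" if "y \<in> shadow U" for y
  proof -
    obtain e where e: "e \<in> C" "y = restrict (lab e) U" using \<open>y \<in> shadow U\<close> by (auto simp: shadow_def)
    then have "y ` U = lab e ` U" by (auto simp: image_def)
    then show ?thesis using D[OF e(1) U] by (simp add: codeg_def)
  qed
  have "card (shadow U) * D U = (\<Sum>y\<in>shadow U. D U)" by simp
  also have "\<dots> \<le> (\<Sum>y\<in>shadow U. card {e \<in> H. y ` U \<subseteq> e})" by (intro sum_mono cod)
  also have "\<dots> = card (SIGMA y:shadow U. {e \<in> H. y ` U \<subseteq> e})"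
    using finH fin_shadow by (subst card_SigmaI) auto
  also have "\<dots> \<le> card (SIGMA e:H. PiE U (\<lambda>_. e))"
  proof (rule card_inj_on_le[where f="\<lambda>(y, e). (e, y)"])
    show "(\<lambda>(y, e). (e, y)) ` (SIGMA y:shadow U. {e \<in> H. y ` U \<subseteq> e}) \<subseteq> (SIGMA e:H. PiE U (\<lambda>_. e))"
      by (auto simp: shadow_def)
    show "finite (SIGMA e:H. PiE U (\<lambda>_. e))"
      using finH finU H_edge by (intro finite_SigmaI finite_PiE) auto
  qed (auto simp: inj_on_def)
  also have "\<dots> = (\<Sum>e\<in>H. card (PiE U (\<lambda>_. e)))"
    using finH finU H_edge by (intro card_SigmaI) (auto intro!: finite_PiE)
  also have "\<dots> \<le> (\<Sum>e\<in>H. r ^ r)"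
  proof (rule sum_mono)
    fix e assume "e \<in> H"
    then have "card (PiE U (\<lambda>_. e)) = r ^ card U" using H_edge finU by (simp add: card_PiE)
    also have "\<dots> \<le> r ^ r" using finU r by (intro power_increasing) auto
    finally show "card (PiE U (\<lambda>_. e)) \<le> r ^ r" .
  qed
  also have "\<dots> = r ^ r * card H" by simp
  finally show ?thesis .
qed

lemma card_fibre_le:
  assumes U: "U \<subseteq> {..<r}"
  shows "card {e \<in> C. restrict (lab e) U = y} \<le> 2 * D U"
proof (cases "{e \<in> C. restrict (lab e) U = y} = {}")
  case False
  then obtain e0 where e0: "e0 \<in> C" "restrict (lab e0) U = y" by auto
  have "{e \<in> C. restrict (lab e) U = y} \<subseteq> {e \<in> H. lab e0 ` U \<subseteq> e}"
  proof
    fix e assume "e \<in> {e \<in> C. restrict (lab e) U = y}"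
    then have e: "e \<in> C" "restrict (lab e) U = restrict (lab e0) U" using e0 by auto
    have "lab e0 i \<in> e" if i: "i \<in> U" for i
    proof -
      have "lab e0 i = lab e i" using fun_cong[OF e(2), of i] i by simp
      then show ?thesis using lab_mem[of e i] e C i U by auto
    qed
    then show "e \<in> {e \<in> H. lab e0 ` U \<subseteq> e}" using e C by auto
  qed
  then have "card {e \<in> C. restrict (lab e) U = y} \<le> codeg H (lab e0 ` U)"
    unfolding codeg_def using finH by (intro card_mono) auto
  then show ?thesis using D[OF e0(1) U] by simp
qed (simp only: card.empty)

lemma card_C_le:
  assumes "U \<subseteq> {..<r}"
  shows "card C \<le> card (shadow U) * (2 * D U)"
proof -
  have "C = (\<Union>y\<in>shadow U. {e \<in> C. restrict (lab e) U = y})" by (auto simp: shadow_def)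
  then have "card C \<le> (\<Sum>y\<in>shadow U. card {e \<in> C. restrict (lab e) U = y})"
    using card_UN_le[OF fin_shadow, of "\<lambda>y. {e \<in> C. restrict (lab e) U = y}" U] by simp
  also have "\<dots> \<le> (\<Sum>y\<in>shadow U. 2 * D U)" by (intro sum_mono card_fibre_le assms)
  finally show ?thesis by simp
qed

lemma cardH_pos: "card H > 0" using H finH by (auto simp: card_gt_0_iff)

lemma cardC_pos: "card C > 0"
proof (rule ccontr)
  assume "\<not> card C > 0"
  then have "real (card H) \<le> 0" using C(2) by simp
  then show False using cardH_pos by simp
qed

text \<open>Enlarging \<open>U\<close> to \<open>U'\<close> multiplies the number of projections by
  at most \<open>n ^ card (U' - U)\<close>, and the number of projections times the codegree is
  about \<open>card H\<close> for both sets.\<close>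

lemma D_mono:
  assumes U: "U \<subseteq> U'" "U' \<subseteq> {..<r}"
  shows "real (D U) \<le> Q * n ^ card (U' - U) * D U'"
proof -
  have finU': "finite U'" using U finite_subset by auto
  have "card (shadow U') \<le> card (shadow U \<times> PiE (U' - U) (\<lambda>_. {..<n}))"
  proof (rule card_inj_on_le[where f="\<lambda>y. (restrict y U, restrict y (U' - U))"])
    show "inj_on (\<lambda>y. (restrict y U, restrict y (U' - U))) (shadow U')"
    proof (rule inj_onI)
      fix y y' assume y: "y \<in> shadow U'" "y' \<in> shadow U'"
        and eq: "(restrict y U, restrict y (U' - U)) = (restrict y' U, restrict y' (U' - U))"
      have e: "restrict y U = restrict y' U" "restrict y (U' - U) = restrict y' (U' - U)" using eq by auto
      show "y = y'"
      proof
        fix i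
        show "y i = y' i"
          using fun_cong[OF e(1), of i] fun_cong[OF e(2), of i] y
          by (cases "i \<in> U"; cases "i \<in> U'") (auto simp: shadow_def)
      qed
    qed
    show "(\<lambda>y. (restrict y U, restrict y (U' - U))) ` shadow U' \<subseteq> shadow U \<times> PiE (U' - U) (\<lambda>_. {..<n})"
    proof (rule image_subsetI)
      fix y assume "y \<in> shadow U'"
      then obtain e where e: "e \<in> C" "y = restrict (lab e) U'" by (auto simp: shadow_def)
      have "restrict y U = restrict (lab e) U" using U e by (auto simp: restrict_def fun_eq_iff)
      moreover have "lab e i < n" if "i \<in> U'" for i using lab_lt[of e i] e C U that by auto
      then have "restrict y (U' - U) \<in> PiE (U' - U) (\<lambda>_. {..<n})"
        using e by (intro iffD2[OF restrict_PiE_iff]) auto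
      ultimately show "(restrict y U, restrict y (U' - U)) \<in> shadow U \<times> PiE (U' - U) (\<lambda>_. {..<n})"
        using e(1) by (auto simp: shadow_def)
    qed
    show "finite (shadow U \<times> PiE (U' - U) (\<lambda>_. {..<n}))"
      using fin_shadow finU' by (intro finite_cartesian_product finite_PiE) auto
  qed
  also have "\<dots> = card (shadow U) * n ^ card (U' - U)"
    using finU' by (simp add: card_cartesian_product card_PiE)
  finally have 1: "real (card (shadow U')) \<le> card (shadow U) * n ^ card (U' - U)"
    by (metis of_nat_le_iff of_nat_mult)
  have "real (card H) * D U \<le> L * card C * D U" using C by (intro mult_right_mono) auto
  also have "\<dots> \<le> L * (card (shadow U') * (2 * D U')) * D U"
    using card_C_le[OF U(2)] L by (intro mult_right_mono mult_left_mono) (auto simp flip: of_nat_mult)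
  also have "\<dots> = real (card (shadow U')) * (L * (2 * D U') * D U)" by simp
  also have "\<dots> \<le> (card (shadow U) * n ^ card (U' - U)) * (L * (2 * D U') * D U)"
    using L by (intro mult_right_mono[OF 1]) auto
  also have "\<dots> = real (card (shadow U) * D U) * (L * n ^ card (U' - U) * (2 * D U'))" by simp
  also have "\<dots> \<le> real (r ^ r * card H) * (L * n ^ card (U' - U) * (2 * D U'))"
    using card_shadow_le[of U] U L by (intro mult_right_mono) (auto simp flip: of_nat_mult)
  finally have "real (card H) * D U \<le> real (card H) * ((2 * real (r ^ r) * L) * (n ^ card (U' - U) * D U'))"
    by (simp add: mult_ac)
  then have "real (D U) \<le> (2 * real (r ^ r) * L) * (n ^ card (U' - U) * D U')"
    using cardH_pos by (simp add: mult_ac)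
  also have "\<dots> \<le> Q * (n ^ card (U' - U) * D U')"
    by (intro mult_right_mono Q_ge) auto
  finally show ?thesis by simp
qed

lemma D_full: "D {..<r} = 1"
proof -
  obtain e where e: "e \<in> C" using cardC_pos by fastforce
  have eH: "e \<in> H" using e C by auto
  then have l: "lab e ` {..<r} = e" using lab[of e] by (simp add: bij_betw_def)
  have "e' = e" if "e' \<in> H" "e \<subseteq> e'" for e'
    using card_subset_eq[of e' e] H_edge[OF that(1)] H_edge[OF eH] that by simp
  then have "{e' \<in> H. e \<subseteq> e'} = {e}" using eH by auto
  then have "codeg H (lab e ` {..<r}) = 1" by (simp add: codeg_def l)
  then show ?thesis using D[OF e, of "{..<r}"] D1[of "{..<r}"] by simp
qed


text \<open>The \<open>s\<close> side lies in a fixed \<open>(r - 1)\<close>-tuple \<open>y\<close> and the \<open>t\<close> side in the link of \<open>y\<close>.\<close>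

lemma link_sampler:
  fixes s t c :: nat and \<iota> :: "nat \<Rightarrow> nat"
  defines "T' \<equiv> {..<r} - {c}"
  assumes c: "c < r" and \<iota>: "inj_on \<iota> {..<s}" "\<iota> ` {..<s} \<subseteq> T'"
    and large: "2 * t * Q \<le> D T'" and t: "t \<ge> 1"
  shows "\<exists>(\<Psi> :: ((nat \<Rightarrow> nat) \<times> (nat \<Rightarrow> nat set)) set) u. finite \<Psi> \<and>
    (\<forall>\<psi>\<in>\<Psi>. inj_on (u \<psi>) (verts (complete_bipartite s t))) \<and>
    (\<forall>\<psi>\<in>\<Psi>. \<forall>i<s. \<forall>j<t. \<exists>e\<in>C. u \<psi> (Inl i) = lab e (\<iota> i) \<and> u \<psi> (Inr j) = lab e c) \<and>
    real (card H) * real (D T') ^ (t - 1) \<le> (2 * Q) ^ (t + 1) * card \<Psi> \<and>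
    (\<forall>I T a. I \<subseteq> {..<s} \<longrightarrow> T \<subseteq> {..<t} \<longrightarrow> T \<noteq> {} \<longrightarrow>
      card {\<psi> \<in> \<Psi>. (\<forall>i\<in>I. u \<psi> (Inl i) = a (Inl i)) \<and> (\<forall>j\<in>T. u \<psi> (Inr j) = a (Inr j))}
        \<le> 2 * D (insert c (\<iota> ` I)) * (2 * D T') ^ (t - card T))"
proof -
  have T': "T' \<subseteq> {..<r}" by (auto simp: T'_def)
  define Cy where "Cy y = {e \<in> C. restrict (lab e) T' = y}" for y
  \<comment> \<open>Tuples whose fibre has at least half the average size; all other fibres together
    contain at most half of \<open>C\<close>.\<close>
  define good where "good = {y \<in> shadow T'. real (card C) \<le> 2 * card (shadow T') * card (Cy y)}"
  define \<Psi> where "\<Psi> = (SIGMA y:good. {g \<in> PiE {..<t} (\<lambda>_. Cy y). inj_on g {..<t}})"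
  define u where "u = (\<lambda>(y :: nat \<Rightarrow> nat, g :: nat \<Rightarrow> nat set). case_sum (\<lambda>i. y (\<iota> i)) (\<lambda>j. lab (g j) c))"
  have fCy: "finite (Cy y)" for y using finC by (simp add: Cy_def)
  have cCy: "card (Cy y) \<le> 2 * D T'" for y unfolding Cy_def by (rule card_fibre_le[OF T'])
  \<comment> \<open>Once the tuple \<open>y\<close> is fixed, an edge is determined by its vertex at
    coordinate \<open>c\<close>, so distinct edges provide distinct vertices of the \<open>t\<close>
    side.\<close>
  have Cyinj: "e = e'" if "e \<in> Cy y" "e' \<in> Cy y" "lab e c = lab e' c" for e e' y
  proof -
    have eq: "restrict (lab e) T' = restrict (lab e') T'" "e \<in> H" "e' \<in> H"
      using that C by (auto simp: Cy_def)
    have "lab e i = lab e' i" if "i < r" for i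
      using fun_cong[OF eq(1), of i] that \<open>lab e c = lab e' c\<close> by (cases "i = c") (auto simp: T'_def)
    then have "lab e ` {..<r} = lab e' ` {..<r}" by (auto simp: image_def)
    then show ?thesis using lab[OF eq(2)] lab[OF eq(3)] by (simp add: bij_betw_def)
  qed
  have Cylab: "y (\<iota> i) = lab e (\<iota> i)" if "e \<in> Cy y" "i < s" for e y i
  proof -
    have "\<iota> i \<in> T'" using \<iota>(2) that(2) by auto
    then show ?thesis using that(1) by (auto simp: Cy_def)
  qed
  have DT: "D T' \<ge> 1" by (rule D1[OF T'])
  have fingood: "finite good" using fin_shadow by (simp add: good_def)
  have finG: "finite {g \<in> PiE {..<t} (\<lambda>_. Cy y). inj_on g {..<t}}" for y
    by (rule finite_subset[of _ "PiE {..<t} (\<lambda>_. Cy y)"]) (auto intro!: finite_PiE fCy)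
  have fin\<Psi>: "finite \<Psi>" unfolding \<Psi>_def by (intro finite_SigmaI fingood finG)
  \<comment> \<open>The average fibre is \<open>card C / card (shadow T')\<close>, and
    \<open>card_shadow_le\<close> makes this comparable to \<open>D T'\<close>.\<close>
  have good_ge: "real (D T') \<le> Q * card (Cy y)" if "y \<in> good" for y
  proof -
    have "real (card H) * D T' \<le> L * card C * D T'" using C by (intro mult_right_mono) auto
    also have "\<dots> \<le> L * (2 * card (shadow T') * card (Cy y)) * D T'"
      using that L unfolding good_def by (intro mult_right_mono mult_left_mono) auto
    also have "\<dots> = real (card (shadow T') * D T') * (2 * L * card (Cy y))" by simp
    also have "\<dots> \<le> real (r ^ r * card H) * (2 * L * card (Cy y))"
      using card_shadow_le[OF T'] L by (intro mult_right_mono) (simp_all only: of_nat_le_iff, auto)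
    finally have "real (card H) * D T' \<le> real (card H) * ((2 * real (r ^ r) * L) * card (Cy y))" by (simp add: mult_ac)
    then have "real (D T') \<le> (2 * real (r ^ r) * L) * card (Cy y)"
      using cardH_pos by (simp add: mult_ac)
    also have "\<dots> \<le> Q * card (Cy y)" by (intro mult_right_mono Q_ge) auto
    finally show ?thesis .
  qed
  have card_good: "real (card H) \<le> Q * (card good * D T')"
  proof -
    have "C = (\<Union>y\<in>shadow T'. Cy y)" by (auto simp: shadow_def Cy_def)
    then have "card C \<le> (\<Sum>y\<in>shadow T'. card (Cy y))"
      using card_UN_le[OF fin_shadow, of Cy T'] by simp
    also have "\<dots> = (\<Sum>y\<in>good. card (Cy y)) + (\<Sum>y\<in>shadow T' - good. card (Cy y))"
      using sum.subset_diff[of good "shadow T'"] fin_shadow by (simp add: good_def add.commute)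
    finally have "real (card C) \<le> (\<Sum>y\<in>good. real (card (Cy y))) + (\<Sum>y\<in>shadow T' - good. real (card (Cy y)))"
      by (simp only: of_nat_sum[symmetric] of_nat_add[symmetric] of_nat_le_iff)
    also have "(\<Sum>y\<in>shadow T' - good. real (card (Cy y))) \<le> card C / 2"
    proof -
      have "(\<Sum>y\<in>shadow T' - good. real (card (Cy y))) \<le> (\<Sum>y\<in>shadow T' - good. card C / (2 * card (shadow T')))"
      proof (rule sum_mono)
        fix y assume y: "y \<in> shadow T' - good"
        then have "card (shadow T') > 0" using fin_shadow by (auto simp: card_gt_0_iff)
        moreover have "2 * card (shadow T') * card (Cy y) \<le> real (card C)" using y by (auto simp: good_def)
        ultimately show "real (card (Cy y)) \<le> card C / (2 * card (shadow T'))" by (simp add: field_simps)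
      qed
      also have "\<dots> = card (shadow T' - good) * (card C / (2 * card (shadow T')))" by simp
      also have "\<dots> \<le> card (shadow T') * (card C / (2 * card (shadow T')))"
        using fin_shadow by (intro mult_right_mono) (auto intro: card_mono)
      also have "\<dots> \<le> card C / 2" by (cases "card (shadow T') = 0") auto
      finally show ?thesis .
    qed
    also have "(\<Sum>y\<in>good. real (card (Cy y))) \<le> (\<Sum>y\<in>good. 2 * real (D T'))"
      using cCy by (intro sum_mono) (metis of_nat_le_iff of_nat_mult of_nat_numeral)
    finally have "real (card C) \<le> 4 * (card good * D T')" by simp
    then have "real (card H) \<le> L * (4 * (card good * D T'))"
      using C(2) L by (meson mult_left_mono order_trans zero_le_one)
    also have "\<dots> = (4 * L) * (card good * D T')" by simp
    also have "\<dots> \<le> Q * (card good * D T')" by (intro mult_right_mono Q_ge) auto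
    finally show ?thesis .
  qed
  have Qpos: "Q > 0" using Q_ge by linarith
  have card\<Psi>: "real (card H) * real (D T') ^ (t - 1) \<le> (2 * Q) ^ (t + 1) * card \<Psi>"
  proof -
    have inj_ge: "real (D T') ^ t \<le> (2 * Q) ^ t * card {g \<in> PiE {..<t} (\<lambda>_. Cy y). inj_on g {..<t}}"
      if y: "y \<in> good" for y
    proof -
      have "2 * real t * Q \<le> Q * card (Cy y)" using large good_ge[OF y] by simp
      then have "2 * t \<le> card (Cy y)" using Qpos by (simp add: mult.commute)
      then have "card (Cy y) ^ t \<le> 2 ^ t * card {g \<in> PiE {..<t} (\<lambda>_. Cy y). inj_on g {..<t}}"
        using card_inj_PiE_ge[of "{..<t}" "Cy y"] fCy by simp
      then have *: "real (card (Cy y)) ^ t \<le> 2 ^ t * real (card {g \<in> PiE {..<t} (\<lambda>_. Cy y). inj_on g {..<t}})"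
        by (metis (mono_tags, lifting) of_nat_le_iff of_nat_mult of_nat_numeral of_nat_power)
      have "real (D T') ^ t \<le> (Q * card (Cy y)) ^ t" using good_ge[OF y] by (intro power_mono) auto
      also have "\<dots> = Q ^ t * real (card (Cy y)) ^ t" by (rule power_mult_distrib)
      also have "\<dots> \<le> Q ^ t * (2 ^ t * real (card {g \<in> PiE {..<t} (\<lambda>_. Cy y). inj_on g {..<t}}))"
        using Qpos by (intro mult_left_mono *) auto
      finally show ?thesis by (simp add: power_mult_distrib mult_ac)
    qed
    have "real (D T') * (real (card H) * real (D T') ^ (t - 1)) = real (card H) * real (D T') ^ t"
      using t by (cases t) auto
    also have "\<dots> \<le> Q * (card good * D T') * real (D T') ^ t" by (intro mult_right_mono card_good) auto
    also have "\<dots> = Q * D T' * (\<Sum>y\<in>good. real (D T') ^ t)" by simp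
    also have "\<dots> \<le> Q * D T' * (\<Sum>y\<in>good. (2 * Q) ^ t * card {g \<in> PiE {..<t} (\<lambda>_. Cy y). inj_on g {..<t}})"
      using Qpos by (intro mult_left_mono sum_mono inj_ge) auto
    also have "\<dots> = Q * D T' * ((2 * Q) ^ t * card \<Psi>)"
      unfolding \<Psi>_def using fingood finG by (simp add: card_SigmaI sum_distrib_left)
    also have "\<dots> \<le> (2 * Q) * D T' * ((2 * Q) ^ t * card \<Psi>)"
      using Qpos by (intro mult_right_mono) auto
    finally have "real (D T') * (real (card H) * real (D T') ^ (t - 1)) \<le> real (D T') * ((2 * Q) ^ (t + 1) * card \<Psi>)"
      by (simp add: mult_ac)
    then show ?thesis using DT by (simp add: mult_ac power_mult_distrib)
  qed
  have mem: "g j \<in> Cy y" if "(y, g) \<in> \<Psi>" "j < t" for y g j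
    using that by (auto simp: \<Psi>_def)
  have edge: "\<exists>e\<in>C. u \<psi> (Inl i) = lab e (\<iota> i) \<and> u \<psi> (Inr j) = lab e c"
    if \<psi>: "\<psi> \<in> \<Psi>" and ij: "i < s" "j < t" for \<psi> i j
  proof -
    obtain y g where yg: "\<psi> = (y, g)" by (cases \<psi>)
    show ?thesis
      using mem[of y g j] Cylab[of "g j" y i] \<psi> ij yg
      by (intro bexI[of _ "g j"]) (auto simp: u_def Cy_def)
  qed
  have inju: "inj_on (u \<psi>) (verts (complete_bipartite s t))" if \<psi>: "\<psi> \<in> \<Psi>" for \<psi>
  proof -
    obtain y g where yg: "\<psi> = (y, g)" by (cases \<psi>)
    have g: "g j \<in> Cy y" "g j \<in> H" if "j < t" for j using mem \<psi> yg that C by (auto simp: Cy_def)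
    have \<iota>r: "\<iota> i < r" "\<iota> i \<noteq> c" if "i < s" for i using \<iota>(2) that by (auto simp: T'_def)
    have LL: "u \<psi> (Inl i) = u \<psi> (Inl i') \<longleftrightarrow> i = i'" if "i < s" "i' < s" for i i'
      using Cylab[OF g(1)[of 0]] lab_inj[OF g(2)[of 0], of "\<iota> i" "\<iota> i'"] t that \<iota>r \<iota>(1)
      by (auto simp: u_def yg inj_on_def)
    have LR: "u \<psi> (Inl i) \<noteq> u \<psi> (Inr j)" if "i < s" "j < t" for i j
      using Cylab[OF g(1)] lab_inj[OF g(2), of j "\<iota> i" c] that \<iota>r c by (auto simp: u_def yg)
    have RR: "u \<psi> (Inr j) = u \<psi> (Inr j') \<longleftrightarrow> j = j'" if "j < t" "j' < t" for j j'
      using Cyinj[OF g(1) g(1), of j j'] that \<psi> yg by (auto simp: u_def \<Psi>_def inj_on_def)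
    show ?thesis
    proof (rule inj_onI)
      fix x x' assume xx: "x \<in> verts (complete_bipartite s t)" "x' \<in> verts (complete_bipartite s t)"
        "u \<psi> x = u \<psi> x'"
      then show "x = x'"
        using LL LR RR by (cases x; cases x') (auto simp: complete_bipartite_def dest: sym)
    qed
  qed
  have marg: "card {\<psi> \<in> \<Psi>. (\<forall>i\<in>I. u \<psi> (Inl i) = a (Inl i)) \<and> (\<forall>j\<in>T. u \<psi> (Inr j) = a (Inr j))}
        \<le> 2 * D (insert c (\<iota> ` I)) * (2 * D T') ^ (t - card T)" (is "card ?M \<le> _")
    if I: "I \<subseteq> {..<s}" and T: "T \<subseteq> {..<t}" "T \<noteq> {}" for I T and a :: "nat + nat \<Rightarrow> nat"
  proof -
    let ?U = "insert c (\<iota> ` I)"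
    have U: "?U \<subseteq> {..<r}" using c I \<iota>(2) by (auto simp: T'_def)
    \<comment> \<open>A prescribed right vertex \<open>j0\<close> fixes the vertex at
      \<open>c\<close> of the edge \<open>g j0\<close>, and prescribed left vertices fix further
      coordinates of the same edge. Hence this edge has at most twice the codegree of these
      coordinates as its number of choices, and it determines \<open>y\<close>. Without an element
      of \<open>T\<close> there would be no such edge.\<close>
    obtain j0 where j0: "j0 \<in> T" using T by auto
    define E0 where "E0 = {e \<in> C. (\<forall>i\<in>I. lab e (\<iota> i) = a (Inl i)) \<and> lab e c = a (Inr j0)}"
    have cE0: "card E0 \<le> 2 * D ?U"
    proof (cases "E0 = {}")
      case False
      then obtain e0 where e0: "e0 \<in> E0" by auto
      have "E0 \<subseteq> {e \<in> C. restrict (lab e) ?U = restrict (lab e0) ?U}"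
        using e0 by (auto simp: E0_def fun_eq_iff restrict_def)
      then have "card E0 \<le> card {e \<in> C. restrict (lab e) ?U = restrict (lab e0) ?U}"
        using finC by (intro card_mono) auto
      also have "\<dots> \<le> 2 * D ?U" by (rule card_fibre_le[OF U])
      finally show ?thesis .
    qed simp
    define Y0 where "Y0 = (\<lambda>e. restrict (lab e) T') ` E0"
    have fE0: "finite E0" using finC by (simp add: E0_def)
    define G where "G y = {g \<in> PiE {..<t} (\<lambda>_. Cy y). \<forall>j\<in>T. lab (g j) c = a (Inr j)}" for y
    have finGy: "finite (G y)" for y
      by (rule finite_subset[of _ "PiE {..<t} (\<lambda>_. Cy y)"]) (auto simp: G_def intro!: finite_PiE fCy)
    have "?M \<subseteq> (SIGMA y:Y0. G y)"
    proof
      fix \<psi> assume \<psi>: "\<psi> \<in> ?M"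
      obtain y g where yg: "\<psi> = (y, g)" by (cases \<psi>)
      have in\<Psi>: "(y, g) \<in> \<Psi>" and u1: "\<And>i. i \<in> I \<Longrightarrow> y (\<iota> i) = a (Inl i)"
        and u2: "\<And>j. j \<in> T \<Longrightarrow> lab (g j) c = a (Inr j)"
        using \<psi> by (auto simp: yg u_def)
      have gj0: "g j0 \<in> Cy y" using mem[OF in\<Psi>] j0 T by auto
      have "lab (g j0) (\<iota> i) = a (Inl i)" if "i \<in> I" for i
        using Cylab[OF gj0, of i] u1[OF that] I that by auto
      then have "g j0 \<in> E0"
        using gj0 u2[OF j0] by (simp add: E0_def Cy_def)
      moreover have "y = restrict (lab (g j0)) T'" using gj0 by (simp add: Cy_def)
      ultimately have "y \<in> Y0" by (auto simp: Y0_def)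
      moreover have "g \<in> G y" using in\<Psi> u2 by (auto simp: G_def \<Psi>_def)
      ultimately show "\<psi> \<in> (SIGMA y:Y0. G y)" by (simp add: yg)
    qed
    then have "card ?M \<le> card (SIGMA y:Y0. G y)"
      using fE0 finGy by (intro card_mono finite_SigmaI) (auto simp: Y0_def)
    also have "\<dots> = (\<Sum>y\<in>Y0. card (G y))" using fE0 finGy by (intro card_SigmaI) (auto simp: Y0_def)
    also have "\<dots> \<le> (\<Sum>y\<in>Y0. (2 * D T') ^ (t - card T))"
    proof (rule sum_mono)
      fix y
      have "card (G y) \<le> card (Cy y) ^ (card {..<t} - card T)"
        unfolding G_def
        by (rule card_PiE_determined_le[where Q="\<lambda>j e. lab e c = a (Inr j)"]) (use fCy T Cyinj in auto)
      also have "\<dots> \<le> (2 * D T') ^ (t - card T)" by (simp only: card_lessThan) (rule power_mono[OF cCy], simp)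
      finally show "card (G y) \<le> (2 * D T') ^ (t - card T)" .
    qed
    also have "\<dots> = card Y0 * (2 * D T') ^ (t - card T)" by simp
    also have "\<dots> \<le> (2 * D ?U) * (2 * D T') ^ (t - card T)"
      using cE0 card_image_le[OF fE0, of "\<lambda>e. restrict (lab e) T'"] by (intro mult_le_mono1) (simp add: Y0_def)
    finally show ?thesis .
  qed
  have 1: "\<forall>\<psi>\<in>\<Psi>. inj_on (u \<psi>) (verts (complete_bipartite s t))" by (intro ballI inju)
  have 2: "\<forall>\<psi>\<in>\<Psi>. \<forall>i<s. \<forall>j<t. \<exists>e\<in>C. u \<psi> (Inl i) = lab e (\<iota> i) \<and> u \<psi> (Inr j) = lab e c"
    by (intro ballI allI impI edge)
  have 3: "\<forall>I T a. I \<subseteq> {..<s} \<longrightarrow> T \<subseteq> {..<t} \<longrightarrow> T \<noteq> {} \<longrightarrow>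
      card {\<psi> \<in> \<Psi>. (\<forall>i\<in>I. u \<psi> (Inl i) = a (Inl i)) \<and> (\<forall>j\<in>T. u \<psi> (Inr j) = a (Inr j))}
        \<le> 2 * D (insert c (\<iota> ` I)) * (2 * D T') ^ (t - card T)"
    by (intro allI impI marg)
  show ?thesis
    by (rule exI[of _ \<Psi>], rule exI[of _ u], intro conjI; fact fin\<Psi> 1 2 card\<Psi> 3)
qed


text \<open>A star with \<open>s\<close> leaves is sampled first, among about \<open>b\<close> centres of degree about \<open>\<Delta>\<close>; the
  \<open>t\<close> side consists of common neighbours of its leaves, of which there are about \<open>\<kappa>\<close>.\<close>

lemma star_sampler:
  fixes s t i0 j0 \<Lambda> :: nat and X :: real
  defines "D2 \<equiv> D {i0, j0}"
  defines "X \<equiv> card H / (4 * \<Lambda> * L * D2)"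
  assumes ij: "i0 < r" "j0 < r" "i0 \<noteq> j0" and \<Lambda>: "n < 2 ^ \<Lambda>" and s: "s \<ge> 1" and t: "t \<ge> 1"
    and large1: "2 * s * n \<le> X"
    and large2: "2 * t * (2 ^ (s + 1) * real \<Lambda> * real n ^ (2 * s - 1)) \<le> X ^ s"
  shows "\<exists>(\<Psi> :: ((nat \<Rightarrow> nat) \<times> (nat \<Rightarrow> nat)) set) u b \<Delta> \<kappa>. finite \<Psi> \<and>
    (\<forall>\<psi>\<in>\<Psi>. inj_on (u \<psi>) (verts (complete_bipartite s t))) \<and>
    (\<forall>\<psi>\<in>\<Psi>. \<forall>i<s. \<forall>j<t. \<exists>e\<in>C. u \<psi> (Inl i) = lab e i0 \<and> u \<psi> (Inr j) = lab e j0) \<and>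
    1 \<le> b \<and> b \<le> n \<and> 1 \<le> \<Delta> \<and> 1 \<le> \<kappa> \<and> X \<le> b * \<Delta> \<and>
    real b * real \<Delta> ^ s \<le> 2 ^ (s + 1) * real \<Lambda> * real n ^ s * \<kappa> \<and>
    real b * real \<Delta> ^ s * real \<kappa> ^ (t - 1) \<le> 2 ^ (s + t + 1) * real \<Lambda> * card \<Psi> \<and>
    (\<forall>I T a. I \<subseteq> {..<s} \<longrightarrow> T \<subseteq> {..<t} \<longrightarrow> T \<noteq> {} \<longrightarrow>
      card {\<psi> \<in> \<Psi>. (\<forall>i\<in>I. u \<psi> (Inl i) = a (Inl i)) \<and> (\<forall>j\<in>T. u \<psi> (Inr j) = a (Inr j))}
        \<le> (2 * \<Delta>) ^ (s - card I) * (2 * \<kappa>) ^ (t - card T))"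
proof -
  have ijr: "{i0, j0} \<subseteq> {..<r}" using ij by auto
  have \<Lambda>1: "\<Lambda> \<ge> 1" using \<Lambda> n by (cases \<Lambda>) auto
  have D2pos: "D2 \<ge> 1" unfolding D2_def by (rule D1[OF ijr])
  have Xpos: "X > 0" unfolding X_def using cardH_pos \<Lambda>1 L D2pos by simp
  \<comment> \<open>The bipartite graph of pairs at the two coordinates. Its size is at least about
    \<open>card H / D2\<close>; leaves come from coordinate \<open>i0\<close>, centres from
    \<open>j0\<close>.\<close>
  define \<Gamma> where "\<Gamma> = (\<lambda>e. (lab e i0, lab e j0)) ` C"
  have fin\<Gamma>: "finite \<Gamma>" using finC by (simp add: \<Gamma>_def)
  have \<Gamma>n: "v < n \<and> w < n \<and> v \<noteq> w \<and> (\<exists>e\<in>C. v = lab e i0 \<and> w = lab e j0)" if vw: "(v, w) \<in> \<Gamma>" for v w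
  proof -
    obtain e where e: "e \<in> C" "v = lab e i0" "w = lab e j0" using vw by (auto simp: \<Gamma>_def)
    then have "e \<in> H" using C by auto
    then show ?thesis using e lab_lt[of e] lab_inj[of e i0 j0] ij by auto
  qed
  define N where "N w = {v. (v, w) \<in> \<Gamma>}" for w
  have Nn: "N w \<subseteq> {..<n}" for w using \<Gamma>n by (auto simp: N_def)
  then have finN: "finite (N w)" and cN: "card (N w) \<le> n" for w
    using finite_subset[OF Nn] card_mono[OF _ Nn] by auto
  have c\<Gamma>: "card H \<le> 2 * L * D2 * card \<Gamma>"
  proof -
    have "card (shadow {i0, j0}) \<le> card \<Gamma>"
    proof (rule card_inj_on_le[where f="\<lambda>y. (y i0, y j0)"])
      show "inj_on (\<lambda>y. (y i0, y j0)) (shadow {i0, j0})"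
        by (auto simp: inj_on_def shadow_def fun_eq_iff restrict_def)
    qed (use fin\<Gamma> in \<open>auto simp: shadow_def \<Gamma>_def\<close>)
    then have "card C \<le> card \<Gamma> * (2 * D2)"
      using card_C_le[OF ijr] unfolding D2_def by (meson le_trans mult_le_mono1)
    then have "real (card C) \<le> real (card \<Gamma> * (2 * D2))" by (simp only: of_nat_le_iff)
    then have "L * card C \<le> L * real (card \<Gamma> * (2 * D2))" using L by (intro mult_left_mono) auto
    then show ?thesis using C(2) by (simp add: mult_ac)
  qed
  have "\<exists>d\<ge>1. card \<Gamma> \<le> \<Lambda> * card {x \<in> \<Gamma>. d \<le> card (N (snd x)) \<and> card (N (snd x)) < 2 * d}"
  proof (rule dyadic_class[OF fin\<Gamma> _ \<Lambda>1])
    fix x assume "x \<in> \<Gamma>"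
    then have "fst x \<in> N (snd x)" by (simp add: N_def)
    then have "card (N (snd x)) > 0" using finN by (auto simp: card_gt_0_iff)
    then show "1 \<le> card (N (snd x)) \<and> card (N (snd x)) < 2 ^ \<Lambda>" using cN[of "snd x"] \<Lambda> by linarith
  qed
  then obtain \<Delta> where \<Delta>: "\<Delta> \<ge> 1"
    "card \<Gamma> \<le> \<Lambda> * card {x \<in> \<Gamma>. \<Delta> \<le> card (N (snd x)) \<and> card (N (snd x)) < 2 * \<Delta>}" by auto
  \<comment> \<open>Centres on a common degree scale. The pigeonhole runs over pairs rather than
    over centres, so \<open>b * \<Delta>\<close> stays comparable to the number of pairs.\<close>
  define W where "W = {w. \<Delta> \<le> card (N w) \<and> card (N w) < 2 * \<Delta>}"
  have Wn: "W \<subseteq> {..<n}"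
  proof
    fix w assume "w \<in> W"
    then have "N w \<noteq> {}" using \<Delta>(1) by (auto simp: W_def)
    then show "w \<in> {..<n}" using \<Gamma>n by (auto simp: N_def)
  qed
  then have finW: "finite W" using finite_subset by auto
  define b where "b = card W"
  have bn: "b \<le> n" using card_mono[OF _ Wn] by (simp add: b_def)
  have Xb: "X \<le> b * \<Delta>"
  proof -
    have "{x \<in> \<Gamma>. \<Delta> \<le> card (N (snd x)) \<and> card (N (snd x)) < 2 * \<Delta>} \<subseteq> (\<lambda>(w, v). (v, w)) ` (SIGMA w:W. N w)"
      by (force simp: W_def N_def image_iff)
    then have "card {x \<in> \<Gamma>. \<Delta> \<le> card (N (snd x)) \<and> card (N (snd x)) < 2 * \<Delta>} \<le> card (SIGMA w:W. N w)"
      using finW finN by (meson card_image_le card_mono finite_SigmaI finite_imageI le_trans)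
    also have "\<dots> = (\<Sum>w\<in>W. card (N w))" using finW finN by (intro card_SigmaI) auto
    also have "\<dots> \<le> (\<Sum>w\<in>W. 2 * \<Delta>)" by (intro sum_mono) (auto simp: W_def)
    also have "\<dots> = 2 * (b * \<Delta>)" by (simp add: b_def)
    finally have "card \<Gamma> \<le> \<Lambda> * (2 * (b * \<Delta>))" using \<Delta>(2) by (meson le_trans mult_le_mono2)
    then have "real (card \<Gamma>) \<le> real (\<Lambda> * (2 * (b * \<Delta>)))" by (simp only: of_nat_le_iff)
    then have "2 * L * D2 * card \<Gamma> \<le> 2 * L * D2 * real (\<Lambda> * (2 * (b * \<Delta>)))"
      using L by (intro mult_left_mono) auto
    then have "card H \<le> (4 * \<Lambda> * L * D2) * (b * \<Delta>)" using c\<Gamma> by (simp add: mult_ac)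
    then show ?thesis unfolding X_def using \<Lambda>1 L D2pos by (simp add: divide_le_eq mult_ac)
  qed
  have b1: "b \<ge> 1" using Xb Xpos by (cases b) auto
  \<comment> \<open>There are at most \<open>n\<close> centres, so
    \<open>X \<le> b * \<Delta>\<close> forces large degrees.\<close>
  have \<Delta>s: "2 * s \<le> \<Delta>"
  proof -
    have "2 * real s * n \<le> real b * \<Delta>" using large1 Xb by simp
    also have "\<dots> \<le> real n * \<Delta>" using bn by (intro mult_right_mono) auto
    finally have "real n * (2 * real s) \<le> real n * \<Delta>" by (simp add: mult_ac)
    then have "2 * real s \<le> \<Delta>" using n by (simp add: mult_ac power_mult_distrib)
    then show ?thesis by linarith
  qed
  have Wcard: "\<Delta> \<le> card (N w)" "card (N w) \<le> 2 * \<Delta>" if "w \<in> W" for w using that by (auto simp: W_def)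
  define S where "S = (SIGMA w:W. {v \<in> PiE {..<s} (\<lambda>_. N w). inj_on v {..<s}})"
  have finS1: "finite {v \<in> PiE {..<s} (\<lambda>_. N w). inj_on v {..<s}}" for w
    by (rule finite_subset[of _ "PiE {..<s} (\<lambda>_. N w)"]) (auto intro!: finite_PiE finN)
  have finS: "finite S" unfolding S_def by (intro finite_SigmaI finW finS1)
  have cS: "b * \<Delta> ^ s \<le> 2 ^ s * card S"
  proof -
    have "b * \<Delta> ^ s = (\<Sum>w\<in>W. \<Delta> ^ s)" by (simp add: b_def)
    also have "\<dots> \<le> (\<Sum>w\<in>W. 2 ^ s * card {v \<in> PiE {..<s} (\<lambda>_. N w). inj_on v {..<s}})"
    proof (rule sum_mono)
      fix w assume w: "w \<in> W"
      have "\<Delta> ^ s \<le> card (N w) ^ s" using Wcard[OF w] by (intro power_mono) auto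
      also have "\<dots> \<le> 2 ^ s * card {v \<in> PiE {..<s} (\<lambda>_. N w). inj_on v {..<s}}"
        using card_inj_PiE_ge[of "{..<s}" "N w"] finN Wcard[OF w] \<Delta>s by simp
      finally show "\<Delta> ^ s \<le> 2 ^ s * card {v \<in> PiE {..<s} (\<lambda>_. N w). inj_on v {..<s}}" .
    qed
    also have "\<dots> = 2 ^ s * card S" unfolding S_def using finW finS1 by (simp add: card_SigmaI sum_distrib_left)
    finally show ?thesis .
  qed
  \<comment> \<open>Common neighbours are taken inside \<open>W\<close> only, so every centre that
    is used has degree at most \<open>2 * \<Delta>\<close>; the bound on the marginals needs
    this.\<close>
  define M where "M v = {w \<in> W. \<forall>i<s. v i \<in> N w}" for v
  have finM: "finite (M v)" and cM: "card (M v) \<le> n" for v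
  proof -
    have "M v \<subseteq> W" by (auto simp: M_def)
    then show "finite (M v)" "card (M v) \<le> n"
      using finite_subset[OF _ finW] order_trans[OF card_mono[OF finW] bn[unfolded b_def]] by simp_all
  qed
  have SM: "fst x \<in> M (snd x)" if "x \<in> S" for x
  proof -
    have "fst x \<in> W" "snd x \<in> PiE {..<s} (\<lambda>_. N (fst x))" using that by (cases x; simp add: S_def)+
    then show ?thesis using PiE_mem[of "snd x" "{..<s}" "\<lambda>_. N (fst x)"] by (simp add: M_def)
  qed
  have "\<exists>d\<ge>1. card S \<le> \<Lambda> * card {x \<in> S. d \<le> card (M (snd x)) \<and> card (M (snd x)) < 2 * d}"
  proof (rule dyadic_class[OF finS _ \<Lambda>1])
    fix x assume "x \<in> S"
    then have "fst x \<in> M (snd x)" by (rule SM)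
    then have "card (M (snd x)) > 0" using finM[of "snd x"] card_gt_0_iff[of "M (snd x)"] by blast
    then show "1 \<le> card (M (snd x)) \<and> card (M (snd x)) < 2 ^ \<Lambda>" using cM[of "snd x"] \<Lambda> by linarith
  qed
  then obtain \<kappa> where \<kappa>: "\<kappa> \<ge> 1"
    "card S \<le> \<Lambda> * card {x \<in> S. \<kappa> \<le> card (M (snd x)) \<and> card (M (snd x)) < 2 * \<kappa>}" by auto
  \<comment> \<open>Leaf tuples with about \<kappa> common neighbours. Again the pigeonhole runs
    over incidences, so \<open>card V * \<kappa>\<close> is comparable to the number of
    stars.\<close>
  define V where "V = {v \<in> snd ` S. \<kappa> \<le> card (M v) \<and> card (M v) < 2 * \<kappa>}"
  have finV: "finite V" using finS by (simp add: V_def)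
  have cV: "card S \<le> 2 * \<Lambda> * (card V * \<kappa>)"
  proof -
    have "{x \<in> S. \<kappa> \<le> card (M (snd x)) \<and> card (M (snd x)) < 2 * \<kappa>} \<subseteq> (\<lambda>(v, w). (w, v)) ` (SIGMA v:V. M v)"
    proof
      fix x assume x: "x \<in> {x \<in> S. \<kappa> \<le> card (M (snd x)) \<and> card (M (snd x)) < 2 * \<kappa>}"
      then have "snd x \<in> V" "fst x \<in> M (snd x)" using SM[of x] by (simp_all add: V_def)
      then have "(snd x, fst x) \<in> (SIGMA v:V. M v)" by simp
      then show "x \<in> (\<lambda>(v, w). (w, v)) ` (SIGMA v:V. M v)" by (rule rev_image_eqI) simp
    qed
    then have "card {x \<in> S. \<kappa> \<le> card (M (snd x)) \<and> card (M (snd x)) < 2 * \<kappa>} \<le> card (SIGMA v:V. M v)"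
      using finV finM by (meson card_image_le card_mono finite_SigmaI finite_imageI le_trans)
    also have "\<dots> = (\<Sum>v\<in>V. card (M v))" using finV finM by (intro card_SigmaI) auto
    also have "\<dots> \<le> (\<Sum>v\<in>V. 2 * \<kappa>)" by (intro sum_mono) (auto simp: V_def)
    also have "\<dots> = 2 * (card V * \<kappa>)" by simp
    finally have "card S \<le> \<Lambda> * (2 * (card V * \<kappa>))" using \<kappa>(2) by (meson le_trans mult_le_mono2)
    then show ?thesis by (simp add: mult_ac)
  qed
  have VP: "v \<in> PiE {..<s} (\<lambda>_. {..<n})" "inj_on v {..<s}" if "v \<in> V" for v
  proof -
    obtain w where "(w, v) \<in> S" using \<open>v \<in> V\<close> by (auto simp: V_def)
    then show "v \<in> PiE {..<s} (\<lambda>_. {..<n})" "inj_on v {..<s}"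
      using Nn[of w] by (auto simp: S_def PiE_def Pi_def)
  qed
  have "card V \<le> card (PiE {..<s} (\<lambda>_. {..<n}))"
    using VP by (intro card_mono finite_PiE) auto
  then have Vn: "card V \<le> n ^ s" by (simp add: card_PiE)
  have chain: "real b * real \<Delta> ^ s \<le> 2 ^ (s + 1) * real \<Lambda> * (card V * \<kappa>)"
  proof -
    have "b * \<Delta> ^ s \<le> 2 ^ s * (2 * \<Lambda> * (card V * \<kappa>))" using cS cV by (meson le_trans mult_le_mono2)
    then have "real (b * \<Delta> ^ s) \<le> real (2 ^ s * (2 * \<Lambda> * (card V * \<kappa>)))" by (simp only: of_nat_le_iff)
    then show ?thesis by (simp add: mult_ac)
  qed
  \<comment> \<open>Only \<open>n ^ s\<close> leaf tuples exist, so many stars force many stars on a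
    common leaf tuple.\<close>
  have \<kappa>_ge: "real b * real \<Delta> ^ s \<le> 2 ^ (s + 1) * real \<Lambda> * real n ^ s * \<kappa>"
  proof -
    have "real (card V) \<le> real n ^ s" using Vn by (metis of_nat_le_iff of_nat_power)
    then have "real (card V) * \<kappa> \<le> real n ^ s * \<kappa>" by (intro mult_right_mono) auto
    then have "2 ^ (s + 1) * real \<Lambda> * (card V * \<kappa>) \<le> 2 ^ (s + 1) * real \<Lambda> * (real n ^ s * \<kappa>)"
      unfolding of_nat_mult by (intro mult_left_mono) auto
    then show ?thesis using chain by (simp add: mult_ac)
  qed
  have \<kappa>t: "2 * t \<le> \<kappa>"
  proof -
    have "X ^ s \<le> (real b * \<Delta>) ^ s" using Xb Xpos by (intro power_mono) auto
    also have "\<dots> = real b ^ (s - 1) * (real b * real \<Delta> ^ s)"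
      using s by (cases s) (auto simp: power_mult_distrib)
    also have "\<dots> \<le> real n ^ (s - 1) * (2 ^ (s + 1) * real \<Lambda> * real n ^ s * \<kappa>)"
    proof (rule mult_mono[OF _ \<kappa>_ge])
      show "real b ^ (s - 1) \<le> real n ^ (s - 1)" using bn by (intro power_mono) auto
    qed auto
    also have "\<dots> = (2 ^ (s + 1) * real \<Lambda> * real n ^ (2 * s - 1)) * \<kappa>"
    proof -
      have "2 * s - 1 = (s - 1) + s" using s by auto
      then show ?thesis by (simp add: power_add mult_ac)
    qed
    finally have "(2 ^ (s + 1) * real \<Lambda> * real n ^ (2 * s - 1)) * real (2 * t) \<le> (2 ^ (s + 1) * real \<Lambda> * real n ^ (2 * s - 1)) * \<kappa>"
      using large2 by (simp add: mult_ac)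
    then have "real (2 * t) \<le> \<kappa>" using \<Lambda>1 n by (simp add: mult_ac power_mult_distrib)
    then show ?thesis by (simp only: of_nat_le_iff)
  qed
  define G where "G v = {g \<in> PiE {..<t} (\<lambda>_. M v). inj_on g {..<t}}" for v
  have finG: "finite (G v)" for v
    by (rule finite_subset[of _ "PiE {..<t} (\<lambda>_. M v)"]) (auto simp: G_def intro!: finite_PiE finM)
  define \<Psi> where "\<Psi> = (SIGMA v:V. G v)"
  define u where "u = (\<lambda>(v :: nat \<Rightarrow> nat, g :: nat \<Rightarrow> nat). case_sum v g)"
  have fin\<Psi>: "finite \<Psi>" unfolding \<Psi>_def by (intro finite_SigmaI finV finG)
  have card\<Psi>: "real b * real \<Delta> ^ s * real \<kappa> ^ (t - 1) \<le> 2 ^ (s + t + 1) * real \<Lambda> * card \<Psi>"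
  proof -
    have "card V * \<kappa> ^ t = (\<Sum>v\<in>V. \<kappa> ^ t)" by simp
    also have "\<dots> \<le> (\<Sum>v\<in>V. 2 ^ t * card (G v))"
    proof (rule sum_mono)
      fix v assume v: "v \<in> V"
      have "\<kappa> ^ t \<le> card (M v) ^ t" using v by (intro power_mono) (auto simp: V_def)
      also have "\<dots> \<le> 2 ^ t * card (G v)"
        using card_inj_PiE_ge[of "{..<t}" "M v"] finM v \<kappa>t by (simp add: V_def G_def)
      finally show "\<kappa> ^ t \<le> 2 ^ t * card (G v)" .
    qed
    also have "\<dots> = 2 ^ t * card \<Psi>" unfolding \<Psi>_def using finV finG by (simp add: card_SigmaI sum_distrib_left)
    finally have *: "real (card V * \<kappa> ^ t) \<le> real (2 ^ t * card \<Psi>)" by (simp only: of_nat_le_iff)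
    have "real b * real \<Delta> ^ s * real \<kappa> ^ (t - 1) \<le> 2 ^ (s + 1) * real \<Lambda> * (card V * \<kappa>) * real \<kappa> ^ (t - 1)"
      by (intro mult_right_mono chain) auto
    also have "\<dots> = 2 ^ (s + 1) * real \<Lambda> * real (card V * \<kappa> ^ t)" using t by (cases t) auto
    also have "\<dots> \<le> 2 ^ (s + 1) * real \<Lambda> * real (2 ^ t * card \<Psi>)" by (intro mult_left_mono *) auto
    finally show ?thesis by (simp add: power_add mult_ac)
  qed
  have mem: "v i \<in> N (g j)" "g j \<in> W" "(v i, g j) \<in> \<Gamma>" if "(v, g) \<in> \<Psi>" "i < s" "j < t" for v g i j
  proof -
    have "g j \<in> M v" using that by (auto simp: \<Psi>_def G_def)
    then show "v i \<in> N (g j)" "g j \<in> W" "(v i, g j) \<in> \<Gamma>" using that by (auto simp: M_def N_def)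
  qed
  have edge: "\<exists>e\<in>C. u \<psi> (Inl i) = lab e i0 \<and> u \<psi> (Inr j) = lab e j0"
    if \<psi>: "\<psi> \<in> \<Psi>" and ij: "i < s" "j < t" for \<psi> i j
  proof -
    obtain v g where vg: "\<psi> = (v, g)" by (cases \<psi>)
    show ?thesis using \<Gamma>n[OF mem(3)[of v g i j]] \<psi> ij vg by (auto simp: u_def)
  qed
  have inju: "inj_on (u \<psi>) (verts (complete_bipartite s t))" if \<psi>: "\<psi> \<in> \<Psi>" for \<psi>
  proof -
    obtain v g where vg: "\<psi> = (v, g)" by (cases \<psi>)
    have 1: "inj_on v {..<s}" "inj_on g {..<t}" using \<psi> vg VP by (auto simp: \<Psi>_def G_def)
    have 2: "v i \<noteq> g j" if "i < s" "j < t" for i j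
      using \<Gamma>n[OF mem(3)[of v g i j]] \<psi> vg that by auto
    show ?thesis
    proof (rule inj_onI)
      fix x x' assume xx: "x \<in> verts (complete_bipartite s t)" "x' \<in> verts (complete_bipartite s t)"
        "u \<psi> x = u \<psi> x'"
      then show "x = x'"
        using 1 2 by (cases x; cases x') (auto simp: complete_bipartite_def u_def vg inj_on_def dest: sym)
    qed
  qed
  have marg: "card {\<psi> \<in> \<Psi>. (\<forall>i\<in>I. u \<psi> (Inl i) = a (Inl i)) \<and> (\<forall>j\<in>T. u \<psi> (Inr j) = a (Inr j))}
        \<le> (2 * \<Delta>) ^ (s - card I) * (2 * \<kappa>) ^ (t - card T)" (is "card ?M \<le> _")
    if I: "I \<subseteq> {..<s}" and T: "T \<subseteq> {..<t}" "T \<noteq> {}" for I T and a :: "nat + nat \<Rightarrow> nat"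
  proof (cases "?M = {}")
    case False
    obtain k where k: "k \<in> T" using T by auto
    have kt: "k < t" using k T by auto
    \<comment> \<open>One prescribed centre \<open>w\<close> confines every leaf to its
      neighbourhood, and the remaining centres are then common neighbours of the leaves.\<close>
    define w where "w = a (Inr k)"
    define V0 where "V0 = {v \<in> PiE {..<s} (\<lambda>_. N w). \<forall>i\<in>I. v i = a (Inl i)}"
    define G0 where "G0 v = {g \<in> PiE {..<t} (\<lambda>_. M v). \<forall>j\<in>T. g j = a (Inr j)}" for v
    have finV0: "finite V0" by (rule finite_subset[of _ "PiE {..<s} (\<lambda>_. N w)"]) (auto simp: V0_def intro!: finite_PiE finN)
    have finG0: "finite (G0 v)" for v
      by (rule finite_subset[of _ "PiE {..<t} (\<lambda>_. M v)"]) (auto simp: G0_def intro!: finite_PiE finM)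
    have sub: "?M \<subseteq> (SIGMA v:V0 \<inter> V. G0 v)"
    proof
      fix \<psi> assume \<psi>: "\<psi> \<in> ?M"
      obtain v g where vg: "\<psi> = (v, g)" by (cases \<psi>)
      have in\<Psi>: "(v, g) \<in> \<Psi>" and u1: "\<And>i. i \<in> I \<Longrightarrow> v i = a (Inl i)"
        and u2: "\<And>j. j \<in> T \<Longrightarrow> g j = a (Inr j)"
        using \<psi> by (auto simp: vg u_def)
      have "v \<in> V" using in\<Psi> by (simp add: \<Psi>_def)
      moreover have "v \<in> PiE {..<s} (\<lambda>_. N w)"
        using VP(1)[OF \<open>v \<in> V\<close>] mem(1)[OF in\<Psi> _ kt] u2[OF k] by (auto simp: w_def PiE_def)
      ultimately show "\<psi> \<in> (SIGMA v:V0 \<inter> V. G0 v)"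
        using u1 u2 in\<Psi> by (auto simp: V0_def G0_def vg \<Psi>_def G_def)
    qed
    have wW: "w \<in> W"
    proof -
      obtain v g where vg: "(v, g) \<in> ?M" using False by auto
      then have "(v, g) \<in> \<Psi>" "g k = w" using k by (auto simp: w_def u_def)
      then show ?thesis using mem(2)[of v g 0 k] s kt by auto
    qed
    have "card ?M \<le> card (SIGMA v:V0 \<inter> V. G0 v)"
      using sub finV0 finG0 by (intro card_mono finite_SigmaI) auto
    also have "\<dots> = (\<Sum>v\<in>V0 \<inter> V. card (G0 v))" using finV0 finG0 by (intro card_SigmaI) auto
    also have "\<dots> \<le> (\<Sum>v\<in>V0 \<inter> V. (2 * \<kappa>) ^ (t - card T))"
    proof (rule sum_mono)
      fix v assume v: "v \<in> V0 \<inter> V"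
      have "card (G0 v) \<le> card (M v) ^ (card {..<t} - card T)"
        unfolding G0_def
        by (rule card_PiE_determined_le[where Q="\<lambda>j e. e = a (Inr j)"]) (use finM T in auto)
      also have "\<dots> \<le> (2 * \<kappa>) ^ (t - card T)" using v by (simp only: card_lessThan) (intro power_mono; simp add: V_def)
      finally show "card (G0 v) \<le> (2 * \<kappa>) ^ (t - card T)" .
    qed
    also have "\<dots> = card (V0 \<inter> V) * (2 * \<kappa>) ^ (t - card T)" by simp
    also have "\<dots> \<le> (2 * \<Delta>) ^ (s - card I) * (2 * \<kappa>) ^ (t - card T)"
    proof (rule mult_le_mono1)
      have "card (V0 \<inter> V) \<le> card V0" using finV0 by (intro card_mono) auto
      also have "\<dots> \<le> card (N w) ^ (card {..<s} - card I)"
        unfolding V0_def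
        by (rule card_PiE_determined_le[where Q="\<lambda>j e. e = a (Inl j)"]) (use finN I in auto)
      also have "\<dots> \<le> (2 * \<Delta>) ^ (s - card I)" by (simp only: card_lessThan) (intro power_mono Wcard wW; simp)
      finally show "card (V0 \<inter> V) \<le> (2 * \<Delta>) ^ (s - card I)" .
    qed
    finally show ?thesis .
  qed (simp only: card.empty)
  have 1: "\<forall>\<psi>\<in>\<Psi>. inj_on (u \<psi>) (verts (complete_bipartite s t))" by (intro ballI inju)
  have 2: "\<forall>\<psi>\<in>\<Psi>. \<forall>i<s. \<forall>j<t. \<exists>e\<in>C. u \<psi> (Inl i) = lab e i0 \<and> u \<psi> (Inr j) = lab e j0"
    by (intro ballI allI impI edge)
  have 3: "\<forall>I T a. I \<subseteq> {..<s} \<longrightarrow> T \<subseteq> {..<t} \<longrightarrow> T \<noteq> {} \<longrightarrow>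
      card {\<psi> \<in> \<Psi>. (\<forall>i\<in>I. u \<psi> (Inl i) = a (Inl i)) \<and> (\<forall>j\<in>T. u \<psi> (Inr j) = a (Inr j))}
        \<le> (2 * \<Delta>) ^ (s - card I) * (2 * \<kappa>) ^ (t - card T)"
    by (intro allI impI marg)
  show ?thesis
    by (rule exI[of _ \<Psi>], rule exI[of _ u], rule exI[of _ b], rule exI[of _ \<Delta>], rule exI[of _ \<kappa>], intro conjI;
      (fact fin\<Psi> 1 2 b1 bn \<Delta>(1) \<kappa>(1) Xb \<kappa>_ge card\<Psi> 3 | insert Xb \<kappa>_ge card\<Psi>, simp; fail))
qed

end

section \<open>Exponents\<close>

lemma affine_nonneg:
  fixes a b y lo hi :: real
  assumes "lo \<le> y" "y \<le> hi" "0 \<le> a + b * lo" "0 \<le> a + b * hi"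
  shows "0 \<le> a + b * y"
proof (cases "0 \<le> b")
  case True
  then show ?thesis using assms mult_left_mono[of lo y b] by linarith
next
  case False
  then show ?thesis using assms mult_left_mono_neg[of y hi b] by linarith
qed

text \<open>A function that is affine in each variable attains its minimum over a rectangle at a
  corner.\<close>

lemma bilinear_nonneg:
  fixes a b c d X Y :: real
  assumes "x0 \<le> X" "X \<le> x1" "y0 \<le> Y" "Y \<le> y1"
    "0 \<le> a + b * x0 + c * y0 + d * x0 * y0" "0 \<le> a + b * x0 + c * y1 + d * x0 * y1"
    "0 \<le> a + b * x1 + c * y0 + d * x1 * y0" "0 \<le> a + b * x1 + c * y1 + d * x1 * y1"
  shows "0 \<le> a + b * X + c * Y + d * X * Y"
proof -
  have 0: "0 \<le> (a + b * x0) + (c + d * x0) * Y" by (rule affine_nonneg[OF assms(3,4)]) (use assms in \<open>simp_all add: algebra_simps\<close>)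
  have 1: "0 \<le> (a + b * x1) + (c + d * x1) * Y" by (rule affine_nonneg[OF assms(3,4)]) (use assms in \<open>simp_all add: algebra_simps\<close>)
  have "0 \<le> (a + c * Y) + (b + d * Y) * X"
    by (rule affine_nonneg[OF assms(1,2)]) (use 0 1 in \<open>simp_all add: algebra_simps\<close>)
  then show ?thesis by (simp add: algebra_simps)
qed

section \<open>Exponents and the inequalities between them\<close>

locale kst_exponents =
  fixes s t :: nat
  assumes s2: "2 \<le> s" and st: "s \<le> t"
begin

definition N :: real where "N = real s * real t - 1"
definition x :: real where "x = (real s + real t - 2) / N"
text \<open>Chosen with \<epsilon> so that \<open>1 - s * \<delta>0 = \<epsilon>\<close> and
  \<open>1 - \<delta>0 = t * \<epsilon>\<close>: at pair density \<open>n powr (- \<delta>0)\<close>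
  one expects \<open>n powr \<epsilon>\<close> common neighbours of \<open>s\<close> vertices, and
  degrees are the \<open>t\<close>-th power of this number.\<close>

definition \<delta>0 :: real where "\<delta>0 = (real t - 1) / N"
definition \<epsilon> :: real where "\<epsilon> = (real s - 1) / N"

lemma reals: "2 \<le> real s" "real s \<le> real t" using s2 st by auto

lemma N_pos: "N > 0"
proof -
  have "2 * 2 \<le> real s * real t" using reals by (intro mult_mono) auto
  then show ?thesis by (simp add: N_def)
qed

lemma scaled: "N * x = real s + real t - 2" "N * \<delta>0 = real t - 1" "N * \<epsilon> = real s - 1"
  using N_pos by (simp_all add: x_def \<delta>0_def \<epsilon>_def)

lemma exponents: "x = \<delta>0 + \<epsilon>" "0 < \<epsilon>" "\<epsilon> \<le> \<delta>0" "1 - s * \<delta>0 = \<epsilon>" "1 - \<delta>0 = t * \<epsilon>" "\<delta>0 < 1" "x \<le> 1"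
proof -
  show 1: "x = \<delta>0 + \<epsilon>" by (simp add: x_def \<delta>0_def \<epsilon>_def add_divide_distrib[symmetric])
  show 2: "0 < \<epsilon>" using N_pos reals by (simp add: \<epsilon>_def)
  show "\<epsilon> \<le> \<delta>0" using N_pos reals by (simp add: \<epsilon>_def \<delta>0_def divide_right_mono)
  have "N * (1 - s * \<delta>0) = N - s * (N * \<delta>0)" by (simp add: algebra_simps)
  also have "\<dots> = N * \<epsilon>" unfolding scaled by (simp add: algebra_simps N_def)
  finally have "N * (1 - s * \<delta>0) = N * \<epsilon>" .
  then show "1 - s * \<delta>0 = \<epsilon>" using N_pos by simp
  have "N * (1 - \<delta>0) = N - N * \<delta>0" by (simp add: algebra_simps)
  also have "\<dots> = t * (N * \<epsilon>)" unfolding scaled by (simp add: algebra_simps N_def)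
  finally have "N * (1 - \<delta>0) = N * (t * \<epsilon>)" by (simp only: mult.left_commute)
  then show 3: "1 - \<delta>0 = t * \<epsilon>" using N_pos by simp
  show "\<delta>0 < 1" using 3 2 reals by (smt (verit) mult_pos_pos)
  have "1 * \<epsilon> \<le> t * \<epsilon>" using 2 reals by (intro mult_right_mono) auto
  then show "x \<le> 1" using 1 3 by linarith
qed

text \<open>Scaled by \<open>N\<close>, the values at the corners \<open>(1, 1)\<close>,
  \<open>(1, t)\<close>, \<open>(s, 1)\<close> and \<open>(s, t)\<close> are \<open>0\<close>,
  \<open>(t - 1) * (t - s)\<close>, \<open>s * (s - 1) * (t - 1)\<close> and
  \<open>(t - 1) ^ 2\<close>. The second uses \<open>s \<le> t\<close>.\<close>

lemma poly_general:
  fixes A T :: real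
  assumes "1 \<le> A" "A \<le> real s" "1 \<le> T" "T \<le> real t"
  shows "0 \<le> A - 1 + x - A * T * \<epsilon> + (T - 2) * \<delta>0"
proof -
  have st1: "0 \<le> (real s - 1) * (real t - 1)" "0 \<le> (real t - 1) * (real t - real s)"
    "0 \<le> (real s - 1) * (real s * real t - real s)" "0 \<le> (real t - 1)\<^sup>2"
    using reals mult_left_mono[of 1 "real t" "real s"] by (simp_all add: mult_nonneg_nonneg)
  have "0 \<le> (- N + (real s + real t - 2) - 2 * (real t - 1)) + N * A + (real t - 1) * T + (- (real s - 1)) * A * T"
    by (rule bilinear_nonneg[OF assms])
      (use st1 in \<open>simp_all add: N_def algebra_simps power2_eq_square\<close>)
  also have "\<dots> = N * (A - 1 + x - A * T * \<epsilon> + (T - 2) * \<delta>0)"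
    unfolding scaled[symmetric] by (simp add: algebra_simps)
  finally show ?thesis using N_pos by (simp add: zero_le_mult_iff)
qed

text \<open>Serves one prescribed right vertex. There the codegree bound through the link size would
  enter with the negative coefficient \<open>T - 2\<close>, so the trivial codegree bound is used
  instead.\<close>

lemma poly_single:
  assumes "2 \<le> A"
  shows "0 \<le> A - 2 + x - A * \<epsilon>"
proof -
  have "\<epsilon> \<le> 1" using exponents by linarith
  then have "0 \<le> (A - 2) * (1 - \<epsilon>)" using assms by (intro mult_nonneg_nonneg) auto
  then show ?thesis using exponents by (simp add: algebra_simps)
qed

text \<open>Serves \<open>r = s + 1\<close> when the whole \<open>s\<close> side is prescribed.
  Scaled by \<open>N\<close>, the value at \<open>T = t\<close> is
  \<open>t * (t - s - 1) + 1\<close>, which would be \<open>1 - s\<close> for \<open>t = s\<close>;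
  hence the assumption \<open>s + 1 \<le> t\<close>.\<close>

lemma poly_tight:
  fixes T :: real
  assumes "1 \<le> T" "T \<le> real t" "s + 1 \<le> t"
  shows "0 \<le> real s - 2 + x - s * T * \<epsilon> + (T - 1) * \<delta>0"
proof -
  have t: "real s + 1 \<le> real t" using assms(3) by linarith
  have "0 \<le> ((real s - 2) * N + (real s + real t - 2) - (real t - 1)) + ((real t - 1) - real s * (real s - 1)) * T"
  proof (rule affine_nonneg[OF assms(1,2)])
    have "1 * (real s + 1) \<le> (real s - 1) * real t" using reals t by (intro mult_mono) auto
    then have "0 \<le> (real s - 1) * ((real s - 1) * real t - real s)"
      using reals by (intro mult_nonneg_nonneg) auto
    then show "0 \<le> ((real s - 2) * N + (real s + real t - 2) - (real t - 1)) + ((real t - 1) - real s * (real s - 1)) * 1"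
      by (simp add: N_def algebra_simps)
    have "0 \<le> real t * (real t - (real s + 1))" using t by (intro mult_nonneg_nonneg) auto
    then show "0 \<le> ((real s - 2) * N + (real s + real t - 2) - (real t - 1)) + ((real t - 1) - real s * (real s - 1)) * real t"
      by (simp add: N_def algebra_simps)
  qed
  also have "\<dots> = N * (real s - 2 + x - s * T * \<epsilon> + (T - 1) * \<delta>0)"
    unfolding scaled[symmetric] by (simp add: algebra_simps)
  finally show ?thesis using N_pos by (simp add: zero_le_mult_iff)
qed

text \<open>Scaled by \<open>N\<close>, the value vanishes at the corners \<open>(1, 1)\<close>,
  \<open>(1, t)\<close> and \<open>(s, t)\<close>, which are the critical subgraphs, and equals
  \<open>(s - 1) ^ 2 * (t - 1)\<close> at \<open>(s, 1)\<close>.\<close>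

lemma poly_star:
  fixes A T :: real
  assumes "1 \<le> A" "A \<le> real s" "1 \<le> T" "T \<le> real t"
  shows "0 \<le> - (2 - x) - A * T * \<epsilon> + 1 + A * (1 - \<delta>0) + (T - 1) * \<epsilon>"
proof -
  have st1: "0 \<le> (real s - 1) * ((real s - 1) * (real t - 1))"
    using reals by (intro mult_nonneg_nonneg) auto
  have "0 \<le> (- N + (real s + real t - 2) - (real s - 1)) + (N - (real t - 1)) * A + (real s - 1) * T + (- (real s - 1)) * A * T"
    by (rule bilinear_nonneg[OF assms])
      (use st1 in \<open>simp_all add: N_def algebra_simps power2_eq_square\<close>)
  also have "\<dots> = N * (- (2 - x) - A * T * \<epsilon> + 1 + A * (1 - \<delta>0) + (T - 1) * \<epsilon>)"
    unfolding scaled[symmetric] by (simp add: algebra_simps)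
  finally show ?thesis using N_pos by (simp add: zero_le_mult_iff)
qed

text \<open>Here and in \<open>star_exponent\<close> the variables are logarithms to base \<open>n\<close> of the parameters of the
  sampler, and \<open>\<theta>\<close> absorbs polylogarithmic factors.\<close>

lemma link_exponent:
  fixes \<mu> \<delta> dI \<theta> \<Sigma> A T j R :: real
  assumes A: "1 \<le> A" "A \<le> real s" and T: "1 \<le> T" "T \<le> real t" "T = 1 \<or> 2 \<le> T" and j: "j \<le> A * T"
    and \<mu>: "R - 1 \<le> \<mu>" and \<theta>: "0 \<le> \<theta>" and \<delta>: "\<mu> - (R - 1) + \<delta>0 - \<theta> \<le> \<delta>"
    and dI: "dI \<le> \<theta> + (R - 1 - A)"
    and cases: "dI \<le> \<theta> + (R - 2 - A) + \<delta> \<or> A = real s \<and> R - 1 = real s \<and> s + 1 \<le> t"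
    and \<Sigma>: "2 \<le> A \<and> j * (\<mu> - 2 + \<delta>0) \<le> \<Sigma> \<or> A = 1 \<and> j = T \<and> \<Sigma> = T * dI \<and> \<mu> - 2 + \<delta>0 \<le> dI"
  shows "dI \<le> (T + 2) * \<theta> + (2 - x) * (j - 1) + (1 - j) * \<mu> + (T - 1) * \<delta> + \<Sigma>"
  using \<Sigma>
proof
  assume *: "2 \<le> A \<and> j * (\<mu> - 2 + \<delta>0) \<le> \<Sigma>"
  have "j * \<epsilon> \<le> A * T * \<epsilon>" using j exponents by (intro mult_right_mono) auto
  moreover have "j * (\<mu> - 2 + \<delta>0) + (2 - x) * (j - 1) + (1 - j) * \<mu> = \<mu> - (2 - x) - j * \<epsilon>"
    using exponents(1) by (simp add: algebra_simps)
  ultimately have rhs: "(T + 2) * \<theta> + (T - 1) * \<delta> + \<mu> - (2 - x) - A * T * \<epsilon>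
      \<le> (T + 2) * \<theta> + (2 - x) * (j - 1) + (1 - j) * \<mu> + (T - 1) * \<delta> + \<Sigma>"
    using * by linarith
  have "dI \<le> (T + 2) * \<theta> + (T - 1) * \<delta> + \<mu> - (2 - x) - A * T * \<epsilon>"
    \<comment> \<open>Either the prescribed coordinates fit into an \<open>(r - 1)\<close>-set, and
      the size of the largest link bounds their codegree, or they fill the whole edge and no such
      gain is available. The latter case rests on \<open>poly_tight\<close>.\<close>
    using cases
  proof
    assume b: "A = real s \<and> R - 1 = real s \<and> s + 1 \<le> t"
    have "(T - 1) * (\<delta>0 - \<theta>) \<le> (T - 1) * \<delta>" using \<delta> \<mu> T by (intro mult_left_mono) auto
    moreover have "0 \<le> real s - 2 + x - s * T * \<epsilon> + (T - 1) * \<delta>0" using poly_tight T b by auto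
    moreover have "0 \<le> T * \<theta>" using T \<theta> by simp
    ultimately show ?thesis using b dI \<mu> \<theta> by (simp add: algebra_simps)
  next
    assume a: "dI \<le> \<theta> + (R - 2 - A) + \<delta>"
    show ?thesis
      using T(3)
    proof
      assume "T = 1"
      then show ?thesis using poly_single[of A] * dI \<mu> \<theta> by (simp add: algebra_simps)
    next
      assume T2: "2 \<le> T"
      have "(T - 2) * (\<delta>0 - \<theta>) \<le> (T - 2) * \<delta>" using \<delta> \<mu> T2 by (intro mult_left_mono) auto
      moreover have "0 \<le> A - 1 + x - A * T * \<epsilon> + (T - 2) * \<delta>0" using poly_general A T by auto
      moreover have "0 \<le> T * \<theta>" using T \<theta> by simp
      ultimately show ?thesis using a \<mu> \<theta> by (simp add: algebra_simps)
    qed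
  qed
  then show ?thesis using rhs by linarith
next
  \<comment> \<open>With one left vertex all prescribed pairs have the same codegree, whose
    logarithm is \<open>dI\<close> itself. It may lie far above the lower bound for pairs, so
    \<Sigma> has to be kept exact.\<close>
  assume *: "A = 1 \<and> j = T \<and> \<Sigma> = T * dI \<and> \<mu> - 2 + \<delta>0 \<le> dI"
  have "- \<theta> \<le> 2 - x - \<mu> + \<delta> + dI" using * \<delta> \<mu> exponents by linarith
  then have "(T - 1) * (- \<theta>) \<le> (T - 1) * (2 - x - \<mu> + \<delta> + dI)" using T by (intro mult_left_mono) auto
  moreover have "0 \<le> T * \<theta>" using T \<theta> by simp
  ultimately show ?thesis using * \<theta> by (simp add: algebra_simps)
qed

lemma star_exponent:
  fixes b dl k e \<theta> A T j \<mu> d2 :: real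
  assumes A: "1 \<le> A" "A \<le> real s" and T: "1 \<le> T" "T \<le> real t" and j: "j \<le> A * T"
    and b: "b \<le> 1" and \<theta>: "0 \<le> \<theta>" and e: "2 - \<delta>0 \<le> \<mu> - d2"
    and dl: "\<mu> - d2 - \<theta> \<le> b + dl" and k: "b + s * dl - s - \<theta> \<le> k"
  shows "(s - A) * dl + (t - T) * k
    \<le> (s + t * (s + 1)) * \<theta> + (2 - x) * (j - 1) - j * \<mu> + b + s * dl + (real t - 1) * k + j * d2"
proof -
  define e where "e = \<mu> - d2"
  \<comment> \<open>Since \<open>2 - x - e \<le> - \<epsilon>\<close>, each further edge lowers the
    right-hand side, and \<open>j = A * T\<close> is the worst case. Likewise \<open>b = 1\<close>
    and \<open>e = 2 - \<delta>0\<close> turn out to be the worst values below.\<close>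
  have "0 \<le> (A * T - j) * (e - 2 + x)"
    using j e exponents by (intro mult_nonneg_nonneg) (auto simp: e_def)
  then have 1: "A * T * (2 - x - e) \<le> j * (2 - x - e)" by (simp add: algebra_simps)
  have dl': "e - b - \<theta> \<le> dl" using dl by (simp add: e_def)
  have 2: "A * (e - b - \<theta>) \<le> A * dl" using dl' A by (intro mult_left_mono) auto
  have "s * (e - b - \<theta>) \<le> s * dl" using dl' by (intro mult_left_mono) auto
  then have "b + s * (e - b) - s - (s + 1) * \<theta> \<le> k" using k by (simp add: algebra_simps)
  then have 3: "(T - 1) * (b + s * (e - b) - s - (s + 1) * \<theta>) \<le> (T - 1) * k"
    using T by (intro mult_left_mono) auto
  have "0 \<le> (1 - b) * (A - 1 + (T - 1) * (real s - 1))"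
    using A T b reals by (intro mult_nonneg_nonneg add_nonneg_nonneg) auto
  then have 4: "1 + A * (e - 1) + (T - 1) * (1 + s * (e - 1) - s) \<le> b + A * (e - b) + (T - 1) * (b + s * (e - b) - s)"
    by (simp add: algebra_simps)
  have "0 \<le> (e - (2 - \<delta>0)) * ((T - 1) * (s - A))"
    using A T e by (intro mult_nonneg_nonneg) (auto simp: e_def)
  then have 5: "A * T * (- \<epsilon>) + 1 + A * (1 - \<delta>0) + (T - 1) * (1 - s * \<delta>0)
      \<le> A * T * (2 - x - e) + 1 + A * (e - 1) + (T - 1) * (1 + s * (e - 1) - s)"
    using exponents(1) by (simp add: algebra_simps)
  have 6: "0 \<le> - (2 - x) - A * T * \<epsilon> + 1 + A * (1 - \<delta>0) + (T - 1) * (1 - s * \<delta>0)"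
    using poly_star[OF A T] exponents(4) by simp
  have 7: "(A + (T - 1) * (s + 1)) * \<theta> \<le> (s + t * (s + 1)) * \<theta>"
  proof (rule mult_right_mono[OF _ \<theta>])
    have "(T - 1) * (real s + 1) \<le> real t * (real s + 1)" using T by (intro mult_right_mono) auto
    then show "A + (T - 1) * (s + 1) \<le> real (s + t * (s + 1))"
      using A unfolding of_nat_add of_nat_mult of_nat_1 by linarith
  qed
  have "0 \<le> (s + t * (s + 1)) * \<theta> - (2 - x) + j * (2 - x - e) + b + A * dl + (T - 1) * k"
    using 1 2 3 4 5 6 7 by (simp add: algebra_simps)
  then show ?thesis by (simp add: algebra_simps e_def)
qed

end

section \<open>Balanced supersaturation\<close>

lemma complete_bipartite_simps:
  "verts (complete_bipartite s t) = Inl ` {..<s} \<union> Inr ` {..<t}"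
  "edges (complete_bipartite s t) = (\<lambda>(i, j). {Inl i, Inr j}) ` ({..<s} \<times> {..<t})"
  by (auto simp: complete_bipartite_def)

lemma card_complete_bipartite:
  "card (verts (complete_bipartite s t)) = s + t" "card (edges (complete_bipartite s t)) = s * t"
proof -
  show "card (verts (complete_bipartite s t)) = s + t"
    unfolding complete_bipartite_simps by (subst card_Un_disjoint) (auto simp: card_image)
  have "inj_on (\<lambda>(i, j). {Inl i, Inr j} :: (nat + nat) set) ({..<s} \<times> {..<t})"
    by (auto simp: inj_on_def doubleton_eq_iff)
  then show "card (edges (complete_bipartite s t)) = s * t"
    unfolding complete_bipartite_simps by (simp add: card_image card_cartesian_product)
qed

lemma Union_complete_bipartite:
  assumes "1 \<le> s" "1 \<le> t"
  shows "\<Union>(edges (complete_bipartite s t)) = verts (complete_bipartite s t)"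
proof
  show "\<Union>(edges (complete_bipartite s t)) \<subseteq> verts (complete_bipartite s t)"
    by (auto simp: complete_bipartite_def)
  have "x \<in> \<Union>(edges (complete_bipartite s t))" if "x \<in> verts (complete_bipartite s t)" for x
  proof (cases x)
    case (Inl i)
    then have "{Inl i, Inr 0} \<in> edges (complete_bipartite s t)"
      using that assms unfolding complete_bipartite_simps by (intro image_eqI[of _ _ "(i, 0)"]) auto
    then show ?thesis using Inl by blast
  next
    case (Inr j)
    then have "{Inl 0, Inr j} \<in> edges (complete_bipartite s t)"
      using that assms unfolding complete_bipartite_simps by (intro image_eqI[of _ _ "(0, j)"]) auto
    then show ?thesis using Inr by blast
  qed
  then show "verts (complete_bipartite s t) \<subseteq> \<Union>(edges (complete_bipartite s t))" by blast
qed

definition left_end :: "('a + 'b) set \<Rightarrow> 'a" where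
  "left_end f = (THE i. Inl i \<in> f)"

lemma left_end_simp [simp]: "left_end {Inl i, Inr j} = i"
  by (simp add: left_end_def)

text \<open>Marginals see a set of edges only through the left vertices \<open>I\<close> and the
  right vertices \<open>T\<close> that it touches. The case of a single left vertex is kept exact,
  because \<open>J\<close> is then a star with one edge for each element of
  \<open>T\<close>.\<close>

lemma touched_vertices:
  assumes J: "J \<subseteq> edges (complete_bipartite s t)" "J \<noteq> {}"
  obtains I T where "I \<subseteq> {..<s}" "T \<subseteq> {..<t}" "I \<noteq> {}" "T \<noteq> {}" "\<Union>J = Inl ` I \<union> Inr ` T"
    "card J \<le> card I * card T" "card I = 1 \<longrightarrow> card J = card T" "\<forall>f\<in>J. left_end f \<in> I"
proof -
  define I where "I = {i. Inl i \<in> \<Union>J}"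
  define T where "T = {j. Inr j \<in> \<Union>J}"
  have J': "\<exists>i j. f = {Inl i, Inr j} \<and> i < s \<and> j < t \<and> i \<in> I \<and> j \<in> T" if fJ: "f \<in> J" for f
  proof -
    have "f \<in> edges (complete_bipartite s t)" using fJ J(1) by auto
    then obtain i j where f: "f = {Inl i, Inr j}" "i < s" "j < t" by (auto simp: complete_bipartite_def)
    then have "i \<in> I" "j \<in> T" using fJ by (auto simp: I_def T_def)
    then show ?thesis using f by auto
  qed
  have I: "I \<subseteq> {..<s}"
  proof
    fix i assume "i \<in> I"
    then obtain f where "f \<in> J" "Inl i \<in> f" by (auto simp: I_def)
    then show "i \<in> {..<s}" using J'[of f] by auto
  qed
  have T: "T \<subseteq> {..<t}"
  proof
    fix j assume "j \<in> T"
    then obtain f where "f \<in> J" "Inr j \<in> f" by (auto simp: T_def)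
    then show "j \<in> {..<t}" using J'[of f] by auto
  qed
  obtain f0 where f0: "f0 \<in> J" using J by auto
  have ne: "I \<noteq> {}" "T \<noteq> {}" using J'[OF f0] by auto
  have U: "\<Union>J = Inl ` I \<union> Inr ` T"
  proof
    show "\<Union>J \<subseteq> Inl ` I \<union> Inr ` T" using J' by blast
    show "Inl ` I \<union> Inr ` T \<subseteq> \<Union>J" by (auto simp: I_def T_def)
  qed
  have fin: "finite I" "finite T" using I T finite_subset by auto
  have sub: "J \<subseteq> (\<lambda>(i, j). {Inl i, Inr j}) ` (I \<times> T)" using J' by force
  have "card J \<le> card ((\<lambda>(i, j). {Inl i, Inr j}) ` (I \<times> T))" using sub fin by (intro card_mono) auto
  also have "\<dots> \<le> card I * card T"
    using card_image_le[of "I \<times> T"] fin by (metis card_cartesian_product finite_cartesian_product)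
  finally have le: "card J \<le> card I * card T" .
  have one: "card J = card T" if c1: "card I = 1"
  proof -
    obtain i where i: "I = {i}" using c1 by (auto simp: card_1_singleton_iff)
    have "J = (\<lambda>j. {Inl i, Inr j}) ` T"
    proof
      show "J \<subseteq> (\<lambda>j. {Inl i, Inr j}) ` T" using J' i by blast
      show "(\<lambda>j. {Inl i, Inr j}) ` T \<subseteq> J"
      proof
        fix f assume "f \<in> (\<lambda>j. {Inl i, Inr j}) ` T"
        then obtain j where j: "j \<in> T" "f = {Inl i, Inr j}" by auto
        then obtain g where g: "g \<in> J" "Inr j \<in> g" by (auto simp: T_def)
        then obtain i' j' where "g = {Inl i', Inr j'}" "i' \<in> I" using J' by blast
        then show "f \<in> J" using g j i by auto
      qed
    qed
    moreover have "inj_on (\<lambda>j. {Inl i, Inr j} :: (nat + nat) set) T" by (auto simp: inj_on_def doubleton_eq_iff)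
    ultimately show ?thesis by (simp add: card_image)
  qed
  have "left_end f \<in> I" if "f \<in> J" for f
  proof -
    obtain i j where "f = {Inl i, Inr j}" "i \<in> I" using J'[OF \<open>f \<in> J\<close>] by blast
    then show ?thesis by simp
  qed
  then show thesis using that[OF I T ne U le] one by simp
qed

section \<open>Supersaturation in a clean regular class\<close>

text \<open>\<open>clean\<close> asks for twice the bound \<open>d_large\<close>, because
  \<open>D\<close> may be smaller than the codegree by a factor of almost two. \<open>small\<close>
  keeps a power of the polylogarithmic losses below \<open>n powr \<epsilon>\<close>, the typical
  number of common neighbours.\<close>

locale kst_class = regular_class + kst_exponents +
  fixes \<Lambda> :: nat
  assumes rst: "s + 1 \<le> t \<and> s + 1 \<le> r \<or> s + 2 \<le> r"
    and \<Lambda>: "n < 2 ^ \<Lambda>" and n2: "2 \<le> n" and dense: "n ^ (r - 1) \<le> card H"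
    and clean: "\<And>e f. e \<in> H \<Longrightarrow> f \<subseteq> e \<Longrightarrow> card f = 2 \<Longrightarrow>
      2 * (2 * (s + t) + 4 * (s * t) * r) * n ^ (r - 3) \<le> codeg H f"
    and small: "(2 ^ (s + t + 3) * s * t * Q * \<Lambda>) ^ (s + 1) \<le> n powr \<epsilon>"
begin

abbreviation "K \<equiv> complete_bipartite s t"

definition P :: real where "P = 2 ^ (s + t + 3) * s * t * Q * \<Lambda>"

abbreviation "\<l> \<equiv> log (real n)"

text \<open>Large enough for the powers of \<open>P\<close> lost in either sampler:
  \<open>s + t * (s + 1) + 2\<close> for stars and at most \<open>2 * t + 3\<close> for
  links.\<close>

definition b_exp :: nat where "b_exp = 4 * s * t + 10"

definition \<beta> :: "nat \<Rightarrow> real" where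
  "\<beta> j = P ^ b_exp * n powr ((2 - x) * (real j - 1)) / card H ^ j"

definition balanced_weight :: "(nat set set \<Rightarrow> real) \<Rightarrow> bool" where
  "balanced_weight w \<longleftrightarrow> (\<forall>A. 0 \<le> w A) \<and>
    (\<forall>A. w A \<noteq> 0 \<longrightarrow> A \<subseteq> H \<and> card A = s * t \<and> A \<in> copies n (expansion r K)) \<and>
    wdeg H w {} > 0 \<and>
    (\<forall>S. S \<subseteq> H \<longrightarrow> S \<noteq> {} \<longrightarrow>
      wdeg H w S \<le> 8 ^ (s * t) * (s * t) ^ (s * t) * r ^ (s + t) * \<beta> (card S) * wdeg H w {})"

lemma \<Lambda>1: "\<Lambda> \<ge> 1" using \<Lambda> n2 by (cases \<Lambda>) auto

text \<open>\<open>P\<close> is the product of all factors that the later estimates lose, so each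
  bound follows by replacing some factors by smaller ones.\<close>

lemma P_ge: "2 ^ (s + t + 2) * Q \<le> P" "2 ^ (s + t + 2) * real \<Lambda> \<le> P" "2 * t * Q \<le> P"
  "2 * s * (4 * \<Lambda> * L) \<le> P" "2 * t * (2 ^ (s + 1) * \<Lambda>) \<le> P" "4 * \<Lambda> * L \<le> P" "1 \<le> P"
proof -
  have s1: "1 \<le> real s" "1 \<le> real t" "1 \<le> real \<Lambda>" "8 \<le> Q" "L \<le> Q" "1 \<le> Q" "1 \<le> L" "0 < Q"
    using reals \<Lambda>1 Q_ge L by auto
  have st1: "1 \<le> real s * real t" "real s \<le> real s * real t" "real t \<le> real s * real t"
    using mult_mono[of 1 "real s" 1 "real t"] mult_left_mono[of 1 "real t" "real s"]
      mult_right_mono[of 1 "real s" "real t"] s1 by auto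
  have P': "P = 2 ^ (s + t + 3) * (real s * real t) * (Q * real \<Lambda>)" by (simp add: P_def)
  have Q\<Lambda>: "Q \<le> Q * real \<Lambda>" "real \<Lambda> \<le> Q * real \<Lambda>" "L * real \<Lambda> \<le> Q * real \<Lambda>" "1 \<le> Q * real \<Lambda>"
    using mult_left_mono[of 1 "real \<Lambda>" Q] mult_right_mono[of 1 Q "real \<Lambda>"] mult_right_mono[of L Q "real \<Lambda>"]
      mult_mono[of 1 Q 1 "real \<Lambda>"] s1
    by auto
  have gen: "a * b * c \<le> P" if "a \<le> 2 ^ (s + t + 3)" "b \<le> real s * real t" "c \<le> Q * real \<Lambda>" "0 \<le> a" "0 \<le> b" "0 \<le> c" for a b c
    unfolding P' using that s1 by (intro mult_mono) auto
  have two: "(2::real) ^ (s + t + 2) \<le> 2 ^ (s + t + 3)" "(8::real) \<le> 2 ^ (s + t + 3)" "(2::real) * 2 ^ (s + 1) \<le> 2 ^ (s + t + 3)"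
  proof -
    have "(2::real) ^ 3 \<le> 2 ^ (s + t + 3)" by (intro power_increasing) auto
    then show "(8::real) \<le> 2 ^ (s + t + 3)" by simp
    have "(2::real) ^ (s + 2) \<le> 2 ^ (s + t + 3)" by (intro power_increasing) auto
    then show "(2::real) * 2 ^ (s + 1) \<le> 2 ^ (s + t + 3)" by simp
    show "(2::real) ^ (s + t + 2) \<le> 2 ^ (s + t + 3)" by (intro power_increasing) auto
  qed
  show "2 ^ (s + t + 2) * Q \<le> P" using gen[of "2 ^ (s + t + 2)" 1 Q] two st1 Q\<Lambda> s1 by simp
  show "2 ^ (s + t + 2) * real \<Lambda> \<le> P" using gen[of "2 ^ (s + t + 2)" 1 "real \<Lambda>"] two st1 Q\<Lambda> s1 by simp
  show "2 * t * Q \<le> P" using gen[of 2 "real t" Q] two st1 Q\<Lambda> s1 by simp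
  show "2 * s * (4 * \<Lambda> * L) \<le> P" using gen[of 8 "real s" "L * real \<Lambda>"] two st1 Q\<Lambda> s1 by (simp add: mult_ac)
  show "2 * t * (2 ^ (s + 1) * \<Lambda>) \<le> P"
    using gen[of "2 * 2 ^ (s + 1)" "real t" "real \<Lambda>"] two st1 Q\<Lambda> s1 by (simp add: mult_ac)
  show "4 * \<Lambda> * L \<le> P" using gen[of 4 1 "L * real \<Lambda>"] two st1 Q\<Lambda> s1 by (simp add: mult_ac)
  show "1 \<le> P" using gen[of 1 1 1] two st1 Q\<Lambda> s1 by simp
qed

definition \<theta> :: real where "\<theta> = \<l> P"
definition \<mu> :: real where "\<mu> = \<l> (card H)"

lemma n1: "1 < real n" using n2 by simp

lemma log_le_iff: "0 < a \<Longrightarrow> 0 < b \<Longrightarrow> \<l> a \<le> \<l> b \<longleftrightarrow> a \<le> b"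
  using n1 by simp

lemma \<theta>: "0 \<le> \<theta>" "(real s + 1) * \<theta> \<le> \<epsilon>"
proof -
  show "0 \<le> \<theta>" using P_ge n1 by (simp add: \<theta>_def zero_le_log_cancel_iff)
  have "\<l> (P ^ (s + 1)) \<le> \<l> (n powr \<epsilon>)"
    using small P_ge n1 by (subst log_le_iff) (auto simp: P_def)
  then show "(real s + 1) * \<theta> \<le> \<epsilon>"
    using P_ge n1 log_nat_power[of P "real n" "s + 1"] by (simp add: \<theta>_def del: power_Suc power_add_numeral) (simp add: add.commute)
qed

lemma \<mu>_ge: "real r - 1 \<le> \<mu>"
proof -
  have "\<l> (real n ^ (r - 1)) \<le> \<l> (card H)"
  proof (subst log_le_iff)
    show "real n ^ (r - 1) \<le> real (card H)" using dense by (metis of_nat_le_iff of_nat_power)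
  qed (use n1 cardH_pos in auto)
  then show ?thesis using n1 r by (simp add: log_nat_power \<mu>_def of_nat_diff)
qed

lemma D_pos: "U \<subseteq> {..<r} \<Longrightarrow> 0 < real (D U)" using D1[of U] by simp

lemma log_D_mono:
  assumes "U \<subseteq> U'" "U' \<subseteq> {..<r}"
  shows "\<l> (D U) \<le> \<theta> + card (U' - U) + \<l> (D U')"
proof -
  have "real (D U) \<le> Q * n ^ card (U' - U) * D U'" by (rule D_mono[OF assms])
  also have "\<dots> \<le> P * real n ^ card (U' - U) * D U'"
  proof -
    have "1 * Q \<le> 2 ^ (s + t + 2) * Q" using Q_ge by (intro mult_right_mono one_le_power) auto
    then have "Q \<le> P" using P_ge by linarith
    then show ?thesis unfolding of_nat_power by (intro mult_right_mono) auto
  qed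
  finally have "\<l> (D U) \<le> \<l> (P * real n ^ card (U' - U) * D U')"
    using D_pos[of U] D_pos[of U'] P_ge n1 assms by (subst log_le_iff) auto
  also have "\<dots> = \<theta> + card (U' - U) + \<l> (D U')"
    using D_pos[OF assms(2)] P_ge n1 by (simp add: log_mult log_nat_power \<theta>_def)
  finally show ?thesis .
qed

lemma log_D_le:
  assumes "U \<subseteq> {..<r}"
  shows "\<l> (D U) \<le> \<theta> + (real r - card U)"
proof -
  have "card ({..<r} - U) = r - card U" "card U \<le> r"
    using assms card_mono[OF _ assms] by (simp_all add: card_Diff_subset finite_subset[OF assms])
  then show ?thesis using log_D_mono[OF assms] D_full by (simp add: of_nat_diff)
qed

text \<open>Feeds a sampler into \<open>expansion_setup\<close>. Left vertex \<open>i\<close> sits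
  at coordinate \<open>\<iota> i\<close> and all right vertices sit at \<open>c\<close>, so the
  codegree attached to an edge of \<open>K\<close> depends only on its left end.\<close>

lemma sampler_weight:
  fixes \<Psi> :: "'i set" and u :: "'i \<Rightarrow> nat + nat \<Rightarrow> nat" and \<iota> :: "nat \<Rightarrow> nat" and c :: nat
  assumes fin: "finite \<Psi>" "\<Psi> \<noteq> {}"
    and inj: "\<forall>\<psi>\<in>\<Psi>. inj_on (u \<psi>) (verts K)"
    and edge: "\<forall>\<psi>\<in>\<Psi>. \<forall>i<s. \<forall>j<t. \<exists>e\<in>C. u \<psi> (Inl i) = lab e (\<iota> i) \<and> u \<psi> (Inr j) = lab e c"
    and coord: "\<And>i. i < s \<Longrightarrow> \<iota> i < r \<and> \<iota> i \<noteq> c" "c < r"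
    and marg: "\<And>I T (J :: (nat + nat) set set) a. I \<subseteq> {..<s} \<Longrightarrow> T \<subseteq> {..<t} \<Longrightarrow> I \<noteq> {} \<Longrightarrow> T \<noteq> {} \<Longrightarrow> J \<noteq> {} \<Longrightarrow> finite J \<Longrightarrow>
      card J \<le> card I * card T \<Longrightarrow> (card I = 1 \<longrightarrow> card J = card T) \<Longrightarrow> (\<forall>f\<in>J. left_end f \<in> I) \<Longrightarrow>
      real (card {\<psi> \<in> \<Psi>. (\<forall>i\<in>I. u \<psi> (Inl i) = a (Inl i)) \<and> (\<forall>j\<in>T. u \<psi> (Inr j) = a (Inr j))})
        \<le> \<beta> (card J) * card \<Psi> * (\<Prod>f\<in>J. real (D {\<iota> (left_end f), c}))"
  shows "\<exists>w. balanced_weight w"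
proof -
  define d where "d f = real (D {\<iota> (left_end f), c})" for f :: "(nat + nat) set"
  have pair: "{\<iota> i, c} \<subseteq> {..<r}" if "i < s" for i using coord that by auto
  \<comment> \<open>Two adjacent core vertices lie in a common edge of the class at known
    coordinates, so regularity and cleanness both apply to them.\<close>
  have cod: "D {\<iota> i, c} \<le> codeg H (u \<psi> ` {Inl i, Inr j}) \<and> codeg H (u \<psi> ` {Inl i, Inr j}) < 2 * D {\<iota> i, c} \<and>
      2 * (2 * (s + t) + 4 * (s * t) * r) * n ^ (r - 3) \<le> codeg H (u \<psi> ` {Inl i, Inr j})"
    if \<psi>: "\<psi> \<in> \<Psi>" and ij: "i < s" "j < t" for \<psi> i j
  proof -
    obtain e where e: "e \<in> C" "u \<psi> (Inl i) = lab e (\<iota> i)" "u \<psi> (Inr j) = lab e c" using edge \<psi> ij by blast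
    have eH: "e \<in> H" using e C by auto
    have im: "u \<psi> ` {Inl i, Inr j} = lab e ` {\<iota> i, c}" using e by simp
    have sub: "lab e ` {\<iota> i, c} \<subseteq> e" using lab_mem[OF eH] coord ij by auto
    have "lab e (\<iota> i) \<noteq> lab e c" using lab_inj[OF eH, of "\<iota> i" c] coord ij by auto
    then have "card (lab e ` {\<iota> i, c}) = 2" by simp
    then show ?thesis unfolding im using D[OF e(1) pair[OF ij(1)]] clean[OF eH sub] by simp
  qed
  obtain \<psi>0 where \<psi>0: "\<psi>0 \<in> \<Psi>" using fin by auto
  have "expansion_setup K n r H \<Psi> u d \<beta>"
  proof
    show "is_rgraph 2 K" by (rule is_rgraph_complete_bipartite)
    show "\<Union>(edges K) = verts K" using s2 st by (intro Union_complete_bipartite) auto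
    show "3 \<le> r" "1 \<le> n" "H \<subseteq> {e. e \<subseteq> {..<n} \<and> card e = r}" by (rule r n H)+
    show "finite \<Psi>" "\<Psi> \<noteq> {}" by (rule fin)+
    show "inj_on (u \<psi>) (verts K)" if "\<psi> \<in> \<Psi>" for \<psi> using inj that by auto
    show "0 \<le> \<beta> j" for j using P_ge by (simp add: \<beta>_def)
    show "d f \<le> real (codeg H (u \<psi> ` f)) \<and> real (codeg H (u \<psi> ` f)) \<le> 2 * d f" if \<psi>f: "\<psi> \<in> \<Psi>" "f \<in> edges K" for \<psi> f
    proof -
      obtain i j where f: "f = {Inl i, Inr j}" "i < s" "j < t" using \<psi>f(2) by (auto simp: complete_bipartite_def)
      show ?thesis using cod[OF \<psi>f(1) f(2,3)] by (simp add: f(1) d_def)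
    qed
    show "real ((2 * card (verts K) + 4 * card (edges K) * r) * n ^ (r - 3)) \<le> d f" if fE: "f \<in> edges K" for f
    proof -
      obtain i j where f: "f = {Inl i, Inr j}" "i < s" "j < t" using fE by (auto simp: complete_bipartite_def)
      have "2 * (2 * (s + t) + 4 * (s * t) * r) * n ^ (r - 3) < 2 * D {\<iota> i, c}"
        using cod[OF \<psi>0 f(2,3)] by linarith
      then have "2 * ((2 * (s + t) + 4 * (s * t) * r) * n ^ (r - 3)) < 2 * D {\<iota> i, c}"
        by (simp only: mult.assoc)
      then have "(2 * (s + t) + 4 * (s * t) * r) * n ^ (r - 3) \<le> D {\<iota> i, c}" by linarith
      then have "real ((2 * (s + t) + 4 * (s * t) * r) * n ^ (r - 3)) \<le> real (D {\<iota> i, c})" by (simp only: of_nat_le_iff)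
      then show ?thesis by (simp only: card_complete_bipartite f(1) d_def left_end_simp)
    qed
    show "real (card {\<psi> \<in> \<Psi>. \<forall>x\<in>\<Union>J. u \<psi> x = a x}) \<le> \<beta> (card J) * card \<Psi> * (\<Prod>f\<in>J. d f)"
      if J: "J \<subseteq> edges K" "J \<noteq> {}" for J a
    proof -
      obtain I T where IT: "I \<subseteq> {..<s}" "T \<subseteq> {..<t}" "I \<noteq> {}" "T \<noteq> {}" "\<Union>J = Inl ` I \<union> Inr ` T"
        "card J \<le> card I * card T" "card I = 1 \<longrightarrow> card J = card T" "\<forall>f\<in>J. left_end f \<in> I"
        using touched_vertices[OF J] by metis
      have "finite (edges K)" by (simp add: complete_bipartite_simps)
      then have "finite J" using J finite_subset by auto
      have "{\<psi> \<in> \<Psi>. \<forall>x\<in>\<Union>J. u \<psi> x = a x} =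
          {\<psi> \<in> \<Psi>. (\<forall>i\<in>I. u \<psi> (Inl i) = a (Inl i)) \<and> (\<forall>j\<in>T. u \<psi> (Inr j) = a (Inr j))}"
        unfolding IT(5) by auto
      then show ?thesis
        using marg[OF IT(1-4) J(2) \<open>finite J\<close> IT(6) IT(7) IT(8), of a] by (simp add: d_def)
    qed
  qed
  from expansion_setup.expansion_weight[OF this] show ?thesis
    unfolding card_complete_bipartite balanced_weight_def by (simp only: of_nat_mult of_nat_power)
qed


lemma sum_log_prod:
  assumes "finite J" "\<And>f. f \<in> J \<Longrightarrow> 0 < g f"
  shows "\<l> (\<Prod>f\<in>J. g f) = (\<Sum>f\<in>J. \<l> (g f))"
  using assms by (simp add: log_def ln_prod sum_divide_distrib less_imp_neq[symmetric])

lemma log_\<beta>: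
  "\<l> (\<beta> j * y) = b_exp * \<theta> + (2 - x) * (real j - 1) - j * \<mu> + \<l> y" if "0 < y" for j y
  unfolding \<beta>_def \<mu>_def \<theta>_def using that P_ge n1 cardH_pos
  by (simp add: log_mult log_divide log_nat_power)

lemma b_exp_ge: "real (s + t * (s + 1)) + 2 \<le> b_exp" "real (2 * t + 3) \<le> b_exp"
proof -
  have st1: "real s \<le> real s * real t" "real t \<le> real s * real t"
    using mult_left_mono[of 1 "real t" "real s"] mult_right_mono[of 1 "real s" "real t"] reals by auto
  show "real (s + t * (s + 1)) + 2 \<le> b_exp" "real (2 * t + 3) \<le> b_exp"
    using st1 by (simp_all add: b_exp_def algebra_simps)
qed

text \<open>A small codegree at the two coordinates means many pairs, about
  \<open>card H / D {i0, j0} \<ge> n powr (2 - \<delta>0)\<close> of them; this is the density at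
  which stars have about \<open>n powr \<epsilon>\<close> common neighbours per leaf tuple.\<close>

lemma star_weight:
  assumes ij: "i0 < r" "j0 < r" "i0 \<noteq> j0" and D2: "D {i0, j0} \<le> card H * n powr (\<delta>0 - 2)"
  shows "\<exists>w. balanced_weight w"
proof -
  define X where "X = card H / (4 * \<Lambda> * L * D {i0, j0})"
  have ijr: "{i0, j0} \<subseteq> {..<r}" using ij by auto
  have Dp: "0 < real (D {i0, j0})" by (rule D_pos[OF ijr])
  have c4: "0 < 4 * real \<Lambda> * L" using \<Lambda>1 L by simp
  have Xge: "n powr (2 - \<delta>0) \<le> 4 * \<Lambda> * L * X"
  proof -
    have "n powr (2 - \<delta>0) * D {i0, j0} \<le> n powr (2 - \<delta>0) * (card H * n powr (\<delta>0 - 2))"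
      by (intro mult_left_mono D2) auto
    also have "\<dots> = card H" using n1 by (simp add: powr_add[symmetric] mult.left_commute)
    finally have "n powr (2 - \<delta>0) \<le> card H / D {i0, j0}" using Dp by (simp add: pos_le_divide_eq)
    also have "\<dots> = 4 * \<Lambda> * L * X" using \<Lambda>1 L by (simp add: X_def)
    finally show ?thesis .
  qed
  have Xpos: "0 < X" unfolding X_def using cardH_pos c4 Dp by simp
  have P\<epsilon>: "P ^ (s + 1) \<le> n powr \<epsilon>" using small by (simp add: P_def)
  have P1: "P \<le> n powr \<epsilon>"
  proof -
    have "P ^ 1 \<le> P ^ (s + 1)" using P_ge by (intro power_increasing) auto
    then show ?thesis using P\<epsilon> by simp
  qed
  have large1: "2 * s * n \<le> X"
  proof -
    have "n powr \<epsilon> \<le> n powr (1 - \<delta>0)"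
    proof (rule powr_mono)
      have "1 * \<epsilon> \<le> t * \<epsilon>" using exponents reals by (intro mult_right_mono) auto
      then show "\<epsilon> \<le> 1 - \<delta>0" using exponents(5) by simp
    qed (use n1 in auto)
    then have "2 * s * (4 * \<Lambda> * L) \<le> n powr (1 - \<delta>0)" using P1 P_ge by linarith
    then have "n * (2 * s * (4 * \<Lambda> * L)) \<le> n * n powr (1 - \<delta>0)" by (intro mult_left_mono) auto
    also have "\<dots> = n powr (2 - \<delta>0)" using n1 powr_mult_base[of "real n" "1 - \<delta>0"] by simp
    also have "\<dots> \<le> 4 * \<Lambda> * L * X" by (rule Xge)
    finally have "(4 * real \<Lambda> * L) * (2 * s * n) \<le> (4 * real \<Lambda> * L) * X" by (simp add: mult_ac)
    then show ?thesis using c4 by (rule mult_left_le_imp_le)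
  qed
  have large2: "2 * t * (2 ^ (s + 1) * real \<Lambda> * real n ^ (2 * s - 1)) \<le> X ^ s"
  proof -
    \<comment> \<open>By \<open>s * \<delta>0 = 1 - \<epsilon>\<close> there is a surplus of
      \<open>n powr \<epsilon>\<close> over \<open>n ^ (2 * s - 1)\<close>, and it pays for the
      losses \<open>P ^ (s + 1)\<close>.\<close>
    have np: "n powr (s * (2 - \<delta>0)) = real n ^ (2 * s - 1) * n powr \<epsilon>"
    proof -
      have "s * (2 - \<delta>0) = real (2 * s - 1) + \<epsilon>"
        using exponents(4) s2 by (simp add: of_nat_diff algebra_simps)
      then show ?thesis using n1 by (simp add: powr_add powr_realpow)
    qed
    have "(4 * \<Lambda> * L) ^ s * (2 * t * (2 ^ (s + 1) * \<Lambda>)) \<le> P ^ s * P"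
      using P_ge c4 by (intro mult_mono power_mono) auto
    also have "\<dots> \<le> n powr \<epsilon>" using P\<epsilon> by (simp add: mult.commute)
    finally have "real n ^ (2 * s - 1) * ((4 * \<Lambda> * L) ^ s * (2 * t * (2 ^ (s + 1) * \<Lambda>))) \<le> real n ^ (2 * s - 1) * n powr \<epsilon>"
      by (intro mult_left_mono) auto
    also have "\<dots> = (n powr (2 - \<delta>0)) ^ s"
      using np n1 by (simp add: powr_powr powr_realpow[symmetric] mult.commute)
    also have "\<dots> \<le> (4 * \<Lambda> * L * X) ^ s" using Xge by (intro power_mono) auto
    also have "\<dots> = (4 * \<Lambda> * L) ^ s * X ^ s" by (rule power_mult_distrib)
    finally have "(4 * real \<Lambda> * L) ^ s * (2 * t * (2 ^ (s + 1) * real \<Lambda> * real n ^ (2 * s - 1))) \<le> (4 * real \<Lambda> * L) ^ s * X ^ s"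
      by (simp add: mult_ac)
    then show ?thesis by (rule mult_left_le_imp_le) (use c4 in simp)
  qed
  have s1: "s \<ge> 1" "t \<ge> 1" using s2 st by auto
  obtain \<Psi> :: "((nat \<Rightarrow> nat) \<times> (nat \<Rightarrow> nat)) set" and u b \<Delta> \<kappa> where
    \<Psi>: "finite \<Psi>" "\<forall>\<psi>\<in>\<Psi>. inj_on (u \<psi>) (verts K)"
      "\<forall>\<psi>\<in>\<Psi>. \<forall>i<s. \<forall>j<t. \<exists>e\<in>C. u \<psi> (Inl i) = lab e i0 \<and> u \<psi> (Inr j) = lab e j0"
    and num: "1 \<le> b" "b \<le> n" "1 \<le> \<Delta>" "1 \<le> \<kappa>" "X \<le> b * \<Delta>"
      "real b * real \<Delta> ^ s \<le> 2 ^ (s + 1) * real \<Lambda> * real n ^ s * \<kappa>"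
      "real b * real \<Delta> ^ s * real \<kappa> ^ (t - 1) \<le> 2 ^ (s + t + 1) * real \<Lambda> * card \<Psi>"
    and marg: "\<forall>I T a. I \<subseteq> {..<s} \<longrightarrow> T \<subseteq> {..<t} \<longrightarrow> T \<noteq> {} \<longrightarrow>
      card {\<psi> \<in> \<Psi>. (\<forall>i\<in>I. u \<psi> (Inl i) = a (Inl i)) \<and> (\<forall>j\<in>T. u \<psi> (Inr j) = a (Inr j))}
        \<le> (2 * \<Delta>) ^ (s - card I) * (2 * \<kappa>) ^ (t - card T)"
    using star_sampler[OF ij \<Lambda> s1, folded X_def, OF large1 large2]
    by (elim exE conjE) (rule that; assumption)
  have pos: "0 < real b" "0 < real \<Delta>" "0 < real \<kappa>" using num by auto
  have \<Psi>pos: "0 < real (card \<Psi>)"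
  proof -
    have "0 < real b * real \<Delta> ^ s * real \<kappa> ^ (t - 1)" using pos by simp
    also note num(7)
    finally show ?thesis using \<Lambda>1 by (simp add: zero_less_mult_iff)
  qed
  define d2 where "d2 = \<l> (D {i0, j0})"
  have e: "2 - \<delta>0 \<le> \<mu> - d2"
  proof -
    have "\<l> (D {i0, j0}) \<le> \<l> (card H * n powr (\<delta>0 - 2))"
      using D2 Dp cardH_pos n1 by (subst log_le_iff) auto
    then show ?thesis using cardH_pos n1 by (simp add: log_mult d2_def \<mu>_def)
  qed
  have dl: "\<mu> - d2 - \<theta> \<le> \<l> b + \<l> \<Delta>"
  proof -
    have "card H / (P * D {i0, j0}) \<le> X"
      unfolding X_def using P_ge Dp c4 cardH_pos by (intro divide_left_mono mult_right_mono) auto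
    also have "\<dots> \<le> real b * real \<Delta>" using num(5) by simp
    finally have "\<l> (card H / (P * D {i0, j0})) \<le> \<l> (real b * real \<Delta>)"
      using cardH_pos Dp P_ge pos by (subst log_le_iff) auto
    then show ?thesis using cardH_pos Dp P_ge pos n1 by (simp add: log_mult log_divide \<mu>_def d2_def \<theta>_def)
  qed
  have k: "\<l> b + s * \<l> \<Delta> - s - \<theta> \<le> \<l> \<kappa>"
  proof -
    have "(2::real) ^ (s + 1) * real \<Lambda> \<le> 2 ^ (s + t + 2) * real \<Lambda>" by (intro mult_right_mono power_increasing) auto
    then have "2 ^ (s + 1) * real \<Lambda> \<le> P" using P_ge by linarith
    then have "2 ^ (s + 1) * real \<Lambda> * real n ^ s * \<kappa> \<le> P * real n ^ s * \<kappa>" by (intro mult_right_mono) auto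
    then have "real b * real \<Delta> ^ s \<le> P * real n ^ s * \<kappa>" using num(6) by linarith
    then have "\<l> (real b * real \<Delta> ^ s) \<le> \<l> (P * real n ^ s * \<kappa>)"
      using pos P_ge n1 by (subst log_le_iff) auto
    then show ?thesis using pos P_ge n1 by (simp add: log_mult log_nat_power \<theta>_def)
  qed
  have b1: "\<l> b \<le> 1"
  proof -
    have "\<l> b \<le> \<l> n" using num pos n1 by (subst log_le_iff) auto
    then show ?thesis using n1 by simp
  qed
  show ?thesis
  proof (rule sampler_weight[where u=u and \<iota>="\<lambda>_. i0" and c=j0 and \<Psi>=\<Psi>])
    show "finite \<Psi>" "\<Psi> \<noteq> {}" "\<forall>\<psi>\<in>\<Psi>. inj_on (u \<psi>) (verts K)"
      "\<forall>\<psi>\<in>\<Psi>. \<forall>i<s. \<forall>j<t. \<exists>e\<in>C. u \<psi> (Inl i) = lab e i0 \<and> u \<psi> (Inr j) = lab e j0"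
      using \<Psi> \<Psi>pos by (auto simp: card_gt_0_iff)
    show "i0 < r \<and> i0 \<noteq> j0" "j0 < r" using ij by auto
    fix I T :: "nat set" and J :: "(nat + nat) set set" and a :: "nat + nat \<Rightarrow> nat"
    assume I: "I \<subseteq> {..<s}" "I \<noteq> {}" and T: "T \<subseteq> {..<t}" "T \<noteq> {}" and J: "J \<noteq> {}" "finite J"
      "card J \<le> card I * card T"
    have cI: "1 \<le> card I" "card I \<le> s" and cT: "1 \<le> card T" "card T \<le> t"
      using I T card_mono[OF _ I(1)] card_mono[OF _ T(1)] finite_subset[OF I(1)] finite_subset[OF T(1)]
      by (auto simp: Suc_le_eq card_gt_0_iff)
    define LHS where "LHS = real (card {\<psi> \<in> \<Psi>. (\<forall>i\<in>I. u \<psi> (Inl i) = a (Inl i)) \<and> (\<forall>j\<in>T. u \<psi> (Inr j) = a (Inr j))})"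
    define B where "B = real \<Delta> ^ (s - card I) * real \<kappa> ^ (t - card T)"
    define Z where "Z = real b * real \<Delta> ^ s * real \<kappa> ^ (t - 1)"
    define D2j where "D2j = real (D {i0, j0}) ^ card J"
    have L1: "LHS \<le> 2 ^ (s + t) * B"
    proof -
      have "card {\<psi> \<in> \<Psi>. (\<forall>i\<in>I. u \<psi> (Inl i) = a (Inl i)) \<and> (\<forall>j\<in>T. u \<psi> (Inr j) = a (Inr j))}
          \<le> (2 * \<Delta>) ^ (s - card I) * (2 * \<kappa>) ^ (t - card T)"
        using marg I T by blast
      then have "LHS \<le> real ((2 * \<Delta>) ^ (s - card I) * (2 * \<kappa>) ^ (t - card T))" unfolding LHS_def by (simp only: of_nat_le_iff)
      also have "\<dots> = 2 ^ (s - card I + (t - card T)) * B" by (simp add: B_def power_mult_distrib power_add mult_ac)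
      also have "\<dots> \<le> 2 ^ (s + t) * B" using pos by (intro mult_right_mono power_increasing) (auto simp: B_def)
      finally show ?thesis .
    qed
    \<comment> \<open>On logarithms to base \<open>n\<close> this is \<open>star_exponent\<close>.
      The two factors \<open>P\<close> absorb the constants in the marginal and in the lower bound
      for \<open>card \<Psi>\<close>.\<close>
    have main: "P\<^sup>2 * B \<le> \<beta> (card J) * (Z * D2j)"
    proof (subst log_le_iff[symmetric])
      show "0 < P\<^sup>2 * B" using pos P_ge by (simp add: B_def)
      show "0 < \<beta> (card J) * (Z * D2j)" using pos P_ge n1 cardH_pos Dp by (simp add: \<beta>_def Z_def D2j_def)
      have "\<l> (P\<^sup>2 * B) = 2 * \<theta> + (real s - card I) * \<l> \<Delta> + (real t - card T) * \<l> \<kappa>"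
        using pos P_ge n1 cI cT by (simp add: B_def log_mult log_nat_power \<theta>_def of_nat_diff)
      also have "\<dots> \<le> 2 * \<theta> + ((s + t * (s + 1)) * \<theta> + (2 - x) * (real (card J) - 1) - card J * \<mu> + \<l> b + s * \<l> \<Delta> + (real t - 1) * \<l> \<kappa> + card J * d2)"
        using star_exponent[of "card I" "card T" "card J" "\<l> b" \<theta> \<mu> d2 "\<l> \<Delta>" "\<l> \<kappa>"] cI cT J(3) b1 \<theta> e dl k
        by (simp flip: of_nat_mult)
      also have "\<dots> \<le> b_exp * \<theta> + (2 - x) * (real (card J) - 1) - card J * \<mu> + (\<l> b + s * \<l> \<Delta> + (real t - 1) * \<l> \<kappa> + card J * d2)"
        using mult_right_mono[OF b_exp_ge(1) \<theta>(1)] by (simp add: algebra_simps)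
      also have "\<dots> = \<l> (\<beta> (card J) * (Z * D2j))"
        using pos Dp s1 n1 by (subst log_\<beta>) (auto simp: Z_def D2j_def log_mult log_nat_power d2_def of_nat_diff)
      finally show "\<l> (P\<^sup>2 * B) \<le> \<l> (\<beta> (card J) * (Z * D2j))" .
    qed
    have \<beta>0: "0 \<le> \<beta> (card J)" using P_ge by (simp add: \<beta>_def)
    have cc: "2 ^ (s + t) * (2 ^ (s + t + 1) * real \<Lambda>) \<le> P\<^sup>2"
    proof -
      have "(2::real) ^ (s + t) * 1 \<le> 2 ^ (s + t + 2) * Q" using Q_ge by (intro mult_mono power_increasing) auto
      then have a1: "(2::real) ^ (s + t) \<le> P" using P_ge by linarith
      have "(2::real) ^ (s + t + 1) * real \<Lambda> \<le> 2 ^ (s + t + 2) * real \<Lambda>" by (intro mult_right_mono power_increasing) auto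
      then have a2: "2 ^ (s + t + 1) * real \<Lambda> \<le> P" using P_ge by linarith
      show ?thesis unfolding power2_eq_square using P_ge by (intro mult_mono a1 a2) auto
    qed
    have "(2 ^ (s + t + 1) * real \<Lambda>) * LHS \<le> (2 ^ (s + t + 1) * real \<Lambda>) * (2 ^ (s + t) * B)"
      by (intro mult_left_mono L1) auto
    also have "\<dots> = (2 ^ (s + t) * (2 ^ (s + t + 1) * real \<Lambda>)) * B" by simp
    also have "\<dots> \<le> P\<^sup>2 * B" by (intro mult_right_mono cc) (simp add: B_def)
    also have "\<dots> \<le> \<beta> (card J) * (Z * D2j)" by (rule main)
    also have "\<dots> \<le> \<beta> (card J) * ((2 ^ (s + t + 1) * real \<Lambda> * card \<Psi>) * D2j)"
      using num(7) \<beta>0 by (intro mult_left_mono mult_right_mono) (auto simp: Z_def D2j_def)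
    finally have "(2 ^ (s + t + 1) * real \<Lambda>) * LHS \<le> (2 ^ (s + t + 1) * real \<Lambda>) * (\<beta> (card J) * card \<Psi> * D2j)"
      by (simp add: mult_ac)
    then have "LHS \<le> \<beta> (card J) * card \<Psi> * D2j" by (rule mult_left_le_imp_le) (use \<Lambda>1 in simp)
    then show "real (card {\<psi> \<in> \<Psi>. (\<forall>i\<in>I. u \<psi> (Inl i) = a (Inl i)) \<and> (\<forall>j\<in>T. u \<psi> (Inr j) = a (Inr j))})
        \<le> \<beta> (card J) * card \<Psi> * (\<Prod>f\<in>J. real (D {i0, j0}))"
      by (simp add: LHS_def D2j_def)
  qed
qed


text \<open>Heavy pairs and \<open>D_mono\<close> force some \<open>(r - 1)\<close>-set of
  coordinates to have codegree at least about \<open>card H * n powr (\<delta>0 - (r - 1))\<close>,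
  hence about \<open>n powr \<delta>0\<close> or more. Such a link has room for the \<open>t\<close>
  side.\<close>

lemma link_weight:
  assumes all: "\<And>i j. i < r \<Longrightarrow> j < r \<Longrightarrow> i \<noteq> j \<Longrightarrow> card H * n powr (\<delta>0 - 2) \<le> D {i, j}"
  shows "\<exists>w. balanced_weight w"
proof -
  \<comment> \<open>The omitted coordinate \<open>c\<close> maximises the codegree, so \<delta>
    bounds the codegree of every \<open>(r - 1)\<close>-set of coordinates and not only that of
    \<open>T'\<close>.\<close>
  define f where "f c = D ({..<r} - {c})" for c
  have "Max (f ` {..<r}) \<in> f ` {..<r}" using r by (intro Max_in) (auto simp: lessThan_empty_iff)
  then obtain c where c: "c < r" and fc: "Max (f ` {..<r}) = f c" by auto
  have cmax: "D ({..<r} - {c'}) \<le> D ({..<r} - {c})" if "c' < r" for c'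
  proof -
    have "f c' \<le> Max (f ` {..<r})" using that by (intro Max_ge) auto
    then show ?thesis unfolding fc by (simp add: f_def)
  qed
  define T' where "T' = {..<r} - {c}"
  have T'r: "T' \<subseteq> {..<r}" and cT': "card T' = r - 1" using c by (auto simp: T'_def)
  have "card {..<s} \<le> card T'" using rst cT' by auto
  then obtain \<iota> where \<iota>: "inj_on \<iota> {..<s}" "\<iota> ` {..<s} \<subseteq> T'"
    using card_le_inj[of "{..<s}" T'] by (auto simp: T'_def)
  have \<iota>r: "\<iota> i < r" "\<iota> i \<noteq> c" if "i < s" for i using \<iota>(2) that by (auto simp: T'_def)
  define \<delta> where "\<delta> = \<l> (D T')"
  have DT'pos: "0 < real (D T')" by (rule D_pos[OF T'r])
  have Tmax: "\<l> (D ({..<r} - {c'})) \<le> \<delta>" if "c' < r" for c'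
    using cmax[OF that] D_pos[of "{..<r} - {c'}"] DT'pos unfolding \<delta>_def T'_def by (subst log_le_iff) auto
  have pair_ge: "\<mu> - 2 + \<delta>0 \<le> \<l> (D {\<iota> i, c})" if "i < s" for i
  proof -
    have "\<l> (card H * n powr (\<delta>0 - 2)) \<le> \<l> (D {\<iota> i, c})"
      using all[of "\<iota> i" c] \<iota>r[OF that] c cardH_pos n1 D_pos[of "{\<iota> i, c}"] by (subst log_le_iff) auto
    then show ?thesis using cardH_pos n1 by (simp add: log_mult \<mu>_def)
  qed
  have big: "\<l> (D U) \<le> \<theta> + (real r - 1 - card U) + \<delta>" if U: "U \<subseteq> {..<r}" "card U \<le> r - 1" for U
  proof -
    have "U \<noteq> {..<r}" using U(2) r by auto
    then obtain c' where c': "c' < r" "c' \<notin> U" using U by auto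
    have sub: "U \<subseteq> {..<r} - {c'}" using U c' by auto
    have "card ({..<r} - {c'} - U) = r - 1 - card U"
      using sub c' by (subst card_Diff_subset) (auto intro: finite_subset)
    moreover have "real (r - 1 - card U) = real r - 1 - card U" using U(2) r by (simp add: of_nat_diff)
    ultimately have "\<l> (D U) \<le> \<theta> + (real r - 1 - card U) + \<l> (D ({..<r} - {c'}))"
      using log_D_mono[OF sub] by simp
    then show ?thesis using Tmax[OF c'(1)] by linarith
  qed
  have s0: "0 < s" "1 \<le> t" using s2 st by auto
  have \<delta>_ge: "\<mu> - (real r - 1) + \<delta>0 - \<theta> \<le> \<delta>"
  proof -
    have "card {\<iota> 0, c} = 2" using \<iota>r[OF s0(1)] by simp
    then have "\<l> (D {\<iota> 0, c}) \<le> \<theta> + (real r - 1 - 2) + \<delta>"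
      using big[of "{\<iota> 0, c}"] \<iota>r[OF s0(1)] c r by simp
    then show ?thesis using pair_ge[OF s0(1)] by linarith
  qed
  \<comment> \<open>The bounds \<open>\<delta> \<ge> \<delta>0 - \<theta>\<close> and
    \<open>2 * \<theta> \<le> \<epsilon> \<le> \<delta>0\<close> give
    \<open>\<theta> \<le> \<delta>\<close>, that is, \<open>P \<le> D T'\<close>.\<close>
  have large: "2 * t * Q \<le> D T'"
  proof -
    have "2 * \<theta> \<le> (real s + 1) * \<theta>" using reals \<theta> by (intro mult_right_mono) auto
    then have "\<theta> \<le> \<delta>" using \<theta> \<delta>_ge \<mu>_ge exponents(3) by linarith
    then have "P \<le> D T'" unfolding \<theta>_def \<delta>_def using DT'pos P_ge by (subst (asm) log_le_iff) auto
    then show ?thesis using P_ge by linarith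
  qed
  obtain \<Psi> :: "((nat \<Rightarrow> nat) \<times> (nat \<Rightarrow> nat set)) set" and u where
    \<Psi>: "finite \<Psi>" "\<forall>\<psi>\<in>\<Psi>. inj_on (u \<psi>) (verts K)"
      "\<forall>\<psi>\<in>\<Psi>. \<forall>i<s. \<forall>j<t. \<exists>e\<in>C. u \<psi> (Inl i) = lab e (\<iota> i) \<and> u \<psi> (Inr j) = lab e c"
    and num: "real (card H) * real (D T') ^ (t - 1) \<le> (2 * Q) ^ (t + 1) * card \<Psi>"
    and marg: "\<forall>I T a. I \<subseteq> {..<s} \<longrightarrow> T \<subseteq> {..<t} \<longrightarrow> T \<noteq> {} \<longrightarrow>
      card {\<psi> \<in> \<Psi>. (\<forall>i\<in>I. u \<psi> (Inl i) = a (Inl i)) \<and> (\<forall>j\<in>T. u \<psi> (Inr j) = a (Inr j))}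
        \<le> 2 * D (insert c (\<iota> ` I)) * (2 * D T') ^ (t - card T)"
    using link_sampler[OF c \<iota>(1) \<iota>(2)[unfolded T'_def] large[unfolded T'_def] s0(2), folded T'_def]
    by (elim exE conjE) (rule that; assumption)
  have Qpos: "0 < Q" using Q_ge by linarith
  have \<Psi>pos: "0 < real (card \<Psi>)"
  proof -
    have "0 < real (card H) * real (D T') ^ (t - 1)" using cardH_pos DT'pos by simp
    also note num
    finally show ?thesis using Qpos by (simp add: zero_less_mult_iff)
  qed
  show ?thesis
  proof (rule sampler_weight[where u=u and \<iota>=\<iota> and c=c and \<Psi>=\<Psi>])
    show "finite \<Psi>" "\<Psi> \<noteq> {}" "\<forall>\<psi>\<in>\<Psi>. inj_on (u \<psi>) (verts K)"
      "\<forall>\<psi>\<in>\<Psi>. \<forall>i<s. \<forall>j<t. \<exists>e\<in>C. u \<psi> (Inl i) = lab e (\<iota> i) \<and> u \<psi> (Inr j) = lab e c"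
      using \<Psi> \<Psi>pos by (auto simp: card_gt_0_iff)
    show "\<iota> i < r \<and> \<iota> i \<noteq> c" if "i < s" for i using \<iota>r that by auto
    show "c < r" by (rule c)
    fix I T :: "nat set" and J :: "(nat + nat) set set" and a :: "nat + nat \<Rightarrow> nat"
    assume I: "I \<subseteq> {..<s}" "I \<noteq> {}" and T: "T \<subseteq> {..<t}" "T \<noteq> {}" and J: "J \<noteq> {}" "finite J"
      "card J \<le> card I * card T" "card I = 1 \<longrightarrow> card J = card T" "\<forall>f\<in>J. left_end f \<in> I"
    have finI: "finite I" using I finite_subset by auto
    have cI: "1 \<le> card I" "card I \<le> s" and cT: "1 \<le> card T" "card T \<le> t"
      using I T card_mono[OF _ I(1)] card_mono[OF _ T(1)] finite_subset[OF I(1)] finite_subset[OF T(1)]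
      by (auto simp: Suc_le_eq card_gt_0_iff)
    let ?U = "insert c (\<iota> ` I)"
    have U: "?U \<subseteq> {..<r}" using c \<iota>r I by auto
    have cU: "card ?U = card I + 1"
    proof -
      have "card (\<iota> ` I) = card I" using \<iota>(1) I by (meson card_image inj_on_subset)
      moreover have "c \<notin> \<iota> ` I" using \<iota>r I by auto
      ultimately show ?thesis using finI by simp
    qed
    define dI where "dI = \<l> (D ?U)"
    define \<Sigma> where "\<Sigma> = (\<Sum>f\<in>J. \<l> (D {\<iota> (left_end f), c}))"
    define Dp where "Dp = (\<Prod>f\<in>J. real (D {\<iota> (left_end f), c}))"
    have lt: "left_end f < s" if "f \<in> J" for f using J(5) I that by auto
    have pp: "0 < real (D {\<iota> (left_end f), c})" if "f \<in> J" for f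
      using D_pos[of "{\<iota> (left_end f), c}"] \<iota>r lt[OF that] c by simp
    have Dpos: "0 < Dp" unfolding Dp_def using pp by (intro prod_pos) auto
    have lDp: "\<l> Dp = \<Sigma>" unfolding Dp_def \<Sigma>_def by (rule sum_log_prod[OF J(2) pp])
    have expo: "dI \<le> (real (card T) + 2) * \<theta> + (2 - x) * (real (card J) - 1) + (1 - real (card J)) * \<mu>
        + (real (card T) - 1) * \<delta> + \<Sigma>"
    proof -
      have dI1: "dI \<le> \<theta> + (real r - 1 - card I)" using log_D_le[OF U] by (simp add: dI_def cU)
      \<comment> \<open>The prescribed coordinates number \<open>card I + 1\<close>. They fit into
        an \<open>(r - 1)\<close>-set unless \<open>card I = s\<close> and \<open>r = s + 1\<close>,
        and then the condition on \<open>r\<close>, \<open>s\<close>, \<open>t\<close> provides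
        \<open>s + 1 \<le> t\<close>.\<close>
      have dI2: "dI \<le> \<theta> + (real r - 2 - card I) + \<delta> \<or> real (card I) = real s \<and> real r - 1 = real s \<and> s + 1 \<le> t"
      proof (cases "card I + 1 \<le> r - 1")
        case True
        then show ?thesis using big[OF U] by (simp add: cU dI_def)
      next
        case False
        then have "card I = s" "r = s + 1" "s + 1 \<le> t" using rst cI by auto
        then show ?thesis by simp
      qed
      have \<Sigma>': "2 \<le> real (card I) \<and> real (card J) * (\<mu> - 2 + \<delta>0) \<le> \<Sigma> \<or>
          real (card I) = 1 \<and> real (card J) = real (card T) \<and> \<Sigma> = real (card T) * dI \<and> \<mu> - 2 + \<delta>0 \<le> dI"
      proof (cases "card I = 1")
        case True
        then obtain i where i: "I = {i}" by (auto simp: card_1_singleton_iff)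
        have "\<Sigma> = (\<Sum>f\<in>J. dI)" unfolding \<Sigma>_def dI_def using J(5) i by (intro sum.cong) (auto simp: insert_commute)
        moreover have "\<mu> - 2 + \<delta>0 \<le> dI" using pair_ge[of i] i I(1) by (simp add: dI_def insert_commute)
        ultimately show ?thesis using True J(4) by simp
      next
        case False
        have "(\<Sum>f\<in>J. \<mu> - 2 + \<delta>0) \<le> \<Sigma>" unfolding \<Sigma>_def using pair_ge lt by (intro sum_mono) auto
        moreover have "2 \<le> card I" using False cI by linarith
        ultimately show ?thesis by simp
      qed
      have "card T = 1 \<or> 2 \<le> card T" using cT by linarith
      then have T12: "real (card T) = 1 \<or> 2 \<le> real (card T)" by auto
      have JT: "real (card J) \<le> real (card I) * real (card T)" using J(3) by (metis of_nat_le_iff of_nat_mult)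
      show ?thesis
        using link_exponent[OF _ _ _ _ T12 JT \<mu>_ge \<theta>(1) \<delta>_ge dI1 dI2 \<Sigma>'] cI cT by simp
    qed
    define LHS where "LHS = real (card {\<psi> \<in> \<Psi>. (\<forall>i\<in>I. u \<psi> (Inl i) = a (Inl i)) \<and> (\<forall>j\<in>T. u \<psi> (Inr j) = a (Inr j))})"
    define B where "B = real (D ?U) * real (D T') ^ (t - card T)"
    define Z where "Z = real (card H) * real (D T') ^ (t - 1)"
    have DUpos: "0 < real (D ?U)" by (rule D_pos[OF U])
    have L1: "LHS \<le> 2 ^ (t + 1) * B"
    proof -
      have "card {\<psi> \<in> \<Psi>. (\<forall>i\<in>I. u \<psi> (Inl i) = a (Inl i)) \<and> (\<forall>j\<in>T. u \<psi> (Inr j) = a (Inr j))}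
          \<le> 2 * D ?U * (2 * D T') ^ (t - card T)"
        using marg I T by blast
      then have "LHS \<le> real (2 * D ?U * (2 * D T') ^ (t - card T))" unfolding LHS_def by (simp only: of_nat_le_iff)
      also have "\<dots> = 2 ^ (t - card T + 1) * B" by (simp add: B_def power_mult_distrib mult_ac)
      also have "\<dots> \<le> 2 ^ (t + 1) * B" using DUpos DT'pos by (intro mult_right_mono power_increasing) (auto simp: B_def)
      finally show ?thesis .
    qed
    have main: "P ^ (t + 1) * B \<le> \<beta> (card J) * (Z * Dp)"
    proof (subst log_le_iff[symmetric])
      show "0 < P ^ (t + 1) * B" using DUpos DT'pos P_ge by (simp add: B_def)
      show "0 < \<beta> (card J) * (Z * Dp)" using DT'pos P_ge n1 cardH_pos Dpos by (simp add: \<beta>_def Z_def)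
      have "\<l> (P ^ (t + 1) * B) = (real t + 1) * \<theta> + dI + (real t - card T) * \<delta>"
        using DUpos DT'pos P_ge n1 cT log_nat_power[of P "real n" "t + 1"]
        by (simp add: B_def log_mult log_nat_power \<theta>_def \<delta>_def dI_def of_nat_diff algebra_simps del: power_Suc power_add_numeral)
      also have "\<dots> \<le> (real t + 1) * \<theta> + ((real (card T) + 2) * \<theta> + (2 - x) * (real (card J) - 1) + (1 - real (card J)) * \<mu>
        + (real (card T) - 1) * \<delta> + \<Sigma>) + (real t - card T) * \<delta>"
        using expo by linarith
      also have "\<dots> \<le> b_exp * \<theta> + (2 - x) * (real (card J) - 1) - card J * \<mu> + (\<mu> + (real t - 1) * \<delta> + \<Sigma>)"
      proof -
        have "(real t + 1 + (real (card T) + 2)) * \<theta> \<le> b_exp * \<theta>"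
          using b_exp_ge(2) cT \<theta> by (intro mult_right_mono) auto
        then show ?thesis by (simp add: algebra_simps)
      qed
      also have "\<dots> = \<l> (\<beta> (card J) * (Z * Dp))"
        using DT'pos Dpos s0 n1 cardH_pos lDp
        by (subst log_\<beta>) (auto simp: Z_def log_mult log_nat_power \<mu>_def \<delta>_def of_nat_diff)
      finally show "\<l> (P ^ (t + 1) * B) \<le> \<l> (\<beta> (card J) * (Z * Dp))" .
    qed
    have \<beta>0: "0 \<le> \<beta> (card J)" using P_ge by (simp add: \<beta>_def)
    have cc: "2 ^ (t + 1) * (2 * Q) ^ (t + 1) \<le> P ^ (t + 1)"
    proof -
      have "(2::real) ^ 2 * Q \<le> 2 ^ (s + t + 2) * Q" using Qpos by (intro mult_right_mono power_increasing) auto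
      then have "2 * (2 * Q) \<le> P" using P_ge by simp
      then have "(2 * (2 * Q)) ^ (t + 1) \<le> P ^ (t + 1)" using Qpos by (intro power_mono) auto
      then show ?thesis by (simp only: power_mult_distrib)
    qed
    have "(2 * Q) ^ (t + 1) * LHS \<le> (2 * Q) ^ (t + 1) * (2 ^ (t + 1) * B)"
      using Qpos by (intro mult_left_mono L1) auto
    also have "\<dots> = (2 ^ (t + 1) * (2 * Q) ^ (t + 1)) * B" by (simp only: mult_ac)
    also have "\<dots> \<le> P ^ (t + 1) * B" by (intro mult_right_mono cc) (simp add: B_def)
    also have "\<dots> \<le> \<beta> (card J) * (Z * Dp)" by (rule main)
    also have "\<dots> \<le> \<beta> (card J) * (((2 * Q) ^ (t + 1) * card \<Psi>) * Dp)"
      using num \<beta>0 Dpos by (intro mult_left_mono mult_right_mono) (auto simp: Z_def)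
    also have "\<dots> = (2 * Q) ^ (t + 1) * (\<beta> (card J) * card \<Psi> * Dp)" by (simp only: mult_ac)
    finally have "(2 * Q) ^ (t + 1) * LHS \<le> (2 * Q) ^ (t + 1) * (\<beta> (card J) * card \<Psi> * Dp)" .
    then have "LHS \<le> \<beta> (card J) * card \<Psi> * Dp" by (rule mult_left_le_imp_le) (use Qpos in simp)
    then show "real (card {\<psi> \<in> \<Psi>. (\<forall>i\<in>I. u \<psi> (Inl i) = a (Inl i)) \<and> (\<forall>j\<in>T. u \<psi> (Inr j) = a (Inr j))})
        \<le> \<beta> (card J) * card \<Psi> * (\<Prod>f\<in>J. real (D {\<iota> (left_end f), c}))"
      by (simp add: LHS_def Dp_def)
  qed
qed

theorem ex_balanced_weight: "\<exists>w. balanced_weight w"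
proof (cases "\<exists>i j. i < r \<and> j < r \<and> i \<noteq> j \<and> real (D {i, j}) \<le> card H * n powr (\<delta>0 - 2)")
  case True
  then show ?thesis using star_weight by blast
next
  case False
  show ?thesis
  proof (rule link_weight)
    fix i j assume "i < r" "j < r" "i \<noteq> j"
    then have "\<not> real (D {i, j}) \<le> card H * n powr (\<delta>0 - 2)" using False by blast
    then show "card H * n powr (\<delta>0 - 2) \<le> D {i, j}" by linarith
  qed
qed

end

section \<open>Containers for expansions of complete bipartite graphs\<close>

text \<open>In each round a container with more than \<kappa> elements is replaced by the containers
  it induces, while a small one is kept as it is. The covering property passes on because
  \<open>I\<close> remains independent inside whichever container holds it.\<close>

lemma iterate_containers:
  fixes \<Omega> :: "'a set" and \<kappa> \<rho> :: real and q :: nat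
  assumes fin: "finite \<Omega>" and \<rho>: "0 \<le> \<rho>" "\<rho> \<le> 1" and q: "q \<ge> 1"
    and step: "\<And>V. V \<subseteq> \<Omega> \<Longrightarrow> \<kappa> < card V \<Longrightarrow> \<exists>\<C>. finite \<C> \<and> card \<C> \<le> q \<and>
      (\<forall>C\<in>\<C>. C \<subseteq> V \<and> card C \<le> (1 - \<rho>) * card V) \<and>
      (\<forall>I. I \<subseteq> V \<and> indep I \<longrightarrow> (\<exists>C\<in>\<C>. I \<subseteq> C))"
  shows "\<exists>\<C>. finite \<C> \<and> card \<C> \<le> q ^ k \<and>
      (\<forall>C\<in>\<C>. C \<subseteq> \<Omega> \<and> card C \<le> max \<kappa> ((1 - \<rho>) ^ k * card \<Omega>)) \<and>
      (\<forall>I. I \<subseteq> \<Omega> \<and> indep I \<longrightarrow> (\<exists>C\<in>\<C>. I \<subseteq> C))"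
proof (induction k)
  case 0
  show ?case by (intro exI[of _ "{\<Omega>}"]) auto
next
  case (Suc k)
  then obtain \<C> where \<C>: "finite \<C>" "card \<C> \<le> q ^ k"
    "\<And>C. C \<in> \<C> \<Longrightarrow> C \<subseteq> \<Omega> \<and> card C \<le> max \<kappa> ((1 - \<rho>) ^ k * card \<Omega>)"
    "\<And>I. I \<subseteq> \<Omega> \<and> indep I \<Longrightarrow> \<exists>C\<in>\<C>. I \<subseteq> C"
    by metis
  have "\<forall>V\<in>\<C>. \<exists>\<D>. finite \<D> \<and> card \<D> \<le> q \<and>
      (\<forall>C\<in>\<D>. C \<subseteq> \<Omega> \<and> card C \<le> max \<kappa> ((1 - \<rho>) ^ Suc k * card \<Omega>)) \<and>
      (\<forall>I. I \<subseteq> V \<and> indep I \<longrightarrow> (\<exists>C\<in>\<D>. I \<subseteq> C))"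
  proof
    fix V assume V: "V \<in> \<C>"
    show "\<exists>\<D>. finite \<D> \<and> card \<D> \<le> q \<and>
      (\<forall>C\<in>\<D>. C \<subseteq> \<Omega> \<and> card C \<le> max \<kappa> ((1 - \<rho>) ^ Suc k * card \<Omega>)) \<and>
      (\<forall>I. I \<subseteq> V \<and> indep I \<longrightarrow> (\<exists>C\<in>\<D>. I \<subseteq> C))"
    proof (cases "\<kappa> < card V")
      case True
      then have cV: "real (card V) \<le> (1 - \<rho>) ^ k * card \<Omega>" using \<C>(3)[OF V] by auto
      obtain \<D> where \<D>: "finite \<D>" "card \<D> \<le> q" "\<forall>C\<in>\<D>. C \<subseteq> V \<and> card C \<le> (1 - \<rho>) * card V"
        "\<forall>I. I \<subseteq> V \<and> indep I \<longrightarrow> (\<exists>C\<in>\<D>. I \<subseteq> C)"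
        using step[of V] \<C>(3)[OF V] True by metis
      have "C \<subseteq> \<Omega> \<and> card C \<le> max \<kappa> ((1 - \<rho>) ^ Suc k * card \<Omega>)" if "C \<in> \<D>" for C
      proof -
        have "real (card C) \<le> (1 - \<rho>) * card V" using \<D>(3) that by auto
        also have "\<dots> \<le> (1 - \<rho>) * ((1 - \<rho>) ^ k * card \<Omega>)" using \<rho> by (intro mult_left_mono cV) auto
        finally show ?thesis using \<D>(3) that \<C>(3)[OF V] by auto
      qed
      then show ?thesis using \<D> by (intro exI[of _ \<D>]) auto
    next
      case False
      then show ?thesis using \<C>(3)[OF V] q by (intro exI[of _ "{V}"]) auto
    qed
  qed
  then obtain \<D> where \<D>: "\<And>V. V \<in> \<C> \<Longrightarrow> finite (\<D> V) \<and> card (\<D> V) \<le> q \<and>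
      (\<forall>C\<in>\<D> V. C \<subseteq> \<Omega> \<and> card C \<le> max \<kappa> ((1 - \<rho>) ^ Suc k * card \<Omega>)) \<and>
      (\<forall>I. I \<subseteq> V \<and> indep I \<longrightarrow> (\<exists>C\<in>\<D> V. I \<subseteq> C))"
    by (metis bchoice)
  have "card (\<Union>V\<in>\<C>. \<D> V) \<le> (\<Sum>V\<in>\<C>. card (\<D> V))" by (rule card_UN_le[OF \<C>(1)])
  also have "\<dots> \<le> (\<Sum>V\<in>\<C>. q)" using \<D> by (intro sum_mono) auto
  also have "\<dots> \<le> q ^ Suc k" using \<C>(2) by simp
  finally have card: "card (\<Union>V\<in>\<C>. \<D> V) \<le> q ^ Suc k" .
  show ?case
  proof (rule exI[of _ "\<Union>V\<in>\<C>. \<D> V"], intro conjI)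
    show "finite (\<Union>V\<in>\<C>. \<D> V)" using \<C>(1) \<D> by blast
    show "card (\<Union>V\<in>\<C>. \<D> V) \<le> q ^ Suc k" by (rule card)
    show "\<forall>C\<in>\<Union>V\<in>\<C>. \<D> V. C \<subseteq> \<Omega> \<and> card C \<le> max \<kappa> ((1 - \<rho>) ^ Suc k * card \<Omega>)"
      using \<D> by blast
    show "\<forall>I. I \<subseteq> \<Omega> \<and> indep I \<longrightarrow> (\<exists>C\<in>\<Union>V\<in>\<C>. \<D> V. I \<subseteq> C)"
    proof (intro allI impI)
      fix I assume I: "I \<subseteq> \<Omega> \<and> indep I"
      obtain V where V: "V \<in> \<C>" "I \<subseteq> V" using \<C>(4)[OF I] by auto
      have "\<forall>I. I \<subseteq> V \<and> indep I \<longrightarrow> (\<exists>C\<in>\<D> V. I \<subseteq> C)" using \<D>[OF V(1)] by simp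
      then obtain C where "C \<in> \<D> V" "I \<subseteq> C" using I V(2) by auto
      then show "\<exists>C\<in>\<Union>V\<in>\<C>. \<D> V. I \<subseteq> C" using V(1) by (intro bexI[of _ C]) auto
    qed
  qed
qed

section \<open>One container round for a dense hypergraph\<close>

definition rsets :: "nat \<Rightarrow> nat \<Rightarrow> nat set set" where
  "rsets r n = {e. e \<subseteq> {..<n} \<and> card e = r}"

lemma finite_rsets: "finite (rsets r n)"
  unfolding rsets_def by (rule finite_subset[of _ "Pow {..<n}"]) auto

lemma card_rsets: "card (rsets r n) = n choose r"
  unfolding rsets_def using n_subsets[of "{..<n}" r] by simp

lemma card_rsets_le: "card (rsets r n) \<le> n ^ r"
  unfolding rsets_def by (rule card_subsets_le_power) auto

text \<open>Twice the coefficient of \<open>n ^ (r - 3)\<close> in \<open>d_large\<close>, for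
  \<open>s + t\<close> core vertices and \<open>s * t\<close> edges.\<close>

definition clean_const :: "nat \<Rightarrow> nat \<Rightarrow> nat \<Rightarrow> nat" where
  "clean_const r s t = 2 * (2 * (s + t) + 4 * (s * t) * r)"

text \<open>Cleaning removes at most \<open>clean_const r s t * n ^ (r - 1)\<close> edges, hence at
  most half of \<open>H\<close>, and leaves at least \<open>n ^ (r - 1)\<close>. The weight lives on
  the cleaned part \<open>G\<close>, but containers are wanted for \<open>H\<close>; replacing
  \<open>card G\<close> by \<open>card H\<close> costs a factor two per edge, whence the last factor
  \<open>2 ^ (s * t)\<close> in \<open>B\<close>.\<close>

lemma container_step_kst:
  fixes r s t n m \<Lambda> :: nat and H :: "nat set set" and PP B c2 :: real
  defines "PP \<equiv> 2 ^ (s + t + 3) * s * t * (8 * r ^ r * real (\<Lambda> ^ 2 ^ r)) * \<Lambda>"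
  defines "B \<equiv> 8 ^ (s * t) * (s * t) ^ (s * t) * r ^ (s + t) * PP ^ (4 * s * t + 10) * 2 ^ (s * t)"
  defines "c2 \<equiv> 2 ^ (s * t * (s * t + 3)) :: real"
  assumes sst: "2 \<le> s" "s \<le> t" and rst: "s + 1 \<le> t \<and> s + 1 \<le> r \<or> s + 2 \<le> r" and n: "2 \<le> n"
    and H: "H \<subseteq> rsets r n" "2 * (clean_const r s t + 1) * n ^ (r - 1) \<le> card H"
    and \<Lambda>: "n ^ r < 2 ^ \<Lambda>"
    and small: "PP ^ (s + 1) \<le> n powr kst_exponents.\<epsilon> s t"
    and m: "n powr (2 - kst_exponents.x s t) \<le> m" and mB: "4 * m * B * c2 \<le> n ^ (r - 1)"
  shows "\<exists>\<C>. finite \<C> \<and> card \<C> \<le> (2 * (n ^ r + 1) ^ m) ^ (s * t) \<and>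
    (\<forall>C\<in>\<C>. C \<subseteq> H \<and> card C \<le> (1 - 1 / (4 * B * c2)) * card H) \<and>
    (\<forall>G. G \<subseteq> H \<and> (\<forall>A\<in>copies n (expansion r (complete_bipartite s t)). \<not> A \<subseteq> G) \<longrightarrow> (\<exists>C\<in>\<C>. G \<subseteq> C))"
proof -
  interpret kst_exponents s t by unfold_locales (use sst in auto)
  have r3: "3 \<le> r" using rst sst by auto
  have finH: "finite H" using H(1) finite_rsets finite_subset by blast
  have H': "H \<subseteq> {e. e \<subseteq> {..<n} \<and> card e = r}" using H(1) by (simp add: rsets_def)
  define a where "a = clean_const r s t"
  define \<S> where "\<S> = {f. f \<subseteq> {..<n} \<and> card f = 2}"
  have fin\<S>: "finite \<S>" unfolding \<S>_def by (rule finite_subset[of _ "Pow {..<n}"]) auto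
  obtain G where G: "G \<subseteq> H" "real (card H) \<le> card G + (\<Sum>S\<in>\<S>. \<bar>real (a * n ^ (r - 3))\<bar>)"
    "\<forall>S\<in>\<S>. \<forall>e\<in>G. S \<subseteq> e \<longrightarrow> real (a * n ^ (r - 3)) \<le> codeg G S"
    using ex_clean_subset[OF finH fin\<S>, of "\<lambda>_. real (a * n ^ (r - 3))"] by auto
  have sumS: "(\<Sum>S\<in>\<S>. \<bar>real (a * n ^ (r - 3))\<bar>) \<le> a * n ^ (r - 1)"
  proof -
    have "card \<S> \<le> n ^ 2" unfolding \<S>_def by (rule card_subsets_le_power) auto
    then have "card \<S> * (a * n ^ (r - 3)) \<le> n ^ 2 * (a * n ^ (r - 3))" by (rule mult_le_mono1)
    also have "\<dots> = a * n ^ (r - 1)"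
    proof -
      have "r - 1 = 2 + (r - 3)" using r3 by simp
      then have "n ^ (r - 1) = n ^ 2 * n ^ (r - 3)" by (simp only: power_add)
      then show ?thesis by (simp only: mult.left_commute)
    qed
    finally have "real (card \<S> * (a * n ^ (r - 3))) \<le> real (a * n ^ (r - 1))" by (simp only: of_nat_le_iff)
    then show ?thesis by simp
  qed
  define M where "M = real n ^ (r - 1)"
  have HM: "2 * (a + 1) * M \<le> card H"
  proof -
    have "real (2 * (a + 1) * n ^ (r - 1)) \<le> card H" using H(2) unfolding a_def by (simp only: of_nat_le_iff)
    then show ?thesis by (simp add: M_def algebra_simps)
  qed
  have GH: "real (card H) - a * M \<le> card G" using G(2) sumS by (simp add: M_def)
  have M1: "1 \<le> M" using n by (simp add: M_def one_le_power)
  have half: "real (card H) \<le> 2 * card G" and GM: "M \<le> card G"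
  proof -
    have "2 * (a * M) + 2 * M \<le> card H" using HM by (simp add: algebra_simps)
    then show "real (card H) \<le> 2 * card G" "M \<le> card G" using GH M1 by linarith+
  qed
  have finG: "finite G" using G(1) finH finite_subset by blast
  have Gsub: "G \<subseteq> {e. e \<subseteq> {..<n} \<and> card e = r}" using G(1) H' by blast
  have Gne: "G \<noteq> {}" using GM M1 by auto
  have Gpow: "card G \<le> n ^ r" 
    using order_trans[OF card_mono[OF finite_rsets] card_rsets_le] order_trans[OF G(1) H(1)] by blast
  have "\<exists>l. bij_betw l {..<r} e" if "e \<in> G" for e
  proof -
    have "finite e" "card e = r" using Gsub that by (auto intro: finite_subset)
    then show ?thesis using ex_bij_betw_nat_finite[of e] by (auto simp: atLeast0LessThan)
  qed
  \<comment> \<open>The order within an edge is arbitrary; coordinates only serve to pigeonhole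
    codegrees.\<close>
  then obtain lab where lab: "\<And>e. e \<in> G \<Longrightarrow> bij_betw (lab e) {..<r} e" by metis
  have \<Lambda>1: "\<Lambda> \<ge> 1"
  proof (rule ccontr)
    assume "\<not> \<Lambda> \<ge> 1"
    then have "\<Lambda> = 0" by simp
    then show False using \<Lambda> n by simp
  qed
  \<comment> \<open>One pigeonhole for each of the \<open>2 ^ r\<close> coordinate sets, which gives
    the factor \<open>\<Lambda> ^ 2 ^ r\<close>.\<close>
  obtain D C where DC: "C \<subseteq> G" "card G \<le> \<Lambda> ^ card (Pow {..<r}) * card C"
    "\<forall>U\<in>Pow {..<r}. 1 \<le> D U \<and> (\<forall>e\<in>C. D U \<le> codeg G (lab e ` U) \<and> codeg G (lab e ` U) < 2 * D U)"
  proof -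
    have "1 \<le> codeg G (lab e ` U) \<and> codeg G (lab e ` U) < 2 ^ \<Lambda>" if "U \<in> Pow {..<r}" "e \<in> G" for U e
    proof -
      have "lab e ` U \<subseteq> e" using lab[OF that(2)] that(1) by (auto simp: bij_betw_def)
      then have "e \<in> {e' \<in> G. lab e ` U \<subseteq> e'}" using that by simp
      then have "codeg G (lab e ` U) > 0" unfolding codeg_def using finG by (auto simp: card_gt_0_iff)
      moreover have "codeg G (lab e ` U) \<le> card G" unfolding codeg_def using finG by (intro card_mono) auto
      ultimately show ?thesis using Gpow \<Lambda> by linarith
    qed
    from dyadic_classes[of "Pow {..<r}" G "\<lambda>U e. codeg G (lab e ` U)" \<Lambda>, OF _ finG this \<Lambda>1]
    show thesis using that by auto
  qed
  define L where "L = real (\<Lambda> ^ 2 ^ r)"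
  have clean: "a * n ^ (r - 3) \<le> codeg G f" if "e \<in> G" "f \<subseteq> e" "card f = 2" for e f
  proof -
    have "f \<in> \<S>" using that Gsub by (auto simp: \<S>_def)
    then have "real (a * n ^ (r - 3)) \<le> real (codeg G f)" using G(3) that by blast
    then show ?thesis by (simp only: of_nat_le_iff)
  qed
  have nr: "n < 2 ^ \<Lambda>"
  proof -
    have "n ^ 1 \<le> n ^ r" using n r3 by (intro power_increasing) auto
    then show ?thesis using \<Lambda> by simp
  qed
  have reg: "regular_class n r G lab C D L"
  proof
    show "1 \<le> n" "3 \<le> r" using n r3 by auto
    show "G \<subseteq> {e. e \<subseteq> {..<n} \<and> card e = r}" "G \<noteq> {}" "C \<subseteq> G" by fact+
    show "bij_betw (lab e) {..<r} e" if "e \<in> G" for e by (rule lab[OF that])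
    have "real (card G) \<le> real (\<Lambda> ^ card (Pow {..<r}) * card C)" using DC(2) by (simp only: of_nat_le_iff)
    then show "real (card G) \<le> L * card C" by (simp add: L_def card_Pow)
    show "1 \<le> L" using \<Lambda>1 by (simp add: L_def one_le_power)
    show "1 \<le> D U" if "U \<subseteq> {..<r}" for U using DC(3) that by auto
    show "D U \<le> codeg G (lab e ` U) \<and> codeg G (lab e ` U) < 2 * D U" if "e \<in> C" "U \<subseteq> {..<r}" for e U
      using DC(3) that by auto
  qed
  then interpret R: regular_class n r G lab C D L .
  have PP_eq: "2 ^ (s + t + 3) * s * t * R.Q * \<Lambda> = PP" unfolding PP_def R.Q_def by (simp add: L_def)
  have dense: "n ^ (r - 1) \<le> card G"
  proof -
    have "real (n ^ (r - 1)) \<le> real (card G)" using GM by (simp add: M_def)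
    then show ?thesis by (simp only: of_nat_le_iff)
  qed
  interpret KC: kst_class n r G lab C D L s t \<Lambda>
  proof
    show "s + 1 \<le> t \<and> s + 1 \<le> r \<or> s + 2 \<le> r" "n < 2 ^ \<Lambda>" "2 \<le> n" "n ^ (r - 1) \<le> card G" by fact+
    show "2 * (2 * (s + t) + 4 * (s * t) * r) * n ^ (r - 3) \<le> codeg G f"
      if "e \<in> G" "f \<subseteq> e" "card f = 2" for e f
      using clean[OF that] by (simp only: a_def clean_const_def)
    show "(2 ^ (s + t + 3) * s * t * R.Q * \<Lambda>) ^ (s + 1) \<le> n powr \<epsilon>"
      unfolding PP_eq by (rule small)
  qed
  obtain w where w: "KC.balanced_weight w" using KC.ex_balanced_weight by blast
  have wnn: "0 \<le> w A" for A using w by (simp add: KC.balanced_weight_def)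
  have wsupp: "A \<subseteq> G \<and> card A = s * t \<and> A \<in> copies n (expansion r (complete_bipartite s t))" if "w A \<noteq> 0" for A
    using w that unfolding KC.balanced_weight_def by blast
  have wpos: "wdeg G w {} > 0" using w unfolding KC.balanced_weight_def by blast
  have wbound: "wdeg G w S \<le> 8 ^ (s * t) * (s * t) ^ (s * t) * r ^ (s + t) * KC.\<beta> (card S) * wdeg G w {}"
    if "S \<subseteq> G" "S \<noteq> {}" for S
    using w that unfolding KC.balanced_weight_def by blast
  have wGH: "wdeg H w S = wdeg G w S" for S
    unfolding wdeg_def using finH G(1) wsupp by (intro sum.mono_neutral_right finite_wdeg_index) auto
  define N where "N = card H"
  have Npos: "0 < N" using half GM M1 G(1) finH Gne by (auto simp: N_def card_gt_0_iff)
  have PPp: "PP = KC.P" unfolding KC.P_def by (rule PP_eq[symmetric])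
  have PP1: "1 \<le> PP" unfolding PPp by (rule KC.P_ge)
  have s1: "1 \<le> s" "1 \<le> t" using sst by auto
  have Bpos: "0 < B"
  proof -
    have "0 < real (s * t) ^ (s * t)" "0 < real r ^ (s + t)" "0 < PP ^ (4 * s * t + 10)" using s1 r3 PP1 by auto
    then show ?thesis unfolding B_def by simp
  qed
  have wdeg_bound: "wdeg H w S \<le> B * wdeg H w {} / N * (m / N) ^ (card S - 1)" if S: "S \<subseteq> H" "S \<noteq> {}" for S
  proof (cases "S \<subseteq> G \<and> card S \<le> s * t")
    case False
    have "wdeg H w S = 0"
      unfolding wdeg_def
    proof (rule sum.neutral, rule ballI)
      fix A assume A: "A \<in> {e. e \<subseteq> H \<and> S \<subseteq> e}"
      show "w A = 0"
      proof (rule ccontr)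
        assume "w A \<noteq> 0"
        from wsupp[OF this] A have SA: "S \<subseteq> A" "A \<subseteq> G" "card A = s * t" by auto
        have "card S \<le> card A" by (rule card_mono[OF finite_subset[OF SA(2) finG] SA(1)])
        then have "S \<subseteq> G" "card S \<le> s * t" using SA by auto
        then show False using False by simp
      qed
    qed
    then show ?thesis using Bpos wpos by (simp add: wGH less_imp_le)
  next
    case True
    have cS: "1 \<le> card S" using S finH by (auto simp: Suc_le_eq card_gt_0_iff intro: finite_subset)
    then have sc: "card S = Suc (card S - 1)" by simp
    define j where "j = card S - 1"
    have cSj: "card S = Suc j" using sc by (simp add: j_def)
    define c1 where "c1 = (8::real) ^ (s * t) * real (s * t) ^ (s * t) * real r ^ (s + t)"
    have c1: "0 \<le> c1" by (simp add: c1_def)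
    have np: "n powr ((2 - x) * (real (card S) - 1)) \<le> real m ^ j"
    proof -
      have "n powr ((2 - x) * (real (card S) - 1)) = (n powr (2 - x)) ^ j"
        using n by (simp add: cSj powr_powr[symmetric] powr_realpow)
      also have "\<dots> \<le> real m ^ j" using m by (intro power_mono) auto
      finally show ?thesis .
    qed
    have Gc: "0 < real (card G)" using Gne finG by (simp add: card_gt_0_iff)
    have inv: "1 / real (card G) ^ card S \<le> 2 ^ (s * t) / real N ^ card S"
    proof -
      have "real N ^ card S \<le> (2 * real (card G)) ^ card S" using half by (intro power_mono) (auto simp: N_def)
      also have "\<dots> = 2 ^ card S * real (card G) ^ card S" by (rule power_mult_distrib)
      also have "\<dots> \<le> 2 ^ (s * t) * real (card G) ^ card S"
        using True by (intro mult_right_mono power_increasing) auto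
      finally show ?thesis using Gc Npos by (simp add: field_simps)
    qed
    have \<beta>: "KC.\<beta> (card S) \<le> PP ^ (4 * s * t + 10) * real m ^ j * (2 ^ (s * t) / real N ^ card S)"
    proof -
      have "KC.\<beta> (card S) = PP ^ (4 * s * t + 10) * n powr ((2 - x) * (real (card S) - 1)) * (1 / real (card G) ^ card S)"
        unfolding KC.\<beta>_def KC.b_exp_def PPp by simp
      also have "\<dots> \<le> PP ^ (4 * s * t + 10) * real m ^ j * (2 ^ (s * t) / real N ^ card S)"
        using PP1 by (intro mult_mono mult_left_mono np inv) auto
      finally show ?thesis .
    qed
    have "wdeg H w S \<le> c1 * KC.\<beta> (card S) * wdeg H w {}"
      using wbound[of S] True S by (simp add: wGH c1_def)
    also have "\<dots> \<le> c1 * (PP ^ (4 * s * t + 10) * real m ^ j * (2 ^ (s * t) / real N ^ card S)) * wdeg H w {}"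
      using \<beta> c1 wpos by (intro mult_right_mono mult_left_mono) (auto simp: wGH)
    also have "\<dots> = B * wdeg H w {} / N * (m / N) ^ (card S - 1)"
      using Npos by (simp add: cSj B_def c1_def power_divide field_simps)
    finally show ?thesis .
  qed
  have NM: "M \<le> N" using GM card_mono[OF finH G(1)] by (simp add: N_def)
  have m1: "1 \<le> m"
  proof -
    have "0 < n powr (2 - x)" using n by simp
    then have "0 < real m" using m by linarith
    then show ?thesis by simp
  qed
  have small': "4 * m * B * 2 ^ (s * t * (s * t + 3)) \<le> N" 
  proof -
    have "real (n ^ (r - 1)) = M" by (simp add: M_def)
    then show ?thesis using mB NM unfolding c2_def by linarith
  qed
  obtain \<C> where \<C>: "finite \<C>" "card \<C> \<le> (2 * (N + 1) ^ m) ^ (s * t)"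
    "\<forall>C\<in>\<C>. C \<subseteq> H \<and> card C + N / (4 * B * 2 ^ (s * t * (s * t + 3))) \<le> N"
    "\<forall>I. I \<subseteq> H \<and> (\<forall>e. e \<subseteq> I \<longrightarrow> w e = 0) \<longrightarrow> (\<exists>C\<in>\<C>. I \<subseteq> C)"
  proof -
    have "\<exists>\<C>. finite \<C> \<and> card \<C> \<le> (2 * (N + 1) ^ m) ^ (s * t) \<and>
      (\<forall>C\<in>\<C>. C \<subseteq> H \<and> card C + N / (4 * B * 2 ^ (s * t * (s * t + 3))) \<le> N) \<and>
      (\<forall>I. I \<subseteq> H \<and> (\<forall>e. e \<subseteq> I \<longrightarrow> w e = 0) \<longrightarrow> (\<exists>C\<in>\<C>. I \<subseteq> C))"
    proof (rule weighted_container)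
      show "finite H" "card H = N" "0 < N" "1 \<le> m" "0 < B" using finH Npos m1 Bpos by (auto simp: N_def)
      show "0 \<le> w e" for e by (rule wnn)
      show "e \<subseteq> H \<and> card e = s * t" if "w e \<noteq> 0" for e using wsupp[OF that] G(1) by auto
      show "wdeg H w {} = wdeg H w {}" "0 < wdeg H w {}" using wpos by (auto simp: wGH)
      show "wdeg H w S \<le> B * wdeg H w {} / N * (m / N) ^ (card S - 1)" if "S \<subseteq> H" "S \<noteq> {}" for S
        by (rule wdeg_bound[OF that])
      show "4 * m * B * 2 ^ (s * t * (s * t + 3)) \<le> N" by (rule small')
    qed
    then show thesis using that by (elim exE conjE)
  qed
  show ?thesis
  proof (intro exI[of _ \<C>] conjI)
    show "finite \<C>" by (rule \<C>)
    have "N \<le> n ^ r" 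
      using order_trans[OF card_mono[OF finite_rsets H(1)] card_rsets_le] by (simp add: N_def)
    then have "(2 * (N + 1) ^ m) ^ (s * t) \<le> (2 * (n ^ r + 1) ^ m) ^ (s * t)"
      by (intro power_mono mult_le_mono2) auto
    then show "card \<C> \<le> (2 * (n ^ r + 1) ^ m) ^ (s * t)" using \<C>(2) by linarith
    show "\<forall>C\<in>\<C>. C \<subseteq> H \<and> card C \<le> (1 - 1 / (4 * B * c2)) * card H"
      using \<C>(3) by (simp add: c2_def N_def algebra_simps)
    show "\<forall>G. G \<subseteq> H \<and> (\<forall>A\<in>copies n (expansion r (complete_bipartite s t)). \<not> A \<subseteq> G) \<longrightarrow> (\<exists>C\<in>\<C>. G \<subseteq> C)"
    proof (intro allI impI)
      fix F assume F: "F \<subseteq> H \<and> (\<forall>A\<in>copies n (expansion r (complete_bipartite s t)). \<not> A \<subseteq> F)"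
      have "w A = 0" if "A \<subseteq> F" for A using wsupp[of A] F that by blast
      then show "\<exists>C\<in>\<C>. F \<subseteq> C" using \<C>(4) F by simp
    qed
  qed
qed


text \<open>\<open>B\<close> and the number of rounds are polylogarithmic in \<open>n\<close>, so
  the logarithm of the number of containers is \<open>m n\<close> times a polylogarithmic
  factor.\<close>

theorem containers_kst:
  fixes r s t :: nat
  assumes sst: "2 \<le> s" "s \<le> t" and rst: "s + 1 \<le> t \<and> s + 1 \<le> r \<or> s + 2 \<le> r"
  shows "\<exists>C1. \<forall>\<^sub>F n in sequentially. \<exists>\<C>. finite \<C> \<and>
    real (card \<C>) \<le> exp (n powr (2 - kst_exponents.x s t) * ln n ^ C1) \<and>
    (\<forall>C\<in>\<C>. C \<subseteq> rsets r n \<and> card C \<le> 2 * (clean_const r s t + 1) * n ^ (r - 1)) \<and>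
    (\<forall>G. G \<subseteq> rsets r n \<and> (\<forall>A\<in>copies n (expansion r (complete_bipartite s t)). \<not> A \<subseteq> G)
      \<longrightarrow> (\<exists>C\<in>\<C>. G \<subseteq> C))"
proof -
  interpret kst_exponents s t by unfold_locales (use sst in auto)
  have r3: "3 \<le> r" using rst sst by auto
  \<comment> \<open>The added 1 makes \<open>n ^ r < 2 ^ \<Lambda> n\<close> strict.\<close>
  define \<Lambda> where "\<Lambda> n = nat \<lceil>real r * log 2 (real n)\<rceil> + 1" for n :: nat
  define PP where "PP n = 2 ^ (s + t + 3) * s * t * (8 * r ^ r * real (\<Lambda> n ^ 2 ^ r)) * \<Lambda> n" for n
  define B where "B n = 8 ^ (s * t) * (s * t) ^ (s * t) * r ^ (s + t) * PP n ^ (4 * s * t + 10) * 2 ^ (s * t)" for n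
  define c2 where "c2 = (2 ^ (s * t * (s * t + 3)) :: real)"
  define m where "m n = nat \<lceil>real n powr (2 - x)\<rceil>" for n
  \<comment> \<open>A round shrinks containers by the factor \<open>1 - 1 / (4 * B n * c2)\<close>,
    so this many rounds gain a factor \<open>n\<close>, which is the step from \<open>n ^ r\<close>
    to \<open>n ^ (r - 1)\<close>.\<close>
  define R where "R n = nat \<lceil>4 * B n * c2 * ln (real n)\<rceil>" for n
  define c\<Lambda> where "c\<Lambda> = real r / ln 2 + 2"
  define d1 where "d1 = (2::nat) ^ r + 1"
  define p1 where "p1 = 2 ^ (s + t + 3) * s * t * (8 * r ^ r) * c\<Lambda> ^ d1"
  define d2 where "d2 = d1 * (4 * s * t + 10)"
  define b2 where "b2 = 8 ^ (s * t) * (s * t) ^ (s * t) * r ^ (s + t) * p1 ^ (4 * s * t + 10) * 2 ^ (s * t)"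
  have s1: "1 \<le> real s" "1 \<le> real t" "1 \<le> real r" "1 \<le> c2" using sst r3 by (auto simp: c2_def one_le_power)
  have c\<Lambda>: "0 < c\<Lambda>" by (simp add: c\<Lambda>_def add_nonneg_pos)
  have p1: "0 < p1" using s1 c\<Lambda> by (simp add: p1_def)
  have b2: "0 < b2" using s1 p1 by (simp add: b2_def)
  have E1: "\<forall>\<^sub>F n in sequentially. (p1 * ln (real n) ^ d1) ^ (s + 1) \<le> real n powr \<epsilon>"
    using exponents(2) p1 by real_asymp
  have xpos: "0 < x" using exponents by linarith
  \<comment> \<open>Leads to \<open>4 * m n * B n * c2 \<le> n ^ 2 \<le> n ^ (r - 1)\<close>, the
    size condition of the container theorem.\<close>
  have E2: "\<forall>\<^sub>F n in sequentially. 8 * c2 * b2 * ln (real n) ^ d2 \<le> real n powr x"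
    using xpos b2 s1 by real_asymp
  have E3: "\<forall>\<^sub>F n in sequentially. (4 * c2 * b2 + 1) * (s * t) * (2 * r + 3) \<le> ln (real n)"
    by real_asymp
  have E4: "\<forall>\<^sub>F n in sequentially. 1 \<le> ln (real n)" by real_asymp
  have E5: "\<forall>\<^sub>F n in sequentially. 2 \<le> (n::nat)" by (rule eventually_ge_at_top)
  show ?thesis
  proof (rule exI[of _ "d2 + 3"])
    from E1 E2 E3 E4 E5 show "\<forall>\<^sub>F n in sequentially. \<exists>\<C>. finite \<C> \<and>
      real (card \<C>) \<le> exp (n powr (2 - x) * ln n ^ (d2 + 3)) \<and>
      (\<forall>C\<in>\<C>. C \<subseteq> rsets r n \<and> card C \<le> 2 * (clean_const r s t + 1) * n ^ (r - 1)) \<and>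
      (\<forall>G. G \<subseteq> rsets r n \<and> (\<forall>A\<in>copies n (expansion r (complete_bipartite s t)). \<not> A \<subseteq> G)
        \<longrightarrow> (\<exists>C\<in>\<C>. G \<subseteq> C))"
    proof eventually_elim
      case (elim n)
      note e1 = elim(1) and e2 = elim(2) and e3 = elim(3) and l1 = elim(4) and n2 = elim(5)
      have lpos: "0 < ln (real n)" using l1 by linarith
      have n1: "1 < real n" using n2 by simp
      have logn: "0 \<le> real r * log 2 (real n)" using n1 by simp
      have \<Lambda>r: "real (\<Lambda> n) \<le> c\<Lambda> * ln (real n)"
      proof -
        have "real (\<Lambda> n) \<le> real r * log 2 (real n) + 2" using logn by (simp add: \<Lambda>_def) linarith
        also have "\<dots> \<le> real r * log 2 (real n) + 2 * ln (real n)" using l1 by simp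
        also have "\<dots> = c\<Lambda> * ln (real n)" by (simp add: c\<Lambda>_def log_def algebra_simps)
        finally show ?thesis .
      qed
      have \<Lambda>p: "n ^ r < 2 ^ \<Lambda> n"
      proof -
        have "real n ^ r = (2 powr log 2 (real n)) powr real r" using n1 by (simp add: powr_realpow)
        also have "\<dots> = 2 powr (real r * log 2 (real n))" by (simp only: powr_powr mult.commute)
        finally have "real n ^ r = 2 powr (real r * log 2 (real n))" .
        also have "\<dots> \<le> 2 powr real (nat \<lceil>real r * log 2 (real n)\<rceil>)" by (intro powr_mono) (auto simp: real_nat_ceiling_ge)
        also have "\<dots> < 2 powr real (\<Lambda> n)" by (simp add: \<Lambda>_def)
        also have "\<dots> = 2 ^ \<Lambda> n" by (simp add: powr_realpow)
        finally have "real (n ^ r) < real (2 ^ \<Lambda> n)" by simp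
        then show ?thesis by (simp only: of_nat_less_iff)
      qed
      have \<Lambda>1: "1 \<le> real (\<Lambda> n)" by (simp add: \<Lambda>_def)
      have PPle: "PP n \<le> p1 * ln (real n) ^ d1"
      proof -
        have "real (\<Lambda> n) ^ d1 \<le> (c\<Lambda> * ln (real n)) ^ d1" by (intro power_mono \<Lambda>r) auto
        then have "2 ^ (s + t + 3) * s * t * (8 * r ^ r) * real (\<Lambda> n) ^ d1
            \<le> 2 ^ (s + t + 3) * s * t * (8 * r ^ r) * (c\<Lambda> * ln (real n)) ^ d1"
          by (intro mult_left_mono) auto
        moreover have "PP n = 2 ^ (s + t + 3) * s * t * (8 * r ^ r) * real (\<Lambda> n) ^ d1"
          by (simp add: PP_def d1_def)
        ultimately show ?thesis by (simp add: p1_def power_mult_distrib)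
      qed
      have PP0: "0 \<le> PP n" by (simp add: PP_def)
      have PP1: "1 \<le> PP n"
      proof -
        have "1 \<le> 2 ^ (s + t + 3) * s * t * (8 * r ^ r * \<Lambda> n ^ 2 ^ r) * \<Lambda> n"
          using s1 \<Lambda>1 by (simp add: Suc_le_eq)
        then have "real 1 \<le> real (2 ^ (s + t + 3) * s * t * (8 * r ^ r * \<Lambda> n ^ 2 ^ r) * \<Lambda> n)" by (simp only: of_nat_le_iff)
        then show ?thesis by (simp add: PP_def)
      qed
      have Ble: "B n \<le> b2 * ln (real n) ^ d2"
      proof -
        have "PP n ^ (4 * s * t + 10) \<le> (p1 * ln (real n) ^ d1) ^ (4 * s * t + 10)" using PP0 PPle by (intro power_mono)
        then have "8 ^ (s * t) * (s * t) ^ (s * t) * r ^ (s + t) * PP n ^ (4 * s * t + 10) * 2 ^ (s * t)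
          \<le> 8 ^ (s * t) * (s * t) ^ (s * t) * r ^ (s + t) * (p1 * ln (real n) ^ d1) ^ (4 * s * t + 10) * 2 ^ (s * t)"
          by (intro mult_right_mono mult_left_mono) auto
        also have "\<dots> = b2 * ln (real n) ^ d2"
          by (simp only: b2_def d2_def power_mult_distrib power_mult mult_ac)
        finally show ?thesis by (simp only: B_def)
      qed
      have B1: "1 \<le> B n"
      proof -
        have "1 \<le> real (8 ^ (s * t) * (s * t) ^ (s * t) * r ^ (s + t))"
          using s1 by (simp add: Suc_le_eq flip: of_nat_mult of_nat_power)
        moreover have "1 \<le> PP n ^ (4 * s * t + 10)" "1 \<le> (2::real) ^ (s * t)" using PP1 by (auto intro: one_le_power)
        ultimately have "1 * 1 * 1 \<le> real (8 ^ (s * t) * (s * t) ^ (s * t) * r ^ (s + t)) * PP n ^ (4 * s * t + 10) * 2 ^ (s * t)"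
          by (intro mult_mono) auto
        then show ?thesis by (simp add: B_def)
      qed
      have np1: "1 \<le> real n powr (2 - x)" using n1 exponents(7) by (simp add: ge_one_powr_ge_zero)
      have m_ge: "real n powr (2 - x) \<le> m n" by (simp add: m_def real_nat_ceiling_ge)
      have m_le: "m n \<le> 2 * real n powr (2 - x)"
      proof -
        have "real (m n) \<le> real n powr (2 - x) + 1" unfolding m_def by (simp add: of_nat_nat)
        then show ?thesis using np1 by linarith
      qed
      have mB: "4 * real (m n) * B n * c2 \<le> n ^ (r - 1)"
      proof -
        have "4 * real (m n) * B n * c2 \<le> 4 * (2 * real n powr (2 - x)) * (b2 * ln (real n) ^ d2) * c2"
          using m_le Ble B1 s1 by (intro mult_right_mono mult_mono) auto
        also have "\<dots> = real n powr (2 - x) * (8 * c2 * b2 * ln (real n) ^ d2)" by simp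
        also have "\<dots> \<le> real n powr (2 - x) * real n powr x" by (intro mult_left_mono e2) auto
        also have "\<dots> = real n ^ 2" using n1 by (simp add: powr_add[symmetric])
        also have "\<dots> \<le> real n ^ (r - 1)" using n1 r3 by (intro power_increasing) auto
        finally show ?thesis by simp
      qed
      have mB': "real (4 * m n) * B n * c2 \<le> real (n ^ (r - 1))" using mB by simp
      have small: "PP n ^ (s + 1) \<le> n powr \<epsilon>"
        using order_trans[OF power_mono[OF PPle PP0] e1] .
      define q where "q = (2 * (n ^ r + 1) ^ m n) ^ (s * t)"
      define \<kappa> where "\<kappa> = 2 * (clean_const r s t + 1) * n ^ (r - 1)"
      define \<rho> where "\<rho> = 1 / (4 * B n * c2)"
      have BC: "1 \<le> 4 * B n * c2" using mult_mono[of 1 "B n" 1 c2] B1 s1 by simp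
      define z where "z = 4 * B n * c2"
      have z: "1 \<le> z" "\<rho> = 1 / z" using BC by (simp_all only: z_def \<rho>_def)
      then have \<rho>: "0 \<le> \<rho>" "\<rho> \<le> 1" by auto
      have q1: "1 \<le> q" by (simp add: q_def Suc_le_eq)
      obtain \<C> where \<C>: "finite \<C>" "card \<C> \<le> q ^ R n"
        "\<forall>C\<in>\<C>. C \<subseteq> rsets r n \<and> card C \<le> max (real \<kappa>) ((1 - \<rho>) ^ R n * card (rsets r n))"
        "\<forall>G. G \<subseteq> rsets r n \<and> (\<forall>A\<in>copies n (expansion r (complete_bipartite s t)). \<not> A \<subseteq> G)
          \<longrightarrow> (\<exists>C\<in>\<C>. G \<subseteq> C)"
      proof -
        have "\<exists>\<C>. finite \<C> \<and> card \<C> \<le> q ^ R n \<and>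
          (\<forall>C\<in>\<C>. C \<subseteq> rsets r n \<and> card C \<le> max (real \<kappa>) ((1 - \<rho>) ^ R n * card (rsets r n))) \<and>
          (\<forall>G. G \<subseteq> rsets r n \<and> (\<forall>A\<in>copies n (expansion r (complete_bipartite s t)). \<not> A \<subseteq> G)
            \<longrightarrow> (\<exists>C\<in>\<C>. G \<subseteq> C))"
        proof (rule iterate_containers[OF finite_rsets \<rho> q1])
          fix V assume V: "V \<subseteq> rsets r n" "real \<kappa> < card V"
          have "\<kappa> < card V" using V(2) by (simp only: of_nat_less_iff)
          then have cV: "2 * (clean_const r s t + 1) * n ^ (r - 1) \<le> card V" by (simp add: \<kappa>_def)
          show "\<exists>\<C>. finite \<C> \<and> card \<C> \<le> q \<and>
            (\<forall>C\<in>\<C>. C \<subseteq> V \<and> card C \<le> (1 - \<rho>) * card V) \<and>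
            (\<forall>G. G \<subseteq> V \<and> (\<forall>A\<in>copies n (expansion r (complete_bipartite s t)). \<not> A \<subseteq> G)
              \<longrightarrow> (\<exists>C\<in>\<C>. G \<subseteq> C))"
            unfolding q_def \<rho>_def
            using container_step_kst[OF sst rst n2 V(1) cV \<Lambda>p, folded PP_def, folded B_def c2_def, OF small m_ge mB'] .
        qed
        then show thesis using that by (elim exE conjE)
      qed
      have shrink: "(1 - \<rho>) ^ R n * card (rsets r n) \<le> \<kappa>"
      proof -
        have "(1 - \<rho>) ^ R n \<le> exp (- \<rho>) ^ R n" using \<rho> exp_ge_add_one_self[of "- \<rho>"] by (intro power_mono) auto
        also have "\<dots> = exp (- (\<rho> * R n))" by (simp add: exp_of_nat_mult[symmetric] mult.commute)
        also have "\<dots> \<le> exp (- ln (real n))"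
        proof -
          have "z * ln (real n) \<le> R n" by (simp add: R_def real_nat_ceiling_ge z_def)
          then have "\<rho> * (z * ln (real n)) \<le> \<rho> * R n" using \<rho> by (intro mult_left_mono)
          moreover have "\<rho> * (z * ln (real n)) = ln (real n)" using z by simp
          ultimately show ?thesis by simp
        qed
        also have "\<dots> = 1 / n" using n1 by (simp add: exp_minus inverse_eq_divide)
        finally have "(1 - \<rho>) ^ R n * card (rsets r n) \<le> 1 / n * real (n ^ r)"
          using card_rsets_le[of r n] by (intro mult_mono) auto
        also have "\<dots> = real n ^ (r - 1)" using n1 r3 by (cases r) auto
        also have "\<dots> \<le> \<kappa>" by (simp add: \<kappa>_def algebra_simps)
        finally show ?thesis .
      qed
      have count: "real (card \<C>) \<le> exp (n powr (2 - x) * ln n ^ (d2 + 3))"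
      proof -
        have "real (card \<C>) \<le> real (q ^ R n)" using \<C>(2) by (simp only: of_nat_le_iff)
        also have "\<dots> = exp (ln (real (q ^ R n)))" using q1 by simp
        also have "\<dots> \<le> exp (n powr (2 - x) * ln n ^ (d2 + 3))"
        proof (subst exp_le_cancel_iff)
          define l where "l = ln (real n)"
          define y where "y = real n powr (2 - x)"
          have ly: "1 \<le> l" "1 \<le> y" using l1 np1 by (simp_all add: l_def y_def)
          have lq: "ln (real q) = (s * t) * (ln 2 + m n * ln (real (n ^ r + 1)))"
            unfolding q_def by (simp add: ln_realpow ln_mult add_pos_nonneg distrib_left del: of_nat_Suc of_nat_add)
          have ln1: "ln (real (n ^ r + 1)) \<le> (r + 1) * l"
          proof -
            have "n ^ r + 1 \<le> n ^ r * 2" using n2 by simp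
            also have "\<dots> \<le> n ^ (r + 1)" using n2 by simp
            finally have "real (n ^ r + 1) \<le> real (n ^ (r + 1))" by (simp only: of_nat_le_iff)
            then have "ln (real (n ^ r + 1)) \<le> ln (real (n ^ (r + 1)))" using n1 by (subst ln_le_cancel_iff) (auto intro!: add_pos_nonneg mult_pos_pos)
            also have "\<dots> = (r + 1) * l" using n1 by (simp add: ln_realpow l_def ln_mult algebra_simps)
            finally show ?thesis .
          qed
          have ln2: "ln 2 \<le> l" using n2 by (simp add: l_def)
          have "ln 2 + m n * ln (real (n ^ r + 1)) \<le> y * l + (2 * y) * ((r + 1) * l)"
          proof (rule add_mono)
            have "1 * l \<le> y * l" using ly by (intro mult_right_mono) auto
            then show "ln 2 \<le> y * l" using ln2 by linarith
            show "m n * ln (real (n ^ r + 1)) \<le> (2 * y) * ((r + 1) * l)"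
              using m_le ln1 ly by (intro mult_mono) (auto simp: y_def)
          qed
          also have "\<dots> = (2 * r + 3) * (y * l)" by (simp add: algebra_simps)
          finally have lnq: "ln (real q) \<le> (s * t) * ((2 * r + 3) * (y * l))"
            unfolding lq by (intro mult_left_mono) auto
          have Rle: "R n \<le> (4 * c2 * b2 + 1) * l ^ (d2 + 1)"
          proof -
            have "0 \<le> 4 * B n * c2 * l" using B1 s1 ly by simp
            then have "R n \<le> 4 * B n * c2 * l + 1" unfolding R_def l_def by ((simp add: of_nat_nat; fail) | (simp add: of_nat_nat, linarith))
            also have "\<dots> \<le> 4 * (b2 * l ^ d2) * c2 * l + l ^ (d2 + 1)"
              using Ble s1 ly by (intro add_mono mult_right_mono mult_left_mono one_le_power) (auto simp: l_def)
            also have "\<dots> = (4 * c2 * b2 + 1) * l ^ (d2 + 1)" by (simp add: algebra_simps)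
            finally show ?thesis .
          qed
          have "ln (real (q ^ R n)) = R n * ln (real q)" using q1 by (simp add: ln_realpow)
          also have "\<dots> \<le> ((4 * c2 * b2 + 1) * l ^ (d2 + 1)) * ((s * t) * ((2 * r + 3) * (y * l)))"
            using q1 ly b2 s1 by (intro mult_mono Rle lnq) auto
          also have "\<dots> = ((4 * c2 * b2 + 1) * (s * t) * (2 * r + 3)) * (y * l ^ (d2 + 2))"
            by (simp add: mult_ac)
          also have "\<dots> \<le> l * (y * l ^ (d2 + 2))"
            using e3 ly by (intro mult_right_mono) (auto simp: l_def)
          also have "\<dots> = y * l ^ (d2 + 3)" by (simp add: power_add numeral_3_eq_3)
          finally show "ln (real (q ^ R n)) \<le> n powr (2 - x) * ln n ^ (d2 + 3)" by (simp add: l_def y_def)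
        qed
        finally show ?thesis .
      qed
      show ?case
      proof (intro exI[of _ \<C>] conjI ballI)
        show "finite \<C>" "real (card \<C>) \<le> exp (n powr (2 - x) * ln n ^ (d2 + 3))" by fact+
        fix C assume "C \<in> \<C>"
        then have C: "C \<subseteq> rsets r n" "real (card C) \<le> max (real \<kappa>) ((1 - \<rho>) ^ R n * card (rsets r n))" using \<C>(3) by auto
        show "C \<subseteq> rsets r n" by (rule C)
        have "real (card C) \<le> real \<kappa>" using C(2) shrink by linarith
        then show "card C \<le> 2 * (clean_const r s t + 1) * n ^ (r - 1)" by (simp only: of_nat_le_iff \<kappa>_def)
      qed (rule \<C>(4))
    qed
  qed
qed

section \<open>Random subsets\<close>

lemma pmf_markov:
  fixes f :: "'a \<Rightarrow> real"
  assumes "finite (set_pmf M)" "\<And>x. x \<in> set_pmf M \<Longrightarrow> 0 \<le> f x" "0 < c"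
  shows "measure_pmf.prob M {x. c \<le> f x} \<le> measure_pmf.expectation M f / c"
  using integral_Markov_inequality_measure[of "measure_pmf M" f UNIV c]
    integrable_measure_pmf_finite[OF assms(1), of f] assms
  by (simp add: AE_measure_pmf_iff)

definition random_subset :: "'a set \<Rightarrow> real \<Rightarrow> 'a set pmf" where
  "random_subset \<Omega> p = map_pmf (\<lambda>X. {e \<in> \<Omega>. X e}) (Pi_pmf \<Omega> False (\<lambda>_. bernoulli_pmf p))"

lemma random_rgraph_eq: "random_rgraph r n p = map_pmf (Pair {..<n}) (random_subset (rsets r n) p)"
  unfolding random_rgraph_def random_subset_def rsets_def by (simp add: map_pmf_comp)

context
  fixes \<Omega> :: "'a set" and p :: real
  assumes fin\<Omega>: "finite \<Omega>" and p: "0 \<le> p" "p \<le> 1"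
begin

lemma set_random_subset: "set_pmf (random_subset \<Omega> p) \<subseteq> Pow \<Omega>"
  by (auto simp: random_subset_def)

lemma finite_set_random_subset: "finite (set_pmf (random_subset \<Omega> p))"
  using finite_subset[OF set_random_subset] fin\<Omega> by simp

lemma integrable_random_subset:
  fixes f :: "'a set \<Rightarrow> real"
  shows "integrable (measure_pmf (random_subset \<Omega> p)) f"
  by (rule integrable_measure_pmf_finite[OF finite_set_random_subset])

lemma prob_superset:
  assumes S: "S \<subseteq> \<Omega>"
  shows "measure_pmf.prob (random_subset \<Omega> p) {E. S \<subseteq> E} = p ^ card S"
proof -
  let ?B = "\<lambda>e. if e \<in> S then {True} else UNIV"
  have "measure_pmf.prob (random_subset \<Omega> p) {E. S \<subseteq> E}
      = measure_pmf.prob (Pi_pmf \<Omega> False (\<lambda>_. bernoulli_pmf p)) (Pi \<Omega> ?B)"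
    unfolding random_subset_def measure_map_pmf using S
    by (intro arg_cong[where f="measure_pmf.prob _"]) (auto simp: Pi_def subset_iff split: if_splits)
  also have "\<dots> = (\<Prod>e\<in>\<Omega>. measure_pmf.prob (bernoulli_pmf p) (?B e))"
    by (rule measure_Pi_pmf_Pi[OF fin\<Omega>])
  also have "\<dots> = (\<Prod>e\<in>\<Omega>. if e \<in> S then p else 1)"
    using p by (intro prod.cong) (auto simp: measure_pmf_single)
  also have "\<dots> = p ^ card S"
    using S fin\<Omega> by (simp add: prod.If_cases Int_absorb1)
  finally show ?thesis .
qed

text \<open>The factors are independent, and each element of \<open>S\<close> contributes
  \<open>2 * p + (1 - p) = 1 + p\<close>.\<close>

lemma expectation_two_power:
  assumes S: "S \<subseteq> \<Omega>"
  shows "measure_pmf.expectation (random_subset \<Omega> p) (\<lambda>E. 2 ^ card (E \<inter> S) :: real) = (1 + p) ^ card S"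
proof -
  have eq: "(2::real) ^ card ({e \<in> \<Omega>. X e} \<inter> S) = (\<Prod>e\<in>\<Omega>. if e \<in> S \<and> X e then 2 else 1)" for X
  proof -
    have "(\<Prod>e\<in>\<Omega>. if e \<in> S \<and> X e then 2 else (1::real)) = 2 ^ card (\<Omega> \<inter> {e. e \<in> S \<and> X e})"
      using fin\<Omega> by (simp add: prod.If_cases)
    also have "\<Omega> \<inter> {e. e \<in> S \<and> X e} = {e \<in> \<Omega>. X e} \<inter> S" by auto
    finally show ?thesis by simp
  qed
  have "measure_pmf.expectation (random_subset \<Omega> p) (\<lambda>E. 2 ^ card (E \<inter> S) :: real)
      = measure_pmf.expectation (Pi_pmf \<Omega> False (\<lambda>_. bernoulli_pmf p)) (\<lambda>X. \<Prod>e\<in>\<Omega>. if e \<in> S \<and> X e then 2 else 1)"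
    unfolding random_subset_def integral_map_pmf eq ..
  also have "\<dots> = (\<Prod>e\<in>\<Omega>. measure_pmf.expectation (bernoulli_pmf p) (\<lambda>b. if e \<in> S \<and> b then 2 else 1))"
    by (rule expectation_prod_Pi_pmf[OF fin\<Omega>]) (auto intro: integrable_measure_pmf_finite)
  also have "\<dots> = (\<Prod>e\<in>\<Omega>. if e \<in> S then 1 + p else 1)"
    using p by (intro prod.cong) auto
  also have "\<dots> = (1 + p) ^ card S"
    using S fin\<Omega> by (simp add: prod.If_cases Int_absorb1)
  finally show ?thesis .
qed

text \<open>Markov's inequality for \<open>2 ^ card (E \<inter> S)\<close>. Base two is good enough
  because \<open>T\<close> will be at least four times the mean.\<close>

lemma prob_card_ge:
  assumes S: "S \<subseteq> \<Omega>"
  shows "measure_pmf.prob (random_subset \<Omega> p) {E. T \<le> real (card (E \<inter> S))} \<le> exp (p * card S - T * ln 2)"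
proof -
  have "{E :: 'a set. T \<le> real (card (E \<inter> S))} = {E. 2 powr T \<le> 2 ^ card (E \<inter> S)}"
    by (simp add: powr_realpow[symmetric])
  then have "measure_pmf.prob (random_subset \<Omega> p) {E. T \<le> real (card (E \<inter> S))}
      \<le> measure_pmf.expectation (random_subset \<Omega> p) (\<lambda>E. 2 ^ card (E \<inter> S)) / 2 powr T"
    using pmf_markov[OF finite_set_random_subset, of "\<lambda>E. 2 ^ card (E \<inter> S)" "2 powr T"] by simp
  also have "\<dots> = (1 + p) ^ card S / 2 powr T" by (simp add: expectation_two_power[OF S])
  also have "\<dots> \<le> exp p ^ card S / 2 powr T"
    using p exp_ge_add_one_self[of p] by (intro divide_right_mono power_mono) auto
  also have "\<dots> = exp (p * card S - T * ln 2)"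
    by (simp add: exp_of_nat_mult[symmetric] exp_diff powr_def mult.commute)
  finally show ?thesis .
qed

lemma expectation_card_family:
  assumes "finite \<X>" "\<And>A. A \<in> \<X> \<Longrightarrow> A \<subseteq> \<Omega>"
  shows "measure_pmf.expectation (random_subset \<Omega> p) (\<lambda>E. real (card {A \<in> \<X>. A \<subseteq> E})) = (\<Sum>A\<in>\<X>. p ^ card A)"
proof -
  have eq: "real (card {A \<in> \<X>. A \<subseteq> E}) = (\<Sum>A\<in>\<X>. indicator {E. A \<subseteq> E} E)" for E
    using assms(1) by (simp add: indicator_def sum.If_cases Int_def)
  have "measure_pmf.expectation (random_subset \<Omega> p) (\<lambda>E. real (card {A \<in> \<X>. A \<subseteq> E}))
      = (\<Sum>A\<in>\<X>. measure_pmf.expectation (random_subset \<Omega> p) (indicator {E. A \<subseteq> E}))"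
    unfolding eq by (rule Bochner_Integration.integral_sum) (rule integrable_random_subset)
  also have "\<dots> = (\<Sum>A\<in>\<X>. p ^ card A)"
    using prob_superset assms(2) by (intro sum.cong) auto
  finally show ?thesis .
qed

lemma expectation_card_Int:
  assumes "S \<subseteq> \<Omega>"
  shows "measure_pmf.expectation (random_subset \<Omega> p) (\<lambda>E. real (card (E \<inter> S))) = p * card S"
proof -
  have finS: "finite S" using assms fin\<Omega> finite_subset by auto
  have "card (E \<inter> S) = card {A \<in> (\<lambda>e. {e}) ` S. A \<subseteq> E}" for E
    by (rule bij_betw_same_card[of "\<lambda>e. {e}"]) (auto simp: bij_betw_def)
  then have "measure_pmf.expectation (random_subset \<Omega> p) (\<lambda>E. real (card (E \<inter> S)))
     = (\<Sum>A\<in>(\<lambda>e. {e}) ` S. p ^ card A)"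
    using expectation_card_family[of "(\<lambda>e. {e}) ` S"] finS assms by auto
  also have "\<dots> = p * card S" by (subst sum.reindex) auto
  finally show ?thesis .
qed

lemma expectation_card_Int_square:
  assumes "S \<subseteq> \<Omega>"
  shows "measure_pmf.expectation (random_subset \<Omega> p) (\<lambda>E. (real (card (E \<inter> S)))\<^sup>2) \<le> p * card S + (p * card S)\<^sup>2"
proof -
  have finS: "finite S" using assms fin\<Omega> finite_subset by auto
  let ?I = "\<lambda>e f. indicator {E. {e, f} \<subseteq> E} :: 'a set \<Rightarrow> real"
  have eq: "(real (card (E \<inter> S)))\<^sup>2 = (\<Sum>e\<in>S. \<Sum>f\<in>S. ?I e f E)" for E
  proof -
    have "real (card (E \<inter> S)) = (\<Sum>e\<in>S. if e \<in> E then 1 else 0)"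
      using finS by (simp add: sum.If_cases Int_commute Int_def)
    then have "(real (card (E \<inter> S)))\<^sup>2 = (\<Sum>e\<in>S. \<Sum>f\<in>S. (if e \<in> E then 1 else 0) * (if f \<in> E then 1 else 0))"
      by (simp only: power2_eq_square sum_product)
    also have "\<dots> = (\<Sum>e\<in>S. \<Sum>f\<in>S. ?I e f E)" by (intro sum.cong) (auto simp: indicator_def)
    finally show ?thesis .
  qed
  have "measure_pmf.expectation (random_subset \<Omega> p) (\<lambda>E. (real (card (E \<inter> S)))\<^sup>2)
      = (\<Sum>e\<in>S. \<Sum>f\<in>S. measure_pmf.expectation (random_subset \<Omega> p) (?I e f))"
    unfolding eq
    by (subst Bochner_Integration.integral_sum, rule integrable_random_subset)
      (intro sum.cong refl Bochner_Integration.integral_sum integrable_random_subset)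
  also have "\<dots> = (\<Sum>e\<in>S. \<Sum>f\<in>S. p ^ card {e, f})"
  proof (intro sum.cong refl)
    fix e f assume "e \<in> S" "f \<in> S"
    then have "{e, f} \<subseteq> \<Omega>" using assms by auto
    from prob_superset[OF this] show "measure_pmf.expectation (random_subset \<Omega> p) (?I e f) = p ^ card {e, f}"
      by simp
  qed
  also have "\<dots> \<le> (\<Sum>e\<in>S. \<Sum>f\<in>S. (if f = e then p else 0) + p\<^sup>2)"
    using p by (intro sum_mono) (auto simp: power2_eq_square)
  also have "\<dots> = p * card S + (p * card S)\<^sup>2"
    using finS by (simp add: sum.distrib power2_eq_square algebra_simps)
  finally show ?thesis .
qed

text \<open>Chebyshev's inequality; the variance is at most the mean.\<close>

lemma prob_card_deviation:
  assumes S: "S \<subseteq> \<Omega>" and a: "0 < a"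
  shows "measure_pmf.prob (random_subset \<Omega> p) {E. a \<le> \<bar>real (card (E \<inter> S)) - p * card S\<bar>} \<le> p * card S / a\<^sup>2"
proof -
  let ?M = "measure_pmf (random_subset \<Omega> p)"
  let ?X = "\<lambda>E. real (card (E \<inter> S))" and ?\<mu> = "p * card S"
  have "{E. a \<le> \<bar>?X E - ?\<mu>\<bar>} = {E. a\<^sup>2 \<le> (?X E - ?\<mu>)\<^sup>2}"
    using a by (auto simp: abs_le_square_iff[symmetric])
  then have "measure ?M {E. a \<le> \<bar>?X E - ?\<mu>\<bar>} \<le> measure_pmf.expectation (random_subset \<Omega> p) (\<lambda>E. (?X E - ?\<mu>)\<^sup>2) / a\<^sup>2"
    using pmf_markov[OF finite_set_random_subset, of "\<lambda>E. (?X E - ?\<mu>)\<^sup>2" "a\<^sup>2"] a by simp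
  also have "measure_pmf.expectation (random_subset \<Omega> p) (\<lambda>E. (?X E - ?\<mu>)\<^sup>2)
      = measure_pmf.expectation (random_subset \<Omega> p) (\<lambda>E. (?X E)\<^sup>2 - 2 * ?\<mu> * ?X E + ?\<mu>\<^sup>2)"
    by (intro arg_cong[where f="measure_pmf.expectation _"]) (auto simp: power2_eq_square algebra_simps)
  also have "\<dots> = measure_pmf.expectation (random_subset \<Omega> p) (\<lambda>E. (?X E)\<^sup>2) - 2 * ?\<mu> * ?\<mu> + ?\<mu>\<^sup>2"
    by (simp add: integrable_random_subset expectation_card_Int[OF S])
  also have "\<dots> \<le> ?\<mu>"
  proof -
    have "?\<mu>\<^sup>2 = ?\<mu> * ?\<mu>" by (rule power2_eq_square)
    then show ?thesis using expectation_card_Int_square[OF S] by linarith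
  qed
  finally show ?thesis by (simp add: divide_right_mono)
qed

end

text \<open>Keep each element with probability \<open>q\<close> and delete one element from every surviving member of the family.\<close>

lemma ex_independent_subset:
  fixes E :: "'a set" and q :: real
  assumes E: "finite E" and \<X>: "\<And>A. A \<in> \<X> \<Longrightarrow> A \<subseteq> E \<and> card A = k" and k: "k \<ge> 1" and q: "0 \<le> q" "q \<le> 1"
  shows "\<exists>E'\<subseteq>E. (\<forall>A\<in>\<X>. \<not> A \<subseteq> E') \<and> q * card E - q ^ k * card \<X> \<le> card E'"
proof -
  have fin\<X>: "finite \<X>" using \<X> E by (intro finite_subset[of \<X> "Pow E"]) auto
  let ?f = "\<lambda>S. real (card (S \<inter> E)) - real (card {A \<in> \<X>. A \<subseteq> S})"
  have ex: "measure_pmf.expectation (random_subset E q) ?f = q * card E - q ^ k * card \<X>"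
    using expectation_card_Int[OF E q, of E] expectation_card_family[OF E q fin\<X>] \<X>
    by (simp add: integrable_random_subset[OF E q])
  have "\<exists>S\<in>Pow E. measure_pmf.expectation (random_subset E q) ?f \<le> ?f S"
  proof -
    define c where "c = Max (?f ` Pow E)"
    have le: "?f S \<le> c" if "S \<in> Pow E" for S unfolding c_def using E that by (intro Max_ge) auto
    have "c \<in> ?f ` Pow E" unfolding c_def using E by (intro Max_in) auto
    then obtain S where S: "S \<in> Pow E" "?f S = c" by auto
    have "measure_pmf.expectation (random_subset E q) ?f \<le> measure_pmf.expectation (random_subset E q) (\<lambda>_. c)"
      using le set_random_subset[OF E q]
      by (intro integral_mono_AE integrable_random_subset[OF E q]) (auto simp: AE_measure_pmf_iff)
    also have "\<dots> = c" by simp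
    finally show ?thesis using S by (intro bexI[of _ S]) auto
  qed
  then obtain S where S: "S \<subseteq> E" "q * card E - q ^ k * card \<X> \<le> ?f S" unfolding ex by auto
  have finS: "finite S" using S E finite_subset by auto
  have ne: "\<exists>x. x \<in> A" if "A \<in> \<X>" for A
  proof -
    have "card A \<noteq> 0" using \<X>[OF that] k by simp
    then have "A \<noteq> {}" by auto
    then show ?thesis by blast
  qed
  define pick where "pick A = (SOME x. x \<in> A)" for A :: "'a set"
  have pick: "pick A \<in> A" if "A \<in> \<X>" for A unfolding pick_def using someI_ex[OF ne[OF that]] .
  define S' where "S' = S - pick ` {A \<in> \<X>. A \<subseteq> S}"
  have "card S - card (pick ` {A \<in> \<X>. A \<subseteq> S}) \<le> card S'"
    unfolding S'_def using fin\<X> by (intro diff_card_le_card_Diff) auto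
  moreover have "card (pick ` {A \<in> \<X>. A \<subseteq> S}) \<le> card {A \<in> \<X>. A \<subseteq> S}" using fin\<X> by (intro card_image_le) auto
  ultimately have "?f S \<le> card S'" using S(1) by (simp add: Int_absorb2)
  moreover have "\<not> A \<subseteq> S'" if "A \<in> \<X>" for A using pick[OF that] that by (auto simp: S'_def)
  moreover have "S' \<subseteq> E" using S by (auto simp: S'_def)
  ultimately show ?thesis using S(2) by (intro exI[of _ S']) auto
qed

section \<open>The random Turan problem\<close>

lemma ex_num_finite:
  assumes "finite (edges G)"
  shows "finite {card (edges H) |H. subhypergraph H G \<and> \<not> contains_copy H F}"
proof (rule finite_subset)
  show "{card (edges H) |H. subhypergraph H G \<and> \<not> contains_copy H F} \<subseteq> {..card (edges G)}"
    using card_mono[OF assms] by (auto simp: subhypergraph_def)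
qed auto

lemma ex_num_ge:
  assumes "finite (edges G)" "subhypergraph H G" "\<not> contains_copy H F"
  shows "card (edges H) \<le> ex_num G F"
  unfolding ex_num_def by (rule Max_ge[OF ex_num_finite[OF assms(1)]]) (use assms(2,3) in blast)

lemma ex_num_attained:
  assumes "finite (edges G)" "edges F \<noteq> {}"
  obtains H where "subhypergraph H G" "\<not> contains_copy H F" "card (edges H) = ex_num G F"
proof -
  let ?S = "{card (edges H) |H. subhypergraph H G \<and> \<not> contains_copy H F}"
  have "subhypergraph (verts G, {}) G \<and> \<not> contains_copy (verts G, {}) F"
    using assms(2) by (auto simp: subhypergraph_def contains_copy_def)
  then have "?S \<noteq> {}" by blast
  then have "ex_num G F \<in> ?S" unfolding ex_num_def by (intro Max_in ex_num_finite assms(1))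
  then show thesis using that by auto
qed

lemma copies_empty_iff:
  assumes E: "E \<subseteq> rsets r n" and nc: "\<And>A. A \<in> copies n F \<Longrightarrow> \<not> A \<subseteq> E"
  shows "\<not> contains_copy ({..<n}, E) F"
proof
  assume "contains_copy ({..<n}, E) F"
  then obtain f where f: "inj_on f (verts F)" "f ` verts F \<subseteq> {..<n}" "\<forall>e\<in>edges F. f ` e \<in> E"
    by (auto simp: contains_copy_def)
  then have "(\<lambda>e. f ` e) ` edges F \<in> copies n F" unfolding copies_def by blast
  then show False using nc f(3) by blast
qed

text \<open>\<open>H\<close> may have fewer vertices than the host. The embedding still maps into
  \<open>verts H\<close> because every vertex of \<open>F\<close> lies in an edge.\<close>

lemma no_copies_subset:
  assumes cov: "\<Union>(edges F) = verts F" and H: "subhypergraph H ({..<n}, E)" "\<not> contains_copy H F"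
    and A: "A \<in> copies n F"
  shows "\<not> A \<subseteq> edges H"
proof
  assume AH: "A \<subseteq> edges H"
  obtain h where h: "inj_on h (verts F)" "A = (\<lambda>e. h ` e) ` edges F" using A by (auto simp: copies_def)
  have he: "h ` e \<in> edges H" if "e \<in> edges F" for e using AH h(2) that by auto
  have "h ` verts F \<subseteq> verts H"
  proof
    fix y assume "y \<in> h ` verts F"
    then obtain v where v: "y = h v" "v \<in> \<Union>(edges F)" unfolding cov by (rule imageE)
    then obtain e where e: "v \<in> e" "e \<in> edges F" by (elim UnionE)
    have "h ` e \<subseteq> verts H" using he[OF e(2)] H(1) unfolding subhypergraph_def by blast
    then show "y \<in> verts H" using v(1) e(1) by blast
  qed
  then show False using H(2) h(1) he by (auto simp: contains_copy_def)
qed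

lemma Union_expansion:
  assumes "\<Union>(edges G) = verts G"
  shows "\<Union>(edges (expansion r G)) = verts (expansion r G)"
  unfolding expansion_def assms[symmetric] by auto

lemma card_edges_expansion: "card (edges (expansion r G)) = card (edges G)"
proof -
  have "inj_on (\<lambda>e. Inl ` e \<union> Inr ` ({e} \<times> {..<r - 2})) (edges G)"
  proof (rule inj_onI)
    fix e e' assume "Inl ` e \<union> Inr ` ({e} \<times> {..<r - 2}) = Inl ` e' \<union> Inr ` ({e'} \<times> {..<r - 2})"
    then have "Inl -` (Inl ` e \<union> Inr ` ({e} \<times> {..<r - 2})) = Inl -` (Inl ` e' \<union> Inr ` ({e'} \<times> {..<r - 2}))" by simp
    then show "e = e'" by (simp add: vimage_Un inj_vimage_image_eq) (auto simp: set_eq_iff)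
  qed
  then show ?thesis by (simp add: expansion_def card_image)
qed

lemma card_verts_expansion:
  assumes "finite (verts G)" "finite (edges G)"
  shows "card (verts (expansion r G)) = card (verts G) + card (edges G) * (r - 2)"
  unfolding expansion_def fst_conv using assms
  by (subst card_Un_disjoint) (auto simp: card_image card_cartesian_product)

lemma copies_props:
  assumes F: "is_rgraph r F" and A: "A \<in> copies n F"
  shows "A \<subseteq> rsets r n" "card A = card (edges F)"
proof -
  obtain h where h: "inj_on h (verts F)" "h ` verts F \<subseteq> {..<n}" "A = (\<lambda>e. h ` e) ` edges F"
    using A by (auto simp: copies_def)
  have e: "e \<subseteq> verts F \<and> card e = r" if "e \<in> edges F" for e using F that by (auto simp: is_rgraph_def)
  show "A \<subseteq> rsets r n"
  proof
    fix a assume "a \<in> A"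
    then obtain e' where e': "e' \<in> edges F" "a = h ` e'" using h(3) by auto
    have "card (h ` e') = r" using e[OF e'(1)] h(1) by (metis card_image inj_on_subset)
    moreover have "h ` e' \<subseteq> {..<n}" using e[OF e'(1)] h(2) by blast
    ultimately show "a \<in> rsets r n" using e' by (simp add: rsets_def)
  qed
  have "inj_on (\<lambda>e. h ` e) (edges F)"
    using e h(1) by (intro inj_onI) (metis inj_on_image_eq_iff)
  then show "card A = card (edges F)" by (simp add: h(3) card_image)
qed

lemma card_copies_le:
  assumes F: "is_rgraph r F"
  shows "finite (copies n F)" "card (copies n F) \<le> n ^ card (verts F)"
proof -
  have fin: "finite (verts F)" using F by (simp add: is_rgraph_def)
  let ?P = "PiE (verts F) (\<lambda>_. {..<n})"
  have finP: "finite ?P" by (rule finite_PiE[OF fin]) auto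
  have sub: "copies n F \<subseteq> (\<lambda>h. (\<lambda>e. h ` e) ` edges F) ` ?P"
  proof
    fix A assume "A \<in> copies n F"
    then obtain h where h: "h ` verts F \<subseteq> {..<n}" "A = (\<lambda>e. h ` e) ` edges F" by (auto simp: copies_def)
    have hr: "h ` e = restrict h (verts F) ` e" if "e \<in> edges F" for e
    proof (rule image_cong[OF refl])
      fix y assume "y \<in> e"
      then have "y \<in> verts F" using F that unfolding is_rgraph_def by blast
      then show "h y = restrict h (verts F) y" by simp
    qed
    have "A = (\<lambda>e. restrict h (verts F) ` e) ` edges F"
      unfolding h(2) by (rule image_cong[OF refl hr])
    moreover have "restrict h (verts F) \<in> ?P" using h(1) by auto
    ultimately show "A \<in> (\<lambda>h. (\<lambda>e. h ` e) ` edges F) ` ?P" by (rule image_eqI)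
  qed
  show "finite (copies n F)" by (rule finite_subset[OF sub]) (simp add: finP)
  have "card (copies n F) \<le> card ((\<lambda>h. (\<lambda>e. h ` e) ` edges F) ` ?P)" by (rule card_mono[OF _ sub]) (simp add: finP)
  also have "\<dots> \<le> card ?P" by (rule card_image_le[OF finP])
  also have "\<dots> = n ^ card (verts F)" by (simp add: card_PiE[OF fin])
  finally show "card (copies n F) \<le> n ^ card (verts F)" .
qed

lemma disjoint_expanded_edges:
  "f \<inter> g = {} \<Longrightarrow> f \<noteq> {} \<Longrightarrow> (Inl ` f \<union> Inr ` ({f} \<times> I)) \<inter> (Inl ` g \<union> Inr ` ({g} \<times> I)) = {}"
  by auto

section \<open>Edges through one vertex\<close>

definition star :: "nat \<Rightarrow> nat \<Rightarrow> nat set set" where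
  "star r n = {e \<in> rsets r n. 0 \<in> e}"

lemma card_star_ge:
  assumes "1 \<le> r" "1 \<le> n"
  shows "(n - 1) choose (r - 1) \<le> card (star r n)"
proof -
  have "card {T. T \<subseteq> {1..<n} \<and> card T = r - 1} \<le> card (star r n)"
  proof (rule card_inj_on_le[where f="insert 0"])
    show "inj_on (insert 0) {T. T \<subseteq> {1..<n} \<and> card T = r - 1}"
    proof (rule inj_onI)
      fix T T' :: "nat set" assume *: "T \<in> {T. T \<subseteq> {1..<n} \<and> card T = r - 1}" "T' \<in> {T. T \<subseteq> {1..<n} \<and> card T = r - 1}"
        "insert 0 T = insert 0 T'"
      then have "0 \<notin> T" "0 \<notin> T'" by auto
      then show "T = T'" using *(3) by (metis insert_ident)
    qed
    show "insert 0 ` {T. T \<subseteq> {1..<n} \<and> card T = r - 1} \<subseteq> star r n"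
    proof (rule image_subsetI)
      fix T assume T: "T \<in> {T. T \<subseteq> {1..<n} \<and> card T = r - 1}"
      then have "finite T" "0 \<notin> T" by (auto intro: finite_subset)
      then show "insert 0 T \<in> star r n" using T assms by (auto simp: star_def rsets_def)
    qed
    show "finite (star r n)" using finite_rsets by (simp add: star_def)
  qed
  then show ?thesis using n_subsets[of "{1..<n}" "r - 1"] by simp
qed

section \<open>Extremal numbers of random subfamilies\<close>

locale kst_turan = kst_exponents +
  fixes r :: nat
  assumes rst: "s + 1 \<le> t \<and> s + 1 \<le> r \<or> s + 2 \<le> r"
begin

definition F where "F = expansion r (complete_bipartite s t)"
definition v where "v = s + t + (r - 2) * (s * t)"
definition p0 :: "nat \<Rightarrow> real" where "p0 n = real n powr (- real r + 2 - x)"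

abbreviation "ex n E \<equiv> ex_num ({..<n}, E) F"
abbreviation "X n E \<equiv> card {A \<in> copies n F. A \<subseteq> E}"

lemma r3: "3 \<le> r" using rst s2 st by auto

lemma F_props: "is_rgraph r F" "\<Union>(edges F) = verts F" "card (edges F) = s * t" "card (verts F) = v" "edges F \<noteq> {}"
proof -
  have s1: "1 \<le> s" "1 \<le> t" using s2 st by auto
  show "is_rgraph r F" unfolding F_def using r3 by (intro is_rgraph_expansion is_rgraph_complete_bipartite) auto
  show "\<Union>(edges F) = verts F" unfolding F_def by (intro Union_expansion Union_complete_bipartite s1)
  show cE: "card (edges F) = s * t" by (simp add: F_def card_edges_expansion card_complete_bipartite)
  have "finite (verts (complete_bipartite s t))" "finite (edges (complete_bipartite s t))"
    by (simp_all add: complete_bipartite_simps)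
  then show "card (verts F) = v" by (simp add: F_def card_verts_expansion card_complete_bipartite v_def mult.commute)
  show "edges F \<noteq> {}" using cE s1 by auto
qed

text \<open>As \<open>s\<close> and \<open>t\<close> are at least 2, the bipartite graph has two
  disjoint edges. Their expansions are disjoint as well, so they cannot both pass through vertex
  0.\<close>

lemma copy_not_star: "A \<in> copies n F \<Longrightarrow> \<not> A \<subseteq> star r n"
proof
  assume A: "A \<in> copies n F" "A \<subseteq> star r n"
  obtain h where h: "inj_on h (verts F)" "A = (\<lambda>e. h ` e) ` edges F" using A by (auto simp: copies_def)
  define e where "e i = (Inl ` {Inl i, Inr i} \<union> Inr ` ({{Inl i, Inr i}} \<times> {..<r - 2}) ::
    ((nat + nat) + (nat + nat) set \<times> nat) set)" for i :: nat
  have ed: "e i \<in> edges F" if "i < 2" for i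
  proof -
    have "{Inl i, Inr i} \<in> edges (complete_bipartite s t)"
      unfolding complete_bipartite_simps using that s2 st by (intro image_eqI[of _ _ "(i, i)"]) auto
    then show ?thesis unfolding F_def expansion_def e_def snd_conv by (rule imageI)
  qed
  have disj: "e 0 \<inter> e 1 = {}" unfolding e_def by (rule disjoint_expanded_edges) simp_all
  have sub: "e i \<subseteq> verts F" if "i < 2" for i using F_props(2) ed[OF that] by blast
  have "h ` e 0 \<inter> h ` e 1 = h ` (e 0 \<inter> e 1)"
    by (rule inj_on_image_Int[OF h(1), symmetric]) (use sub in simp_all)
  moreover have z: "0 \<in> h ` e i" if "i < 2" for i
  proof -
    have "h ` e i \<in> star r n" using A(2) ed[OF that] unfolding h(2) by blast
    then show ?thesis by (simp add: star_def)
  qed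
  moreover have "0 \<in> h ` e 0 \<inter> h ` e 1" using z[of 0] z[of 1] by simp
  ultimately show False using disj by simp
qed

lemma finE: "E \<subseteq> rsets r n \<Longrightarrow> finite E" by (rule finite_subset[OF _ finite_rsets])

lemma ex_ge:
  assumes E: "E \<subseteq> rsets r n" "E' \<subseteq> E" "\<And>A. A \<in> copies n F \<Longrightarrow> \<not> A \<subseteq> E'"
  shows "card E' \<le> ex n E"
proof -
  have E': "E' \<subseteq> rsets r n" using E by auto
  have "subhypergraph ({..<n}, E') ({..<n}, E)"
    using E by (auto simp: subhypergraph_def rsets_def)
  then show ?thesis
    using ex_num_ge[of "({..<n}, E)" "({..<n}, E')" F] copies_empty_iff[where F=F, OF E' E(3)] finE[OF E(1)] by simp
qed

lemma ex_star:
  assumes "E \<subseteq> rsets r n" shows "card (E \<inter> star r n) \<le> ex n E"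
proof (rule ex_ge[OF assms])
  show "\<not> A \<subseteq> E \<inter> star r n" if "A \<in> copies n F" for A using copy_not_star[OF that] by auto
qed auto

text \<open>The thinning probability \<open>q\<close> is the free parameter: deletion alone, with
  \<open>q = 1\<close>, is efficient when copies are rarer than edges, and above \<open>p0\<close>
  one first thins to a density slightly below it.\<close>

lemma ex_deletion:
  fixes q :: real
  assumes E: "E \<subseteq> rsets r n" and q: "0 \<le> q" "q \<le> 1"
  shows "q * card E - q ^ (s * t) * X n E \<le> ex n E"
proof -
  have k: "1 \<le> s * t" using s2 st by (simp add: Suc_le_eq)
  have "\<exists>E'\<subseteq>E. (\<forall>A\<in>{A \<in> copies n F. A \<subseteq> E}. \<not> A \<subseteq> E') \<and> q * card E - q ^ (s * t) * X n E \<le> card E'"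
  proof (rule ex_independent_subset)
    show "finite E" "1 \<le> s * t" "0 \<le> q" "q \<le> 1" using finE[OF E] k q by auto
    show "A \<subseteq> E \<and> card A = s * t" if "A \<in> {A \<in> copies n F. A \<subseteq> E}" for A
      using that copies_props(2)[OF F_props(1), of A n] F_props(3) by simp
  qed
  then obtain E' where E': "E' \<subseteq> E" "\<forall>A\<in>{A \<in> copies n F. A \<subseteq> E}. \<not> A \<subseteq> E'"
    "q * card E - q ^ (s * t) * X n E \<le> card E'" by blast
  have "card E' \<le> ex n E" by (rule ex_ge[OF E E'(1)]) (use E' in blast)
  then show ?thesis using E'(3) by linarith
qed

lemma ex_attained:
  assumes E: "E \<subseteq> rsets r n"
  obtains E' where "E' \<subseteq> E" "\<And>A. A \<in> copies n F \<Longrightarrow> \<not> A \<subseteq> E'" "card E' = ex n E"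
proof -
  obtain H where H: "subhypergraph H ({..<n}, E)" "\<not> contains_copy H F" "card (edges H) = ex n E"
    using ex_num_attained[of "({..<n}, E)" F] finE[OF E] F_props(5) by auto
  show thesis
  proof (rule that)
    show "edges H \<subseteq> E" using H(1) by (simp add: subhypergraph_def)
    show "\<not> A \<subseteq> edges H" if "A \<in> copies n F" for A
      by (rule no_copies_subset[OF F_props(2) H(1,2) that])
  qed (rule H(3))
qed

lemma ex_le_card: "E \<subseteq> rsets r n \<Longrightarrow> ex n E \<le> card E"
  using ex_attained[of E n] card_mono[OF finE] by metis

text \<open>\<open>p0\<close> is the density at which the upper bound
  \<open>p ^ (s * t) * n ^ v\<close> for the expected number of copies agrees with the order
  \<open>p * n ^ r\<close> of the number of edges. Behind the second identity is
  \<open>(s * t - 1) * x = s + t - 2\<close>.\<close>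

lemma p0_identities:
  assumes "2 \<le> n"
  shows "p0 n * real n ^ r = real n powr (2 - x)" "p0 n ^ (s * t) * real n ^ v = real n powr (2 - x)"
    "p0 n * real n ^ (r - 1) = real n powr (1 - x)" "0 < p0 n"
proof -
  have n: "0 < real n" using assms by simp
  show "0 < p0 n" using n by (simp add: p0_def)
  show "p0 n * real n ^ r = real n powr (2 - x)"
    using n by (simp add: p0_def powr_realpow[symmetric] powr_add[symmetric])
  show "p0 n * real n ^ (r - 1) = real n powr (1 - x)"
    using n r3 by (simp add: p0_def powr_realpow[symmetric] powr_add[symmetric] of_nat_diff)
  have "real (s * t) * (- real r + 2 - x) + real v = 2 - x"
  proof -
    have "real v = real s + real t + (real r - 2) * (real s * real t)" using r3 by (simp add: v_def of_nat_diff)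
    moreover have "real s * real t * x = x + (real s + real t - 2)" using scaled(1) by (simp add: N_def algebra_simps)
    ultimately show ?thesis by (simp add: algebra_simps)
  qed
  moreover have "p0 n ^ (s * t) = real n powr (real (s * t) * (- real r + 2 - x))"
    using n by (simp add: p0_def powr_realpow[symmetric] powr_powr mult.commute)
  ultimately show "p0 n ^ (s * t) * real n ^ v = real n powr (2 - x)"
    using n by (simp add: powr_realpow[symmetric] powr_add[symmetric])
qed

lemma prob_bad_le:
  assumes sub: "\<And>E. E \<subseteq> rsets r n \<Longrightarrow> E \<notin> \<Union>(set Bs) \<Longrightarrow> A E"
  shows "measure_pmf.prob (random_subset (rsets r n) p) {E. \<not> A E}
    \<le> (\<Sum>B\<leftarrow>Bs. measure_pmf.prob (random_subset (rsets r n) p) B)"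
proof -
  let ?M = "random_subset (rsets r n) p"
  have "set_pmf ?M \<subseteq> Pow (rsets r n)" by (auto simp: random_subset_def)
  then have "{E. \<not> A E} \<inter> set_pmf ?M \<subseteq> \<Union>(set Bs)" using sub by blast
  then have "measure_pmf.prob ?M ({E. \<not> A E} \<inter> set_pmf ?M) \<le> measure_pmf.prob ?M (\<Union>(set Bs))"
    by (intro measure_pmf.finite_measure_mono) auto
  also have "\<dots> \<le> (\<Sum>B\<leftarrow>Bs. measure_pmf.prob ?M B)"
  proof (induction Bs)
    case (Cons B Bs)
    have "measure_pmf.prob ?M (\<Union>(set (B # Bs))) \<le> measure_pmf.prob ?M B + measure_pmf.prob ?M (\<Union>(set Bs))"
      using measure_Un_le[of B "measure_pmf ?M" "\<Union>(set Bs)"] by simp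
    then show ?case using Cons by simp
  qed simp
  finally show ?thesis by (simp add: measure_Int_set_pmf)
qed

lemma aasI:
  assumes p: "\<And>n. 0 < p n \<and> p n \<le> (1::real)" and \<epsilon>: "e \<longlonglongrightarrow> 0"
    and bad: "\<forall>\<^sub>F n in sequentially. measure_pmf.prob (random_subset (rsets r n) (p n)) {E. \<not> A n ({..<n}, E)} \<le> e n"
  shows "aas (\<lambda>n. random_rgraph r n (p n)) A"
proof -
  have eq: "measure_pmf.prob (random_rgraph r n (p n)) {G. A n G}
      = 1 - measure_pmf.prob (random_subset (rsets r n) (p n)) {E. \<not> A n ({..<n}, E)}" for n
  proof -
    have "measure_pmf.prob (random_rgraph r n (p n)) {G. A n G} = measure_pmf.prob (random_subset (rsets r n) (p n)) {E. A n ({..<n}, E)}"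
      by (simp add: random_rgraph_eq vimage_def)
    also have "{E. A n ({..<n}, E)} = UNIV - {E. \<not> A n ({..<n}, E)}" by auto
    finally show ?thesis
      using measure_pmf.prob_compl[of "{E. \<not> A n ({..<n}, E)}" "random_subset (rsets r n) (p n)"] by simp
  qed
  have lim: "(\<lambda>n. 1 - e n) \<longlonglongrightarrow> 1" using tendsto_diff[OF tendsto_const \<epsilon>, of 1] by simp
  show ?thesis
    unfolding aas_def
  proof (rule tendsto_sandwich[OF _ _ lim tendsto_const])
    show "\<forall>\<^sub>F n in sequentially. 1 - e n \<le> measure_pmf.prob (random_rgraph r n (p n)) {G. A n G}"
      using bad by eventually_elim (simp add: eq)
  qed simp
qed

lemma choose_ge:
  assumes "r \<le> n"
  shows "real n ^ r \<le> real (r ^ r) * (n choose r)"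
proof -
  have "(real n / real r) ^ r \<le> real (n choose r)" using binomial_ge_n_over_k_pow_k[OF assms, where 'a=real] by simp
  then show ?thesis using r3 by (simp add: power_divide field_simps)
qed

lemma star_ge:
  assumes "r \<le> n"
  shows "real n ^ (r - 1) \<le> (2 * real r) ^ (r - 1) * card (star r n)"
proof -
  have n: "2 \<le> n" "1 \<le> n" "r - 1 \<le> n - 1" using assms r3 by auto
  have r2: "0 < real (r - 1)" using r3 by simp
  have "real n \<le> 2 * real (n - 1)" using n by (simp add: of_nat_diff)
  also have "\<dots> \<le> 2 * (real r * (real (n - 1) / real (r - 1)))"
  proof -
    have "real (r - 1) * real (n - 1) \<le> real r * real (n - 1)" by (intro mult_right_mono) auto
    then have "real (n - 1) \<le> real r * (real (n - 1) / real (r - 1))" using r2 by (simp add: field_simps)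
    then show ?thesis by simp
  qed
  finally have "real n ^ (r - 1) \<le> (2 * real r * (real (n - 1) / real (r - 1))) ^ (r - 1)" by (intro power_mono) auto
  also have "\<dots> = (2 * real r) ^ (r - 1) * (real (n - 1) / real (r - 1)) ^ (r - 1)" by (rule power_mult_distrib)
  also have "\<dots> \<le> (2 * real r) ^ (r - 1) * real ((n - 1) choose (r - 1))"
    using binomial_ge_n_over_k_pow_k[OF n(3), where 'a=real] by (intro mult_left_mono) auto
  also have "\<dots> \<le> (2 * real r) ^ (r - 1) * card (star r n)"
    using card_star_ge[of r n] r3 n by (intro mult_left_mono) auto
  finally show ?thesis .
qed

lemma prob_copies:
  fixes p c :: real
  assumes p: "0 < p" "p \<le> 1" and c: "0 < c"
  shows "measure_pmf.prob (random_subset (rsets r n) p) {E. c \<le> X n E} \<le> p ^ (s * t) * real n ^ v / c"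
proof -
  have p': "0 \<le> p" "p \<le> 1" using p by auto
  have fc: "finite (copies n F)" by (rule card_copies_le[OF F_props(1)])
  have "measure_pmf.prob (random_subset (rsets r n) p) {E. c \<le> X n E}
      \<le> measure_pmf.expectation (random_subset (rsets r n) p) (\<lambda>E. real (X n E)) / c"
  proof (rule pmf_markov)
    show "finite (set_pmf (random_subset (rsets r n) p))" by (rule finite_set_random_subset[OF finite_rsets p'])
  qed (use c in auto)
  also have "measure_pmf.expectation (random_subset (rsets r n) p) (\<lambda>E. real (X n E)) = (\<Sum>A\<in>copies n F. p ^ card A)"
    by (rule expectation_card_family[OF finite_rsets p' fc]) (rule copies_props(1)[OF F_props(1)])
  also have "\<dots> = card (copies n F) * p ^ (s * t)"
    using copies_props(2)[OF F_props(1)] F_props(3) by simp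
  also have "\<dots> \<le> real n ^ v * p ^ (s * t)"
  proof (rule mult_right_mono)
    have "card (copies n F) \<le> n ^ v" using card_copies_le(2)[OF F_props(1), of n] F_props(4) by simp
    then show "real (card (copies n F)) \<le> real n ^ v" by (metis of_nat_le_iff of_nat_power)
  qed (use p in auto)
  finally show ?thesis using c by (simp add: divide_right_mono mult.commute)
qed

section \<open>Upper bound by a union over containers\<close>

text \<open>The exceptional event \<open>B\<close> is explicit so that it can be joined with those
  of the lower bound, and every \<open>C \<ge> C0\<close> is allowed so that a single
  \<open>C\<close> can serve both bounds.\<close>

lemma upper_bound:
  "\<exists>C0>0. \<forall>C\<ge>C0. \<forall>p :: nat \<Rightarrow> real. (\<forall>n. 0 < p n \<and> p n \<le> 1) \<longrightarrow> (\<forall>\<^sub>F n in sequentially. \<exists>B.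
      measure_pmf.prob (random_subset (rsets r n) (p n)) B \<le> exp (- (n / 8)) \<and>
      (\<forall>E. E \<subseteq> rsets r n \<longrightarrow> E \<notin> B \<longrightarrow>
        real (ex n E) \<le> max (C * p n * real n ^ (r - 1)) (real n powr (2 - x) * ln (real n) powr C)))"
proof -
  obtain C1 where C1: "\<forall>\<^sub>F n in sequentially. \<exists>\<C>. finite \<C> \<and>
    real (card \<C>) \<le> exp (n powr (2 - x) * ln n ^ C1) \<and>
    (\<forall>C\<in>\<C>. C \<subseteq> rsets r n \<and> card C \<le> 2 * (clean_const r s t + 1) * n ^ (r - 1)) \<and>
    (\<forall>G. G \<subseteq> rsets r n \<and> (\<forall>A\<in>copies n F. \<not> A \<subseteq> G) \<longrightarrow> (\<exists>C\<in>\<C>. G \<subseteq> C))"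
    using containers_kst[OF s2 st rst] unfolding F_def by auto
  define K where "K = real (2 * (clean_const r s t + 1))"
  have K: "0 < K" by (simp add: K_def)
  show ?thesis
  proof (intro exI[of _ "4 * K + C1 + 1"] conjI allI impI)
    show "0 < 4 * K + real C1 + 1" using K by simp
    fix C :: real and p :: "nat \<Rightarrow> real"
    assume C: "4 * K + real C1 + 1 \<le> C" and p: "\<forall>n. 0 < p n \<and> p n \<le> 1"
    have "\<forall>\<^sub>F n::nat in sequentially. 8 \<le> ln (real n)" by real_asymp
    moreover have "\<forall>\<^sub>F n::nat in sequentially. 2 \<le> n" by (rule eventually_ge_at_top)
    ultimately show "\<forall>\<^sub>F n in sequentially. \<exists>B.
      measure_pmf.prob (random_subset (rsets r n) (p n)) B \<le> exp (- (n / 8)) \<and>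
      (\<forall>E. E \<subseteq> rsets r n \<longrightarrow> E \<notin> B \<longrightarrow>
        real (ex n E) \<le> max (C * p n * real n ^ (r - 1)) (real n powr (2 - x) * ln (real n) powr C))"
      using C1
    proof eventually_elim
      case (elim n)
      then obtain \<C> where \<C>: "finite \<C>" "real (card \<C>) \<le> exp (n powr (2 - x) * ln n ^ C1)"
        "\<And>D. D \<in> \<C> \<Longrightarrow> D \<subseteq> rsets r n \<and> card D \<le> 2 * (clean_const r s t + 1) * n ^ (r - 1)"
        "\<And>G. G \<subseteq> rsets r n \<and> (\<forall>A\<in>copies n F. \<not> A \<subseteq> G) \<Longrightarrow> \<exists>D\<in>\<C>. G \<subseteq> D"
        by metis
      have pn: "0 \<le> p n" "p n \<le> 1" using p[rule_format, of n] by auto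
      have n: "1 \<le> real n" using elim by simp
      define T where "T = max (C * p n * real n ^ (r - 1)) (real n powr (2 - x) * ln (real n) powr C)"
      define a where "a = real n powr (2 - x) * ln (real n) ^ C1"
      have yn: "real n \<le> real n powr (2 - x)"
        using powr_mono[of 1 "2 - x" "real n"] n exponents(7) by simp
      have lC: "8 * ln (real n) ^ C1 \<le> ln (real n) powr C"
      proof -
        have "8 * ln (real n) ^ C1 \<le> ln (real n) * ln (real n) ^ C1" using elim by (intro mult_right_mono) auto
        also have "\<dots> = ln (real n) powr (real C1 + 1)" using elim by (simp add: powr_add powr_realpow)
        also have "\<dots> \<le> ln (real n) powr C" using elim C K by (intro powr_mono) auto
        finally show ?thesis .
      qed
      \<comment> \<open>\<open>C\<close> exceeds \<open>C1\<close> by at least 1. The spare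
        logarithm makes the number \<open>exp a\<close> of containers negligible against the tail
        probability \<open>exp (- T / 4)\<close> of each.\<close>
      have aT: "8 * a \<le> T"
      proof -
        have "real n powr (2 - x) * (8 * ln (real n) ^ C1) \<le> real n powr (2 - x) * ln (real n) powr C"
          by (intro mult_left_mono lC) auto
        then show ?thesis by (simp add: a_def T_def mult_ac)
      qed
      have nT: "real n \<le> T"
      proof -
        have "1 \<le> ln (real n) powr C" using elim C K by (intro ge_one_powr_ge_zero) auto
        then have "real n * 1 \<le> real n powr (2 - x) * ln (real n) powr C" using yn by (intro mult_mono) auto
        then show ?thesis by (simp add: T_def)
      qed
      have KT: "4 * (p n * (K * real n ^ (r - 1))) \<le> T"
      proof -
        have "(4 * K) * (p n * real n ^ (r - 1)) \<le> C * (p n * real n ^ (r - 1))"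
          using C pn K by (intro mult_right_mono) auto
        then show ?thesis by (simp add: T_def mult_ac)
      qed
      let ?B = "\<Union>D\<in>\<C>. {E. T \<le> real (card (E \<inter> D))}"
      have "measure_pmf.prob (random_subset (rsets r n) (p n)) ?B
          \<le> (\<Sum>D\<in>\<C>. measure_pmf.prob (random_subset (rsets r n) (p n)) {E. T \<le> real (card (E \<inter> D))})"
        using \<C>(1) by (intro measure_UNION_le) auto
      also have "\<dots> \<le> (\<Sum>D\<in>\<C>. exp (T / 4 - T / 2))"
      proof (rule sum_mono)
        fix D assume D: "D \<in> \<C>"
        have "measure_pmf.prob (random_subset (rsets r n) (p n)) {E. T \<le> real (card (E \<inter> D))} \<le> exp (p n * card D - T * ln 2)"
          by (rule prob_card_ge[OF finite_rsets pn]) (use \<C>(3)[OF D] in auto)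
        also have "\<dots> \<le> exp (T / 4 - T / 2)"
        proof -
          have "real (card D) \<le> real (2 * (clean_const r s t + 1) * n ^ (r - 1))"
            using \<C>(3)[OF D] by (simp only: of_nat_le_iff)
          then have "real (card D) \<le> K * real n ^ (r - 1)" by (simp add: K_def algebra_simps)
          then have "p n * card D \<le> p n * (K * real n ^ (r - 1))" using pn by (intro mult_left_mono)
          moreover have "T * (1 / 2) \<le> T * ln 2" using nT ln2_ge_two_thirds by (intro mult_left_mono) auto
          ultimately show ?thesis using KT by simp
        qed
        finally show "measure_pmf.prob (random_subset (rsets r n) (p n)) {E. T \<le> real (card (E \<inter> D))} \<le> exp (T / 4 - T / 2)" .
      qed
      also have "\<dots> = card \<C> * exp (T / 4 - T / 2)" by simp
      also have "\<dots> \<le> exp a * exp (T / 4 - T / 2)" using \<C>(2) by (intro mult_right_mono) (auto simp: a_def)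
      also have "\<dots> = exp (a + (T / 4 - T / 2))" by (rule exp_add[symmetric])
      also have "\<dots> \<le> exp (- (n / 8))" using aT nT by simp
      finally have prob: "measure_pmf.prob (random_subset (rsets r n) (p n)) ?B \<le> exp (- (n / 8))" .
      have "real (ex n E) \<le> T" if E: "E \<subseteq> rsets r n" "E \<notin> ?B" for E
      proof -
        obtain E' where E': "E' \<subseteq> E" "\<And>A. A \<in> copies n F \<Longrightarrow> \<not> A \<subseteq> E'" "card E' = ex n E"
          using ex_attained[OF E(1)] by metis
        have "\<exists>D\<in>\<C>. E' \<subseteq> D" using E' E(1) by (intro \<C>(4)) auto
        then obtain D where D: "D \<in> \<C>" "E' \<subseteq> D" by auto
        have "card E' \<le> card (E \<inter> D)" using finE[OF E(1)] E'(1) D(2) by (intro card_mono) auto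
        moreover have "real (card (E \<inter> D)) < T" using E(2) D(1) by auto
        ultimately show ?thesis using E'(3) by linarith
      qed
      then show ?case using prob unfolding T_def by blast
    qed
  qed
qed

lemma eventually_p0_le:
  assumes p: "\<And>n. 0 < p n \<and> p n \<le> 1" and lim: "p0 \<lless> p"
  shows "\<forall>\<^sub>F n in sequentially. p0 n / p n < 1"
  using order_tendstoD(2)[OF lim[unfolded much_less_def], of 1] by simp

section \<open>The dense regime\<close>

lemma part1:
  "\<exists>c C. c > 0 \<and> C > 0 \<and> (\<forall>p. (\<forall>n. 0 < p n \<and> p n \<le> 1) \<longrightarrow> p0 \<lless> p \<longrightarrow>
      aas (\<lambda>n. random_rgraph r n (p n)) (\<lambda>n G.
        max (c * p n * real n ^ (r - 1)) (real n powr (2 - x) * ln (real n) powr (- C)) \<le> real (ex_num G F) \<and>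
        real (ex_num G F) \<le> max (C * p n * real n ^ (r - 1)) (real n powr (2 - x) * ln (real n) powr C)))"
proof -
  obtain C0 where C0: "0 < C0"
    "\<forall>C\<ge>C0. \<forall>p :: nat \<Rightarrow> real. (\<forall>n. 0 < p n \<and> p n \<le> 1) \<longrightarrow> (\<forall>\<^sub>F n in sequentially. \<exists>B.
      measure_pmf.prob (random_subset (rsets r n) (p n)) B \<le> exp (- (n / 8)) \<and>
      (\<forall>E. E \<subseteq> rsets r n \<longrightarrow> E \<notin> B \<longrightarrow>
        real (ex n E) \<le> max (C * p n * real n ^ (r - 1)) (real n powr (2 - x) * ln (real n) powr C)))"
    using upper_bound by (elim exE conjE) (rule that; assumption)
  \<comment> \<open>The 2 leaves room for the loss \<open>1 / l ^ 2\<close> of the deletion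
    argument.\<close>
  define C where "C = max C0 2"
  define c1 where "c1 = (2 * real r) ^ (r - 1)"
  define c2 where "c2 = real (r ^ r)"
  have c12: "1 \<le> c1" "1 \<le> c2"
    using one_le_power[of "2 * real r" "r - 1"] one_le_power[of "real r" r] r3
    unfolding c1_def c2_def by simp_all
  show ?thesis
  proof (rule exI[of _ "1 / (2 * c1)"], rule exI[of _ C], intro conjI[OF _ conjI] allI impI)
    show "0 < 1 / (2 * c1)" "0 < C" using c12 C0 by (auto simp: C_def)
    fix p :: "nat \<Rightarrow> real"
    assume p': "\<forall>n. 0 < p n \<and> p n \<le> 1" and lim: "p0 \<lless> p"
    then have p: "\<And>n. 0 < p n \<and> p n \<le> 1" by blast
    define w where "w n = p0 n / p n" for n
    have w0: "w \<longlonglongrightarrow> 0" using lim unfolding much_less_def w_def .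
    define e where "e n = exp (- (real n / 8)) + (4 * c1 * w n + (4 * c2 * w n + 1 / ln (real n)))" for n
    have "(\<lambda>n::nat. exp (- (real n / 8))) \<longlonglongrightarrow> 0" "(\<lambda>n::nat. 1 / ln (real n)) \<longlonglongrightarrow> 0"
      by real_asymp+
    then have "e \<longlonglongrightarrow> 0 + (4 * c1 * 0 + (4 * c2 * 0 + 0))"
      unfolding e_def by (intro tendsto_intros w0)
    then have e0: "e \<longlonglongrightarrow> 0" by simp
    have E1: "\<forall>\<^sub>F n::nat in sequentially. 4 * c2 \<le> ln (real n)" by real_asymp
    have E2: "\<forall>\<^sub>F n::nat in sequentially. max 2 r \<le> n" by (rule eventually_ge_at_top)
    have E4: "C0 \<le> C" by (simp add: C_def)
    show "aas (\<lambda>n. random_rgraph r n (p n)) (\<lambda>n G.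
        max (1 / (2 * c1) * p n * real n ^ (r - 1)) (real n powr (2 - x) * ln (real n) powr (- C)) \<le> real (ex_num G F) \<and>
        real (ex_num G F) \<le> max (C * p n * real n ^ (r - 1)) (real n powr (2 - x) * ln (real n) powr C))"
    proof (rule aasI[OF p e0])
      from E1 E2 eventually_p0_le[OF p lim] C0(2)[THEN spec, THEN mp, OF E4, THEN spec, THEN mp, OF p']
      show "\<forall>\<^sub>F n in sequentially. measure_pmf.prob (random_subset (rsets r n) (p n))
        {E. \<not> (max (1 / (2 * c1) * p n * real n ^ (r - 1)) (real n powr (2 - x) * ln (real n) powr (- C)) \<le> real (ex n E) \<and>
          real (ex n E) \<le> max (C * p n * real n ^ (r - 1)) (real n powr (2 - x) * ln (real n) powr C))} \<le> e n"
      proof eventually_elim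
        case (elim n)
        then obtain B1 where B1: "measure_pmf.prob (random_subset (rsets r n) (p n)) B1 \<le> exp (- (n / 8))"
          "\<And>E. E \<subseteq> rsets r n \<Longrightarrow> E \<notin> B1 \<Longrightarrow>
            real (ex n E) \<le> max (C * p n * real n ^ (r - 1)) (real n powr (2 - x) * ln (real n) powr C)"
          by metis
        define l where "l = ln (real n)"
        have l: "4 * c2 \<le> l" "4 \<le> l" using elim(1) c12 by (auto simp: l_def)
        have n: "2 \<le> n" "r \<le> n" "1 \<le> real n" using elim(2) by auto
        have pn: "0 < p n" "0 \<le> p n" "p n \<le> 1" using p[of n] by auto
        have p0p: "0 < p0 n" by (rule p0_identities[OF n(1)])
        have wn: "0 < w n" "w n < 1" "p0 n = w n * p n" using elim(3) p0p pn by (auto simp: w_def)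
        \<comment> \<open>\<open>p0 n * n ^ (r - 1) = n powr (1 - x)\<close> is at least 1 because
          \<open>x \<le> 1\<close>. This bounds the expected edge counts from below by a multiple of
          \<open>1 / w n\<close>, so Chebyshev's error probabilities are of order
          \<open>w n\<close>.\<close>
        have np: "1 \<le> w n * (p n * real n ^ (r - 1))"
        proof -
          have "1 \<le> real n powr (1 - x)" using n exponents(7) by (intro ge_one_powr_ge_zero) auto
          then show ?thesis using p0_identities(3)[OF n(1)] wn(3) by (simp add: mult_ac)
        qed
        define \<mu>1 where "\<mu>1 = p n * card (star r n)"
        define \<mu>2 where "\<mu>2 = p n * card (rsets r n)"
        have m1: "p n * real n ^ (r - 1) \<le> c1 * \<mu>1"
          using mult_left_mono[OF star_ge[OF n(2)] pn(2)] by (simp add: \<mu>1_def c1_def mult_ac)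
        have m2: "p n * real n ^ r \<le> c2 * \<mu>2"
          using mult_left_mono[OF choose_ge[OF n(2)] pn(2)] by (simp add: \<mu>2_def c2_def card_rsets mult_ac)
        have w1: "1 \<le> c1 * w n * \<mu>1"
        proof -
          have "w n * (p n * real n ^ (r - 1)) \<le> w n * (c1 * \<mu>1)" using wn by (intro mult_left_mono m1) auto
          then show ?thesis using np by (simp add: mult_ac)
        qed
        have w2: "1 \<le> c2 * w n * \<mu>2"
        proof -
          have "real n ^ (r - 1) \<le> real n ^ r" using n by (intro power_increasing) auto
          then have "w n * (p n * real n ^ (r - 1)) \<le> w n * (p n * real n ^ r)" using wn pn by (intro mult_left_mono) auto
          also have "\<dots> \<le> w n * (c2 * \<mu>2)" using wn by (intro mult_left_mono m2) auto
          finally show ?thesis using np by (simp add: mult_ac)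
        qed
        have \<mu>: "0 < \<mu>1" "0 < \<mu>2"
        proof -
          have "0 < (c1 * w n) * \<mu>1" "0 < (c2 * w n) * \<mu>2" using w1 w2 by linarith+
          moreover have "0 < c1 * w n" "0 < c2 * w n" using c12 wn by auto
          ultimately show "0 < \<mu>1" "0 < \<mu>2" by (blast intro: zero_less_mult_pos)+
        qed
        define B2 where "B2 = {E. \<mu>1 / 2 \<le> \<bar>real (card (E \<inter> star r n)) - \<mu>1\<bar>}"
        define B3 where "B3 = {E. \<mu>2 / 2 \<le> \<bar>real (card (E \<inter> rsets r n)) - \<mu>2\<bar>}"
        define B4 where "B4 = {E. l * (p n ^ (s * t) * real n ^ v) \<le> X n E}"
        have P2: "measure_pmf.prob (random_subset (rsets r n) (p n)) B2 \<le> 4 * c1 * w n"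
        proof -
          have "measure_pmf.prob (random_subset (rsets r n) (p n)) B2 \<le> \<mu>1 / (\<mu>1 / 2)\<^sup>2"
            unfolding B2_def \<mu>1_def
            by (rule prob_card_deviation[OF finite_rsets pn(2,3)]) (use \<mu> in \<open>auto simp: star_def \<mu>1_def\<close>)
          also have "\<dots> = 4 / \<mu>1" using \<mu> by (simp add: power2_eq_square field_simps)
          also have "\<dots> \<le> 4 * c1 * w n" using w1 \<mu> by (simp add: divide_le_eq mult_ac)
          finally show ?thesis .
        qed
        have P3: "measure_pmf.prob (random_subset (rsets r n) (p n)) B3 \<le> 4 * c2 * w n"
        proof -
          have "measure_pmf.prob (random_subset (rsets r n) (p n)) B3 \<le> \<mu>2 / (\<mu>2 / 2)\<^sup>2"
            unfolding B3_def \<mu>2_def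
            by (rule prob_card_deviation[OF finite_rsets pn(2,3)]) (use \<mu> in \<open>auto simp: \<mu>2_def\<close>)
          also have "\<dots> = 4 / \<mu>2" using \<mu> by (simp add: power2_eq_square field_simps)
          also have "\<dots> \<le> 4 * c2 * w n" using w2 \<mu> by (simp add: divide_le_eq mult_ac)
          finally show ?thesis .
        qed
        have pv: "0 < p n ^ (s * t) * real n ^ v" using pn n by simp
        have P4: "measure_pmf.prob (random_subset (rsets r n) (p n)) B4 \<le> 1 / ln (real n)"
        proof -
          have "measure_pmf.prob (random_subset (rsets r n) (p n)) B4
              \<le> p n ^ (s * t) * real n ^ v / (l * (p n ^ (s * t) * real n ^ v))"
            unfolding B4_def by (rule prob_copies[OF pn(1,3)]) (use l pv in simp)
          also have "\<dots> = 1 / l"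
          proof -
            have "a / (l * a) = 1 / l" if "0 < a" for a using that by simp
            from this[OF pv] show ?thesis .
          qed
          finally show ?thesis by (simp add: l_def)
        qed
        have good: "max (1 / (2 * c1) * p n * real n ^ (r - 1)) (real n powr (2 - x) * ln (real n) powr (- C)) \<le> real (ex n E) \<and>
          real (ex n E) \<le> max (C * p n * real n ^ (r - 1)) (real n powr (2 - x) * ln (real n) powr C)"
          if E: "E \<subseteq> rsets r n" "E \<notin> \<Union>(set [B1, B2, B3, B4])" for E
        proof -
          have nb: "E \<notin> B1" "E \<notin> B2" "E \<notin> B3" "E \<notin> B4" using E(2) by auto
          have "1 / (2 * c1) * p n * real n ^ (r - 1) \<le> \<mu>1 / 2"
            using m1 c12 by (simp add: field_simps)
          also have "\<dots> \<le> real (card (E \<inter> star r n))" using nb(2) unfolding B2_def mem_Collect_eq by linarith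
          also have "\<dots> \<le> ex n E" using ex_star[OF E(1)] by simp
          finally have low1: "1 / (2 * c1) * p n * real n ^ (r - 1) \<le> real (ex n E)" .
          define y where "y = real n powr (2 - x)"
          have y: "0 < y" "w n * p n * real n ^ r = y" "(w n * p n) ^ (s * t) * real n ^ v = y"
            using p0_identities(1,2)[OF n(1)] n by (auto simp: y_def wn(3))
          \<comment> \<open>Thinning to density \<open>p0 n / l\<close>, just below the point where
            copies catch up with edges. Edges lose one factor \<open>l\<close>, copies lose
            \<open>s * t \<ge> 4\<close> of them, and one of these is spent on Markov's
            inequality.\<close>
          define q where "q = w n / l"
          have q: "0 \<le> q" "q \<le> 1" using wn l by (auto simp: q_def divide_le_eq)
          have EE: "E \<inter> rsets r n = E" using E(1) by auto
          have cE: "\<mu>2 / 2 \<le> real (card E)" using nb(3) unfolding B3_def mem_Collect_eq EE by linarith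
          have XE: "real (X n E) \<le> l * (p n ^ (s * t) * real n ^ v)" using nb(4) by (simp add: B4_def)
          have t1: "2 * y / l\<^sup>2 \<le> q * card E"
          proof -
            have "w n * (p n * real n ^ r) \<le> w n * (c2 * \<mu>2)" using wn by (intro mult_left_mono m2) auto
            then have "y \<le> w n * (c2 * \<mu>2)" using y(2) by (simp only: mult.assoc)
            then have "y / (2 * c2 * l) \<le> w n * (c2 * \<mu>2) / (2 * c2 * l)" using c12 l by (intro divide_right_mono) auto
            also have "\<dots> = q * (\<mu>2 / 2)" using c12 by (simp add: q_def)
            also have "\<dots> \<le> q * card E" by (rule mult_left_mono[OF cE q(1)])
            finally have "y / (2 * c2 * l) \<le> q * card E" .
            moreover have "2 * y / l\<^sup>2 \<le> y / (2 * c2 * l)"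
            proof -
              have "y * (4 * c2) \<le> y * l" using l y by (intro mult_left_mono) auto
              then have "y * (4 * c2) / (2 * c2 * l * l) \<le> y * l / (2 * c2 * l * l)"
                using c12 l by (intro divide_right_mono) auto
              moreover have "y * (4 * c2) / (2 * c2 * l * l) = 2 * y / l\<^sup>2" "y * l / (2 * c2 * l * l) = y / (2 * c2 * l)"
                using c12 l by (simp_all add: power2_eq_square)
              ultimately show ?thesis by simp
            qed
            ultimately show ?thesis by linarith
          qed
          have t2: "q ^ (s * t) * X n E \<le> y / l\<^sup>2"
          proof -
            have "q ^ (s * t) * X n E \<le> q ^ (s * t) * (l * (p n ^ (s * t) * real n ^ v))"
              using q by (intro mult_left_mono XE) auto
            also have "\<dots> = y * (l / l ^ (s * t))"
              unfolding y(3)[symmetric] q_def by (simp add: power_divide power_mult_distrib)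
            also have "\<dots> \<le> y * (1 / l\<^sup>2)"
            proof (rule mult_left_mono)
              have "2 * 2 \<le> s * t" using s2 st by (intro mult_le_mono) auto
              then have "l ^ 3 \<le> l ^ (s * t)" using l by (intro power_increasing) auto
              then have "l / l ^ (s * t) \<le> l / l ^ 3" using l by (intro divide_left_mono) auto
              also have "\<dots> = 1 / l\<^sup>2" using l by (simp add: power2_eq_square power3_eq_cube)
              finally show "l / l ^ (s * t) \<le> 1 / l\<^sup>2" .
            qed (use y in simp)
            finally show ?thesis by simp
          qed
          have "y * ln (real n) powr (- C) \<le> y * (1 / l\<^sup>2)"
          proof (rule mult_left_mono)
            have "ln (real n) powr (- C) \<le> ln (real n) powr (- 2)" using l by (intro powr_mono) (auto simp: C_def l_def)
            also have "\<dots> = 1 / l\<^sup>2" using l by (simp add: l_def powr_minus inverse_eq_divide powr_numeral)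
            finally show "ln (real n) powr (- C) \<le> 1 / l\<^sup>2" .
          qed (use y in simp)
          also have "\<dots> = 2 * y / l\<^sup>2 - y / l\<^sup>2" by simp
          also have "\<dots> \<le> ex n E" using t1 t2 ex_deletion[OF E(1) q] by linarith
          finally show ?thesis using low1 B1(2)[OF E(1) nb(1)] by (simp add: y_def)
        qed
        have "measure_pmf.prob (random_subset (rsets r n) (p n))
          {E. \<not> (max (1 / (2 * c1) * p n * real n ^ (r - 1)) (real n powr (2 - x) * ln (real n) powr (- C)) \<le> real (ex n E) \<and>
            real (ex n E) \<le> max (C * p n * real n ^ (r - 1)) (real n powr (2 - x) * ln (real n) powr C))}
          \<le> (\<Sum>B\<leftarrow>[B1, B2, B3, B4]. measure_pmf.prob (random_subset (rsets r n) (p n)) B)"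
          by (rule prob_bad_le) (rule good)
        also have "\<dots> \<le> e n" unfolding e_def using B1(1) P2 P3 P4 by simp
        finally show ?case .
      qed
    qed
  qed
qed

section \<open>The sparse regime\<close>

lemma part2:
  assumes p: "\<And>n. 0 < p n \<and> p n \<le> 1" and lim1: "(\<lambda>n. real n powr (- real r)) \<lless> p" and lim2: "p \<lless> p0"
  shows "aas_asymp (\<lambda>n. random_rgraph r n (p n)) (\<lambda>n G. real (ex_num G F)) (\<lambda>n. p n * real (n choose r))"
proof -
  define c2 where "c2 = real (r ^ r)"
  have c2: "1 \<le> c2" using r3 by (simp add: c2_def one_le_power)
  \<comment> \<open>\<open>z\<close> bounds the reciprocal of the expected number of edges and
    \<rho> the ratio of expected copies to expected edges. Relative deviations of the fourth root of
    \<open>z\<close> and the square root of \<rho> leave error probabilities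
    \<open>sqrt (z n)\<close> and \<open>sqrt (\<rho> n)\<close>.\<close>
  define z where "z n = c2 * (real n powr (- real r) / p n)" for n
  define \<rho> where "\<rho> n = c2 * (p n / p0 n) ^ (s * t - 1)" for n
  have k1: "0 < s * t - 1"
  proof -
    have "2 * 2 \<le> s * t" using s2 st by (intro mult_le_mono) auto
    then show ?thesis by simp
  qed
  have z0: "z \<longlonglongrightarrow> 0"
    using tendsto_mult_left[OF lim1[unfolded much_less_def], of c2] unfolding z_def by simp
  have \<rho>0: "\<rho> \<longlonglongrightarrow> 0"
    using tendsto_mult_left[OF tendsto_power[OF lim2[unfolded much_less_def], of "s * t - 1"], of c2] k1
    unfolding \<rho>_def by (simp add: zero_power)
  have sq: "(\<lambda>n. sqrt (z n)) \<longlonglongrightarrow> 0" "(\<lambda>n. sqrt (\<rho> n)) \<longlonglongrightarrow> 0"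
    using tendsto_real_sqrt[OF z0] tendsto_real_sqrt[OF \<rho>0] by simp_all
  have ssq: "(\<lambda>n. sqrt (sqrt (z n))) \<longlonglongrightarrow> 0" using tendsto_real_sqrt[OF sq(1)] by simp
  have \<delta>0: "(\<lambda>n. sqrt (sqrt (z n)) + sqrt (\<rho> n)) \<longlonglongrightarrow> 0" using tendsto_add[OF ssq sq(2)] by simp
  have e0: "(\<lambda>n. sqrt (z n) + sqrt (\<rho> n)) \<longlonglongrightarrow> 0" using tendsto_add[OF sq] by simp
  have "aas (\<lambda>n. random_rgraph r n (p n)) (\<lambda>n G.
      \<bar>real (ex_num G F) - p n * real (n choose r)\<bar> \<le> (sqrt (sqrt (z n)) + sqrt (\<rho> n)) * (p n * real (n choose r)))"
  proof (rule aasI[OF p e0])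
    have "\<forall>\<^sub>F n::nat in sequentially. max 2 r \<le> n" by (rule eventually_ge_at_top)
    then show "\<forall>\<^sub>F n in sequentially. measure_pmf.prob (random_subset (rsets r n) (p n))
        {E. \<not> \<bar>real (ex n E) - p n * real (n choose r)\<bar> \<le> (sqrt (sqrt (z n)) + sqrt (\<rho> n)) * (p n * real (n choose r))}
        \<le> sqrt (z n) + sqrt (\<rho> n)"
    proof eventually_elim
      case (elim n)
      have n: "2 \<le> n" "r \<le> n" "0 < real n" using elim by auto
      have pn: "0 < p n" "0 \<le> p n" "p n \<le> 1" using p[of n] by auto
      have p0p: "0 < p0 n" by (rule p0_identities[OF n(1)])
      define \<mu> where "\<mu> = p n * real (n choose r)"
      have \<mu>0: "0 < \<mu>" using pn n by (simp add: \<mu>_def zero_less_binomial_iff)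
      have m2: "p n * real n ^ r \<le> c2 * \<mu>"
        using mult_left_mono[OF choose_ge[OF n(2)] pn(2)] by (simp add: \<mu>_def c2_def mult_ac)
      have zn: "0 < z n" "1 \<le> z n * \<mu>"
      proof -
        have zeq: "z n = c2 / (p n * real n ^ r)"
          using n by (simp add: z_def powr_minus powr_realpow inverse_eq_divide field_simps)
        then show "0 < z n" using pn n c2 by simp
        have "0 < p n * real n ^ r" using pn n by simp
        then show "1 \<le> z n * \<mu>" using m2 by (simp add: zeq le_divide_eq)
      qed
      have \<rho>n: "0 < \<rho> n" "p n ^ (s * t) * real n ^ v \<le> \<rho> n * \<mu>"
      proof -
        show "0 < \<rho> n" using pn p0p c2 by (simp add: \<rho>_def)
        have k: "s * t = Suc (s * t - 1)" using k1 by simp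
        have nv: "real n ^ v = p0 n * real n ^ r / p0 n ^ (s * t)"
          using p0_identities(1,2)[OF n(1)] p0p by (simp add: field_simps)
        have "p n ^ (s * t) * real n ^ v = (p n / p0 n) ^ (s * t - 1) * (p n * real n ^ r)"
          unfolding nv by (subst (1 2) k) (use p0p in \<open>simp add: power_divide\<close>)
        also have "\<dots> \<le> (p n / p0 n) ^ (s * t - 1) * (c2 * \<mu>)" using pn p0p by (intro mult_left_mono m2) auto
        finally show "p n ^ (s * t) * real n ^ v \<le> \<rho> n * \<mu>" by (simp add: \<rho>_def mult_ac)
      qed
      define B1 where "B1 = {E. sqrt (sqrt (z n)) * \<mu> \<le> \<bar>real (card (E \<inter> rsets r n)) - p n * card (rsets r n)\<bar>}"
      define B2 where "B2 = {E. sqrt (\<rho> n) * \<mu> \<le> X n E}"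
      have P1: "measure_pmf.prob (random_subset (rsets r n) (p n)) B1 \<le> sqrt (z n)"
      proof -
        have "measure_pmf.prob (random_subset (rsets r n) (p n)) B1 \<le> p n * card (rsets r n) / (sqrt (sqrt (z n)) * \<mu>)\<^sup>2"
          unfolding B1_def by (rule prob_card_deviation[OF finite_rsets pn(2,3)]) (use zn \<mu>0 in auto)
        also have "\<dots> = 1 / (sqrt (z n) * \<mu>)"
          using zn \<mu>0 by (simp add: card_rsets \<mu>_def[symmetric] power_mult_distrib power2_eq_square)
        also have "\<dots> \<le> sqrt (z n)"
        proof -
          have "sqrt (z n) * sqrt (z n) = z n" using zn by simp
          then have "1 \<le> sqrt (z n) * (sqrt (z n) * \<mu>)" using zn by (simp add: mult.assoc[symmetric])
          then show ?thesis using zn \<mu>0 by (simp add: divide_le_eq)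
        qed
        finally show ?thesis .
      qed
      have P2: "measure_pmf.prob (random_subset (rsets r n) (p n)) B2 \<le> sqrt (\<rho> n)"
      proof -
        have "measure_pmf.prob (random_subset (rsets r n) (p n)) B2 \<le> p n ^ (s * t) * real n ^ v / (sqrt (\<rho> n) * \<mu>)"
          unfolding B2_def by (rule prob_copies[OF pn(1,3)]) (use \<rho>n \<mu>0 in auto)
        also have "\<dots> \<le> \<rho> n * \<mu> / (sqrt (\<rho> n) * \<mu>)" using \<rho>n \<mu>0 by (intro divide_right_mono) auto
        also have "\<dots> = \<rho> n / sqrt (\<rho> n)" using \<mu>0 by simp
        also have "\<dots> = sqrt (\<rho> n)" using \<rho>n by (simp add: real_div_sqrt)
        finally show ?thesis .
      qed
      have good: "\<bar>real (ex n E) - p n * real (n choose r)\<bar> \<le> (sqrt (sqrt (z n)) + sqrt (\<rho> n)) * (p n * real (n choose r))"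
        if E: "E \<subseteq> rsets r n" "E \<notin> \<Union>(set [B1, B2])" for E
      proof -
        have "E \<inter> rsets r n = E" using E(1) by auto
        then have cE: "\<bar>real (card E) - \<mu>\<bar> \<le> sqrt (sqrt (z n)) * \<mu>" using E(2) by (simp add: B1_def card_rsets \<mu>_def)
        have XE: "real (X n E) \<le> sqrt (\<rho> n) * \<mu>" using E(2) by (simp add: B2_def)
        \<comment> \<open>Deletion without thinning, since below \<open>p0\<close> copies are rarer
          than edges.\<close>
        have "real (card E) - real (X n E) \<le> ex n E" using ex_deletion[OF E(1), of 1] by simp
        moreover have "real (ex n E) \<le> card E" using ex_le_card[OF E(1)] by simp
        moreover have "0 \<le> sqrt (\<rho> n) * \<mu>" using \<rho>n \<mu>0 by simp
        ultimately have "\<bar>real (ex n E) - \<mu>\<bar> \<le> sqrt (sqrt (z n)) * \<mu> + sqrt (\<rho> n) * \<mu>"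
          using cE XE by linarith
        then show ?thesis by (simp add: \<mu>_def distrib_right)
      qed
      have "measure_pmf.prob (random_subset (rsets r n) (p n))
          {E. \<not> \<bar>real (ex n E) - p n * real (n choose r)\<bar> \<le> (sqrt (sqrt (z n)) + sqrt (\<rho> n)) * (p n * real (n choose r))}
          \<le> (\<Sum>B\<leftarrow>[B1, B2]. measure_pmf.prob (random_subset (rsets r n) (p n)) B)"
        by (rule prob_bad_le) (rule good)
      also have "\<dots> \<le> sqrt (z n) + sqrt (\<rho> n)" using P1 P2 by simp
      finally show ?case .
    qed
  qed
  then show ?thesis unfolding aas_asymp_def using \<delta>0 by blast
qed

end

theorem theorem2p3:
  fixes r s t :: nat
  assumes "r \<ge> 2" and "s \<ge> 2" and "t \<ge> 2" and "t \<ge> s"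
    and "(int t \<ge> (int s)\<^sup>2 - 2 * int s + 3 \<and> r \<ge> s + 1) \<or> r \<ge> s + 2"
  shows "\<exists>c C :: real. c > 0 \<and> C > 0 \<and>
    (\<forall>p :: nat \<Rightarrow> real. (\<forall>n. 0 < p n \<and> p n \<le> 1) \<longrightarrow>
      ((\<lambda>n. real n powr (- real r + 2 - (real s + real t - 2) / (real s * real t - 1))) \<lless> p \<longrightarrow>
        aas (\<lambda>n. random_rgraph r n (p n))
          (\<lambda>n G.
            max (c * p n * real n ^ (r - 1))
                (real n powr (2 - (real s + real t - 2) / (real s * real t - 1)) * ln (real n) powr (- C))
              \<le> real (ex_num G (expansion r (complete_bipartite s t))) \<and>
            real (ex_num G (expansion r (complete_bipartite s t)))
              \<le> max (C * p n * real n ^ (r - 1))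
                  (real n powr (2 - (real s + real t - 2) / (real s * real t - 1)) * ln (real n) powr C)))
      \<and>
      ((\<lambda>n. real n powr (- real r)) \<lless> p \<and>
       p \<lless> (\<lambda>n. real n powr (- real r + 2 - (real s + real t - 2) / (real s * real t - 1))) \<longrightarrow>
        aas_asymp (\<lambda>n. random_rgraph r n (p n))
          (\<lambda>n G. real (ex_num G (expansion r (complete_bipartite s t))))
          (\<lambda>n. p n * real (n choose r))))"
proof -
  have "s + 1 \<le> t \<and> s + 1 \<le> r \<or> s + 2 \<le> r"
    using assms(5)
  proof
    assume *: "int t \<ge> (int s)\<^sup>2 - 2 * int s + 3 \<and> r \<ge> s + 1"
    \<comment> \<open>The number \<open>s ^ 2 - 2 * s + 3\<close> exceeds \<open>s + 1\<close> by
      \<open>(s - 1) * (s - 2)\<close>.\<close>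
    have "0 \<le> (int s - 1) * (int s - 2)" using assms(2) by (intro mult_nonneg_nonneg) auto
    then have "int s + 1 \<le> (int s)\<^sup>2 - 2 * int s + 3" by (simp add: power2_eq_square algebra_simps)
    then show ?thesis using * by linarith
  qed simp
  then interpret kst_turan s t r by unfold_locales (use assms in auto)
  have x: "(real s + real t - 2) / (real s * real t - 1) = x" by (simp add: x_def N_def)
  obtain c C where cC: "c > 0" "C > 0"
    "\<forall>p. (\<forall>n. 0 < p n \<and> p n \<le> 1) \<longrightarrow> p0 \<lless> p \<longrightarrow>
      aas (\<lambda>n. random_rgraph r n (p n)) (\<lambda>n G.
        max (c * p n * real n ^ (r - 1)) (real n powr (2 - x) * ln (real n) powr (- C)) \<le> real (ex_num G F) \<and>
        real (ex_num G F) \<le> max (C * p n * real n ^ (r - 1)) (real n powr (2 - x) * ln (real n) powr C))"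
    using part1 by (elim exE conjE) (rule that; assumption)
  show ?thesis
    unfolding x F_def[symmetric] p0_def[symmetric, abs_def]
  proof (rule exI[of _ c], rule exI[of _ C], intro conjI[OF cC(1) conjI[OF cC(2)]] allI impI conjI)
    fix p :: "nat \<Rightarrow> real"
    assume p: "\<forall>n. 0 < p n \<and> p n \<le> 1"
    show "aas_asymp (\<lambda>n. random_rgraph r n (p n)) (\<lambda>n G. real (ex_num G F)) (\<lambda>n. p n * real (n choose r))"
      if "(\<lambda>n. real n powr (- real r)) \<lless> p \<and> p \<lless> p0"
      using part2[of p] p that by blast
  qed (use cC(3) in blast)+
qed

end
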